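(* Assume the semiparametric model satisfies the standing assumptions A1--A7 of the context. Assume also that for every random sequence $\tilde\theta_n\in\Theta$, $\Delta_n(\tilde\theta_n)=o_P(1)$ implies $\tilde\theta_n=\theta_0+o_P(1)$, and that $\rho$ is a proper prior density on $\Theta$ with $\rho(\theta_0)>0$ having a continuous and finite first-order derivative in some neighborhood of $\theta_0$. Let $\varrho_n=(\theta-\hat\theta_n)\tilde I_0^{1/2}$ and let $r$ be a positive integer. If $\int_{-\infty}^{+\infty}|\theta|^r\rho(\theta)\,d\theta<\infty$, then $$\tilde E_{\theta|\tilde X}\,\varrho_n^r=n^{-r/2}\,EU^r+O_P(n^{-(r+1)/2}),$$ where $\tilde E_{\theta|\tilde X}\varrho_n^r$ is the $r$th moment of $\varrho_n$ under the posterior profile distribution $\tilde P_{\theta|\tilde X}$ and $U\sim N(0,1)$.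
   Context: Setting. The data $X_1,\dots,X_n$ are i.i.d. with values in a sample space $\mathcal X$, from a semiparametric model $\{p_{\theta,\eta}:\theta\in\Theta,\eta\in\mathcal H\}$ with $\Theta\subset\mathbb R$ and $\mathcal H$ an arbitrary (typically infinite-dimensional) set equipped with a norm $\|\cdot\|$; $(\theta_0,\eta_0)$ is the true parameter and $P=P_{\theta_0,\eta_0}$ the true law. $\mathrm{lik}(\theta,\eta)(x)$ is the likelihood of one observation, and $\mathrm{lik}_n(\theta,\eta)=\prod_{i=1}^n\mathrm{lik}(\theta,\eta)(X_i)$. The profile likelihood is $pl_n(\theta)=\sup_\eta \mathrm{lik}_n(\theta,\eta)$; $\hat\eta_\theta=\arg\max_\eta \mathrm{lik}_n(\theta,\eta)$; $(\hat\theta_n,\hat\eta_n)$, $\hat\eta_n=\hat\eta_{\hat\theta_n}$, is the maximum likelihood estimator for the full likelihood. Operator notation: $Pf=\int f\,dP$, $\mathbb P_nf=n^{-1}\sum_{i=1}^n f(X_i)$, $\mathbb G_nf=n^{-1/2}\sum_{i=1}^n(f(X_i)-Pf)$. Efficient score: $\tilde\ell_{\theta,\eta}=\dot\ell_{\theta,\eta}-\Pi_{\theta,\eta}\dot\ell_{\theta,\eta}$, where $\dot\ell_{\theta,\eta}$ is the score for $\theta$ (partial derivative of the log-likelihood in $\theta$, $\eta$ fixed) and $\Pi_{\theta,\eta}$ is the $L_2(P_{\theta,\eta})$-projection onto the closed linear span of the score functions for $\eta$. $\tilde I_{\theta,\eta}$ is the variance of $\tilde\ell_{\theta,\eta}$.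 Write $\tilde\ell_0=\tilde\ell_{\theta_0,\eta_0}$, $\tilde I_0=\tilde I_{\theta_0,\eta_0}=P\tilde\ell_0^2$. Least favorable submodel: a map $t\mapsto\eta_t(\theta,\eta)$ from a neighborhood of $\theta$ into $\mathcal H$ is given, and $\ell(t,\theta,\eta)(x)=\log\mathrm{lik}(t,\eta_t(\theta,\eta))(x)$. $\dot\ell,\ddot\ell,\ell^{(3)}$ denote the first, second and third derivatives of $\ell(t,\theta,\eta)$ in $t$; $\ell_{t,\theta}(t,\theta,\eta)$ is the derivative of $\dot\ell(t,\theta,\eta)$ in $\theta$. $\dot\ell_0=\dot\ell(\theta_0,\theta_0,\eta_0)$, $\ddot\ell_0=\ddot\ell(\theta_0,\theta_0,\eta_0)$. The submodel is least favorable at $(\theta_0,\eta_0)$, i.e. $\dot\ell_0=\tilde\ell_0$. Standing assumptions: A1. $\Theta\subset\mathbb R$ is compact and $\theta_0$ is an interior point of $\Theta$. A2. $\eta_\theta(\theta,\eta)=\eta$ for all $(\theta,\eta)\in\Theta\times\mathcal H$. A3. $\|\hat\eta_{\tilde\theta_n}-\eta_0\|=O_P(n^{-1/2}+|\tilde\theta_n-\theta_0|)$ whenever $\tilde\theta_n=\theta_0+o_P(1)$. A4. The maps $(t,\theta,\eta)\mapsto\frac{\partial^{l+m}}{\partial t^l\partial\theta^m}\ell(t,\theta,\eta)$ have integrable envelope functions in $L_1(P)$ in some neighborhood of $(\theta_0,\theta_0,\eta_0)$ for $(l,m)=(0,0),(1,0),(2,0),(3,0),(1,1),(1,2),(2,1)$.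 This smoothness is taken to imply $-P\dot\ell_0^2=P\ddot\ell_0$ and $\frac{\partial}{\partial\theta}P\dot\ell(\theta_0,\theta,\eta_0)|_{\theta=\theta_0}=0$. A5. There is a neighborhood $V$ of $(\theta_0,\theta_0,\eta_0)$ in $\Theta\times\Theta\times\mathcal H$ such that $\{\ddot\ell(t,\theta,\eta):(t,\theta,\eta)\in V\}$ and $\{\ell_{t,\theta}(t,\theta,\eta):(t,\theta,\eta)\in V\}$ are $P$-Donsker and $\{\ell^{(3)}(t,\theta,\eta):(t,\theta,\eta)\in V\}$ is $P$-Glivenko--Cantelli. A6. For all $\eta$ in some neighborhood of $\eta_0$: $\mathbb G_n(\dot\ell(\theta_0,\theta_0,\eta)-\dot\ell_0)=O_P(\|\eta-\eta_0\|)$; $P\ddot\ell(\theta_0,\theta_0,\eta)-P\ddot\ell(\theta_0,\theta_0,\eta_0)=O(\|\eta-\eta_0\|)$; $P\ell_{t,\theta}(\theta_0,\theta_0,\eta)-P\ell_{t,\theta}(\theta_0,\theta_0,\eta_0)=O(\|\eta-\eta_0\|)$; $P\dot\ell(\theta_0,\theta_0,\eta)=O(\|\eta-\eta_0\|^2)$. A7. $\tilde I_0>0$. Posterior profile distribution: $\tilde P_{\theta|\tilde X}$ is the distribution of $\theta$ with density proportional to $\rho(\theta)pl_n(\theta)$, given the data $\tilde X=(X_1,\dots,X_n)$; the prior density is extended by $0$ outside $\Theta$. Also $\Delta_n(\theta)=n^{-1}\{\log pl_n(\theta)-\log pl_n(\hat\theta_n)\}$. *)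

theory Defs
  imports "HOL-Probability.Probability"
begin

section \<open>Stochastic order symbols\<close>

text \<open>
  Profile likelihoods and argmax selections over an arbitrary nuisance set need not be measurable.
  As usual in empirical process theory, a random element is an arbitrary map on the underlying
  probability space, and \<open>o\<^sub>P\<close> and \<open>O\<^sub>P\<close> refer to outer probability.  The variables in
  \<open>op_zero\<close> are extended real because log-likelihood ratios may equal \<open>-\<infinity>\<close>.
\<close>

definition op_zero :: "'o measure \<Rightarrow> (nat \<Rightarrow> 'o \<Rightarrow> ereal) \<Rightarrow> bool" where
  "op_zero M Z \<longleftrightarrow>
     (\<forall>\<epsilon>>0. (\<lambda>n. outer_measure_of M {\<omega> \<in> space M. ereal \<epsilon> < \<bar>Z n \<omega>\<bar>}) \<longlonglongrightarrow> 0)"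

definition bigOp :: "'o measure \<Rightarrow> (nat \<Rightarrow> 'o \<Rightarrow> real) \<Rightarrow> (nat \<Rightarrow> 'o \<Rightarrow> real) \<Rightarrow> bool" where
  "bigOp M Z R \<longleftrightarrow>
     (\<forall>\<epsilon>>0. \<exists>C. \<forall>\<^sub>F n in sequentially.
        outer_measure_of M {\<omega> \<in> space M. C * R n \<omega> < \<bar>Z n \<omega>\<bar>} < ennreal \<epsilon>)"

text \<open>\<open>Z\<^sub>n(i) = O\<^sub>P(R(i))\<close> for all \<open>i \<in> I\<close>, with one constant for the whole index set.\<close>

definition bigOp_on ::
  "'o measure \<Rightarrow> 'i set \<Rightarrow> (nat \<Rightarrow> 'i \<Rightarrow> 'o \<Rightarrow> real) \<Rightarrow> ('i \<Rightarrow> real) \<Rightarrow> bool" where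
  "bigOp_on M I Z R \<longleftrightarrow>
     (\<forall>\<epsilon>>0. \<exists>C. \<forall>\<^sub>F n in sequentially.
        outer_measure_of M {\<omega> \<in> space M. \<exists>i\<in>I. C * R i < \<bar>Z n i \<omega>\<bar>} < ennreal \<epsilon>)"

section \<open>Empirical processes, Donsker and Glivenko--Cantelli classes\<close>

definition emp_mean :: "nat \<Rightarrow> ('x \<Rightarrow> real) \<Rightarrow> (nat \<Rightarrow> 'x) \<Rightarrow> real" where
  "emp_mean n f xs = (\<Sum>i<n. f (xs i)) / real n"

definition emp_proc :: "'x measure \<Rightarrow> nat \<Rightarrow> ('x \<Rightarrow> real) \<Rightarrow> (nat \<Rightarrow> 'x) \<Rightarrow> real" where
  "emp_proc P n f xs = (\<Sum>i<n. f (xs i) - (\<integral>x. f x \<partial>P)) / sqrt (real n)"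

definition L2_fun :: "'x measure \<Rightarrow> ('x \<Rightarrow> real) \<Rightarrow> bool" where
  "L2_fun P f \<longleftrightarrow> f \<in> borel_measurable P \<and> integrable P (\<lambda>x. (f x)\<^sup>2)"

definition outer_expectation :: "'o measure \<Rightarrow> ('o \<Rightarrow> real) \<Rightarrow> real" where
  "outer_expectation M Z =
     Inf {(\<integral>\<omega>. U \<omega> \<partial>M) | U. integrable M U \<and> (\<forall>\<omega>\<in>space M. Z \<omega> \<le> U \<omega>)}"

text \<open>
  The space \<open>\<ell>\<^sup>\<infinity>(F)\<close> is realised inside the Banach space of bounded (continuous) functions on the
  discrete space of all functions, an element of \<open>\<ell>\<^sup>\<infinity>(F)\<close> being extended by \<open>0\<close> outside \<open>F\<close>.
\<close>

type_synonym 'x linf = "('x \<Rightarrow> real) discrete \<Rightarrow>\<^sub>C real"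

definition emp_path :: "'x measure \<Rightarrow> ('x \<Rightarrow> real) set \<Rightarrow> nat \<Rightarrow> (nat \<Rightarrow> 'x) \<Rightarrow> 'x linf" where
  "emp_path P F n xs =
     Bcontfun (\<lambda>d. if of_discrete d \<in> F then emp_proc P n (of_discrete d) xs else 0)"

text \<open>
  Weak convergence in the sense of Hoffmann-Jorgensen of the empirical process in \<open>\<ell>\<^sup>\<infinity>(F)\<close>
  to a tight Borel law \<open>L\<close>; the observations are the coordinate projections of \<open>P\<^sup>\<infinity>\<close>.
  That \<open>L\<close> is Gaussian is then a consequence of the finite-dimensional central limit theorem.
  The boundedness condition makes the sample paths elements of \<open>\<ell>\<^sup>\<infinity>(F)\<close>.
\<close>

definition donsker :: "'x measure \<Rightarrow> ('x \<Rightarrow> real) set \<Rightarrow> bool" where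
  "donsker P F \<longleftrightarrow>
     (\<forall>f\<in>F. L2_fun P f) \<and>
     (AE x in P. \<exists>B. \<forall>f\<in>F. \<bar>f x - (\<integral>y. f y \<partial>P)\<bar> \<le> B) \<and>
     (\<exists>L :: 'x linf measure.
        prob_space L \<and> sets L = sets borel \<and>
        (\<forall>\<epsilon>>0. \<exists>K. compact K \<and> measure L K > 1 - \<epsilon>) \<and>
        (\<forall>h :: 'x linf \<Rightarrow> real. continuous_on UNIV h \<and> bounded (range h) \<longrightarrow>
           (\<lambda>n. outer_expectation (PiM UNIV (\<lambda>_. P)) (\<lambda>xs. h (emp_path P F n xs)))
             \<longlonglongrightarrow> (\<integral>z. h z \<partial>L)))"

text \<open>Uniform convergence outer almost surely: the supremum has measurable majorants tending to 0.\<close>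

definition glivenko_cantelli :: "'x measure \<Rightarrow> ('x \<Rightarrow> real) set \<Rightarrow> bool" where
  "glivenko_cantelli P F \<longleftrightarrow>
     (\<forall>f\<in>F. integrable P f) \<and>
     (\<exists>U :: nat \<Rightarrow> (nat \<Rightarrow> 'x) \<Rightarrow> ereal.
        (\<forall>n. U n \<in> borel_measurable (PiM UNIV (\<lambda>_. P))) \<and>
        (\<forall>n. \<forall>xs\<in>space (PiM UNIV (\<lambda>_. P)). \<forall>f\<in>F.
           ereal \<bar>emp_mean n f xs - (\<integral>x. f x \<partial>P)\<bar> \<le> U n xs) \<and>
        (AE xs in PiM UNIV (\<lambda>_. P). (\<lambda>n. U n xs) \<longlonglongrightarrow> 0))"

section \<open>Semiparametric models and efficient scores\<close>

text \<open>
  \<open>lik \<theta> \<eta>\<close> is the density of \<open>P\<^sub>\<theta>\<^sub>,\<^sub>\<eta>\<close> with respect to a dominating measure \<open>\<mu>\<close>.  The nuisance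
  set \<open>H\<close> is a subset of a normed space.
\<close>

definition law :: "'x measure \<Rightarrow> (real \<Rightarrow> 'h \<Rightarrow> 'x \<Rightarrow> real) \<Rightarrow> real \<Rightarrow> 'h \<Rightarrow> 'x measure" where
  "law \<mu> lik \<theta> \<eta> = density \<mu> (\<lambda>x. ennreal (lik \<theta> \<eta> x))"

definition semiparametric_model ::
  "'x measure \<Rightarrow> real set \<Rightarrow> 'h set \<Rightarrow> (real \<Rightarrow> 'h \<Rightarrow> 'x \<Rightarrow> real) \<Rightarrow> bool" where
  "semiparametric_model \<mu> \<Theta> H lik \<longleftrightarrow>
     sigma_finite_measure \<mu> \<and>
     (\<forall>\<theta>\<in>\<Theta>. \<forall>\<eta>\<in>H. lik \<theta> \<eta> \<in> borel_measurable \<mu> \<and> (\<forall>x\<in>space \<mu>. 0 \<le> lik \<theta> \<eta> x) \<and>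
        prob_space (law \<mu> lik \<theta> \<eta>))"

text \<open>
  The score for \<open>\<theta>\<close>, with \<open>\<eta>\<close> fixed.  Positivity near \<open>\<theta>\<close> is required explicitly because
  \<open>ln\<close> is totalised by \<open>ln 0 = 0\<close>.
\<close>

definition is_theta_score ::
  "'x measure \<Rightarrow> (real \<Rightarrow> 'h \<Rightarrow> 'x \<Rightarrow> real) \<Rightarrow> real \<Rightarrow> 'h \<Rightarrow> ('x \<Rightarrow> real) \<Rightarrow> bool" where
  "is_theta_score \<mu> lik \<theta> \<eta> s \<longleftrightarrow>
     L2_fun (law \<mu> lik \<theta> \<eta>) s \<and>
     (AE x in law \<mu> lik \<theta> \<eta>.
        (\<forall>\<^sub>F t in nhds \<theta>. 0 < lik t \<eta> x) \<and>
        ((\<lambda>t. ln (lik t \<eta> x)) has_real_derivative s x) (at \<theta>))"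

text \<open>
  Score functions for \<open>\<eta>\<close>: scores at \<open>u = 0\<close> of one-dimensional submodels \<open>u \<mapsto> \<gamma> u\<close> of \<open>H\<close>
  through \<open>\<eta>\<close> (\<open>\<theta>\<close> fixed) that are differentiable in quadratic mean.
\<close>

definition nuisance_scores ::
  "'x measure \<Rightarrow> 'h set \<Rightarrow> (real \<Rightarrow> 'h \<Rightarrow> 'x \<Rightarrow> real) \<Rightarrow> real \<Rightarrow> 'h \<Rightarrow> ('x \<Rightarrow> real) set" where
  "nuisance_scores \<mu> H lik \<theta> \<eta> =
     {g. L2_fun (law \<mu> lik \<theta> \<eta>) g \<and>
         (\<exists>\<gamma> :: real \<Rightarrow> 'h. \<gamma> 0 = \<eta> \<and> (\<forall>\<^sub>F u in at_right 0. \<gamma> u \<in> H) \<and>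
            ((\<lambda>u. \<integral>\<^sup>+x. ennreal (((sqrt (lik \<theta> (\<gamma> u) x) - sqrt (lik \<theta> \<eta> x)) / u
                     - g x * sqrt (lik \<theta> \<eta> x) / 2)\<^sup>2) \<partial>\<mu>) \<longlongrightarrow> 0) (at_right 0))}"

definition L2_closed_span :: "'x measure \<Rightarrow> ('x \<Rightarrow> real) set \<Rightarrow> ('x \<Rightarrow> real) set" where
  "L2_closed_span P S =
     {k. L2_fun P k \<and>
         (\<forall>\<epsilon>>0. \<exists>T c. finite T \<and> T \<subseteq> S \<and>
            (\<integral>x. (k x - (\<Sum>g\<in>T. c g * g x))\<^sup>2 \<partial>P) < \<epsilon>)}"

definition is_L2_projection ::
  "'x measure \<Rightarrow> ('x \<Rightarrow> real) set \<Rightarrow> ('x \<Rightarrow> real) \<Rightarrow> ('x \<Rightarrow> real) \<Rightarrow> bool" where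
  "is_L2_projection P K f p \<longleftrightarrow> p \<in> K \<and> (\<forall>k\<in>K. (\<integral>x. (f x - p x) * k x \<partial>P) = 0)"

text \<open>Efficient scores are determined up to null sets only, hence a predicate.\<close>

definition is_efficient_score ::
  "'x measure \<Rightarrow> 'h set \<Rightarrow> (real \<Rightarrow> 'h \<Rightarrow> 'x \<Rightarrow> real) \<Rightarrow> real \<Rightarrow> 'h \<Rightarrow> ('x \<Rightarrow> real) \<Rightarrow> bool" where
  "is_efficient_score \<mu> H lik \<theta> \<eta> e \<longleftrightarrow>
     (\<exists>s p. is_theta_score \<mu> lik \<theta> \<eta> s \<and>
        is_L2_projection (law \<mu> lik \<theta> \<eta>)
          (L2_closed_span (law \<mu> lik \<theta> \<eta>) (nuisance_scores \<mu> H lik \<theta> \<eta>)) s p \<and>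
        e = (\<lambda>x. s x - p x))"

definition efficient_info :: "'x measure \<Rightarrow> ('x \<Rightarrow> real) \<Rightarrow> real" where
  "efficient_info P e = (\<integral>x. (e x - (\<integral>y. e y \<partial>P))\<^sup>2 \<partial>P)"

section \<open>Profile likelihood and maximum likelihood\<close>

definition lik_n ::
  "(real \<Rightarrow> 'h \<Rightarrow> 'x \<Rightarrow> real) \<Rightarrow> nat \<Rightarrow> (nat \<Rightarrow> 'x) \<Rightarrow> real \<Rightarrow> 'h \<Rightarrow> real" where
  "lik_n lik n xs \<theta> \<eta> = (\<Prod>i<n. lik \<theta> \<eta> (xs i))"

text \<open>The real supremum is only used where it is attained (see \<open>is_mle\<close>).\<close>

definition prof_lik ::
  "'h set \<Rightarrow> (real \<Rightarrow> 'h \<Rightarrow> 'x \<Rightarrow> real) \<Rightarrow> nat \<Rightarrow> (nat \<Rightarrow> 'x) \<Rightarrow> real \<Rightarrow> real" where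
  "prof_lik H lik n xs \<theta> = (SUP \<eta>\<in>H. lik_n lik n xs \<theta> \<eta>)"

text \<open>
  For one data sequence: \<open>\<eta>h \<theta>\<close> maximises the likelihood over \<open>H\<close> at fixed \<open>\<theta>\<close>, and
  \<open>(\<theta>h, \<eta>h \<theta>h)\<close> maximises it over \<open>\<Theta> \<times> H\<close>.
\<close>

definition is_mle ::
  "real set \<Rightarrow> 'h set \<Rightarrow> (real \<Rightarrow> 'h \<Rightarrow> 'x \<Rightarrow> real) \<Rightarrow> nat \<Rightarrow> (nat \<Rightarrow> 'x) \<Rightarrow>
     real \<Rightarrow> (real \<Rightarrow> 'h) \<Rightarrow> bool" where
  "is_mle \<Theta> H lik n xs \<theta>h \<eta>h \<longleftrightarrow>
     (\<forall>\<theta>\<in>\<Theta>. \<eta>h \<theta> \<in> H \<and> (\<forall>\<eta>\<in>H. lik_n lik n xs \<theta> \<eta> \<le> lik_n lik n xs \<theta> (\<eta>h \<theta>))) \<and>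
     \<theta>h \<in> \<Theta> \<and> (\<forall>\<theta>\<in>\<Theta>. \<forall>\<eta>\<in>H. lik_n lik n xs \<theta> \<eta> \<le> lik_n lik n xs \<theta>h (\<eta>h \<theta>h))"

definition ext_ln :: "real \<Rightarrow> ereal" where
  "ext_ln x = (if 0 < x then ereal (ln x) else - \<infinity>)"

definition Delta_n ::
  "'h set \<Rightarrow> (real \<Rightarrow> 'h \<Rightarrow> 'x \<Rightarrow> real) \<Rightarrow> nat \<Rightarrow> (nat \<Rightarrow> 'x) \<Rightarrow> real \<Rightarrow> real \<Rightarrow> ereal" where
  "Delta_n H lik n xs \<theta>h \<theta> =
     (ext_ln (prof_lik H lik n xs \<theta>) - ext_ln (prof_lik H lik n xs \<theta>h)) / ereal (real n)"

definition profile_posterior :: "(real \<Rightarrow> real) \<Rightarrow> (real \<Rightarrow> real) \<Rightarrow> real measure" where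
  "profile_posterior \<rho> pl =
     density lborel (\<lambda>\<theta>. ennreal (\<rho> \<theta> * pl \<theta> / (\<integral>t. \<rho> t * pl t \<partial>lborel)))"

section \<open>Least favorable submodel\<close>

definition ell ::
  "(real \<Rightarrow> 'h \<Rightarrow> 'x \<Rightarrow> real) \<Rightarrow> (real \<Rightarrow> real \<Rightarrow> 'h \<Rightarrow> 'h) \<Rightarrow>
     real \<Rightarrow> real \<Rightarrow> 'h \<Rightarrow> 'x \<Rightarrow> real" where
  "ell lik \<eta>sub t \<theta> \<eta> x = ln (lik t (\<eta>sub t \<theta> \<eta>) x)"

text \<open>
  \<open>ell_deriv lik \<eta>sub l m t \<theta> \<eta> x\<close>: \<open>l\<close> derivatives in \<open>t\<close>, followed by \<open>m\<close> derivatives in \<open>\<theta>\<close>.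
\<close>

definition ell_deriv ::
  "(real \<Rightarrow> 'h \<Rightarrow> 'x \<Rightarrow> real) \<Rightarrow> (real \<Rightarrow> real \<Rightarrow> 'h \<Rightarrow> 'h) \<Rightarrow> nat \<Rightarrow> nat \<Rightarrow>
     real \<Rightarrow> real \<Rightarrow> 'h \<Rightarrow> 'x \<Rightarrow> real" where
  "ell_deriv lik \<eta>sub l m t \<theta> \<eta> x =
     (deriv ^^ m) (\<lambda>\<theta>'. (deriv ^^ l) (\<lambda>t'. ell lik \<eta>sub t' \<theta>' \<eta> x) t) \<theta>"

text \<open>A base of neighborhoods of \<open>(\<theta>0, \<theta>0, \<eta>0)\<close> in \<open>\<Theta> \<times> \<Theta> \<times> H\<close>.\<close>

definition nbhd3 ::
  "real set \<Rightarrow> 'h::real_normed_vector set \<Rightarrow> real \<Rightarrow> 'h \<Rightarrow> real \<Rightarrow> (real \<times> real \<times> 'h) set" where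
  "nbhd3 \<Theta> H \<theta>0 \<eta>0 \<delta> =
     {(t, \<theta>, \<eta>). t \<in> \<Theta> \<and> \<theta> \<in> \<Theta> \<and> \<eta> \<in> H \<and>
        \<bar>t - \<theta>0\<bar> < \<delta> \<and> \<bar>\<theta> - \<theta>0\<bar> < \<delta> \<and> norm (\<eta> - \<eta>0) < \<delta>}"

text \<open>
  The submodel passes through \<open>(\<theta>, \<eta>)\<close> and stays in \<open>H\<close> for \<open>t\<close> near \<open>\<theta>\<close>, and on a neighborhood
  of \<open>(\<theta>0, \<theta>0, \<eta>0)\<close> of uniform size.
\<close>

definition is_submodel ::
  "real set \<Rightarrow> 'h::real_normed_vector set \<Rightarrow> real \<Rightarrow> 'h \<Rightarrow> (real \<Rightarrow> real \<Rightarrow> 'h \<Rightarrow> 'h) \<Rightarrow> bool" where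
  "is_submodel \<Theta> H \<theta>0 \<eta>0 \<eta>sub \<longleftrightarrow>
     (\<forall>\<theta>\<in>\<Theta>. \<forall>\<eta>\<in>H. \<eta>sub \<theta> \<theta> \<eta> = \<eta>) \<and>
     (\<forall>\<theta>\<in>\<Theta>. \<forall>\<eta>\<in>H. \<exists>\<delta>>0. \<forall>t\<in>\<Theta>. \<bar>t - \<theta>\<bar> < \<delta> \<longrightarrow> \<eta>sub t \<theta> \<eta> \<in> H) \<and>
     (\<exists>\<delta>>0. \<forall>(t, \<theta>, \<eta>) \<in> nbhd3 \<Theta> H \<theta>0 \<eta>0 \<delta>. \<eta>sub t \<theta> \<eta> \<in> H)"

text \<open>Existence of the partial derivatives used below, at a single sample point \<open>x\<close>.\<close>

definition ell_smooth ::
  "(real \<Rightarrow> 'h \<Rightarrow> 'x \<Rightarrow> real) \<Rightarrow> (real \<Rightarrow> real \<Rightarrow> 'h \<Rightarrow> 'h) \<Rightarrow>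
     (real \<times> real \<times> 'h) set \<Rightarrow> 'x \<Rightarrow> bool" where
  "ell_smooth lik \<eta>sub V x \<longleftrightarrow>
     (\<forall>(t, \<theta>, \<eta>) \<in> V.
        0 < lik t (\<eta>sub t \<theta> \<eta>) x \<and>
        (\<forall>l\<in>{0, 1, 2}. (\<lambda>t'. ell_deriv lik \<eta>sub l 0 t' \<theta> \<eta> x) field_differentiable (at t)) \<and>
        (\<forall>(l, m)\<in>{(1, 0), (1, 1), (2, 0)}.
           (\<lambda>\<theta>'. ell_deriv lik \<eta>sub l m t \<theta>' \<eta> x) field_differentiable (at \<theta>)))"

definition smooth_envelopes ::
  "'x measure \<Rightarrow> (real \<Rightarrow> 'h \<Rightarrow> 'x \<Rightarrow> real) \<Rightarrow> (real \<Rightarrow> real \<Rightarrow> 'h \<Rightarrow> 'h) \<Rightarrow>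
     (real \<times> real \<times> 'h) set \<Rightarrow> bool" where
  "smooth_envelopes P lik \<eta>sub V \<longleftrightarrow>
     (AE x in P. ell_smooth lik \<eta>sub V x) \<and>
     (\<forall>(l, m)\<in>{(0, 0), (1, 0), (2, 0), (3, 0), (1, 1), (1, 2), (2, 1)}.
        (\<forall>(t, \<theta>, \<eta>)\<in>V. ell_deriv lik \<eta>sub l m t \<theta> \<eta> \<in> borel_measurable P) \<and>
        (\<exists>F. integrable P F \<and>
           (AE x in P. \<forall>(t, \<theta>, \<eta>)\<in>V. \<bar>ell_deriv lik \<eta>sub l m t \<theta> \<eta> x\<bar> \<le> F x)))"

definition ell_class ::
  "(real \<Rightarrow> 'h \<Rightarrow> 'x \<Rightarrow> real) \<Rightarrow> (real \<Rightarrow> real \<Rightarrow> 'h \<Rightarrow> 'h) \<Rightarrow> nat \<Rightarrow> nat \<Rightarrow>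
     (real \<times> real \<times> 'h) set \<Rightarrow> ('x \<Rightarrow> real) set" where
  "ell_class lik \<eta>sub l m V = (\<lambda>(t, \<theta>, \<eta>). ell_deriv lik \<eta>sub l m t \<theta> \<eta>) ` V"

section \<open>Priors\<close>

definition proper_prior :: "real set \<Rightarrow> (real \<Rightarrow> real) \<Rightarrow> bool" where
  "proper_prior \<Theta> \<rho> \<longleftrightarrow>
     \<rho> \<in> borel_measurable borel \<and> (\<forall>\<theta>. 0 \<le> \<rho> \<theta>) \<and> (\<forall>\<theta>. \<theta> \<notin> \<Theta> \<longrightarrow> \<rho> \<theta> = 0) \<and>
     (\<integral>\<^sup>+\<theta>. ennreal (\<rho> \<theta>) \<partial>lborel) = 1"

end

theory Submission
  imports Defs
begin

text \<open>
  Put \<open>e = n\<^sup>-\<^sup>1\<^sup>/\<^sup>2\<close>, \<open>h = \<theta> - \<theta>hat\<close> and let \<open>I\<close> be the efficient information.  The posterior moment is a quotient of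
  two integrals over \<open>\<theta>\<close>, and the result follows from Laplace's method once the profile likelihood is known to satisfy

  \<open>ln (pl \<theta> / pl \<theta>hat) = - n I h\<^sup>2 / 2 + O (n \<bar>h\<bar> (e + \<bar>h\<bar>)\<^sup>2)\<close> for \<open>\<theta>\<close> near \<open>\<theta>0\<close>, and
  \<open>pl \<theta> \<le> pl \<theta>hat * exp (- c n)\<close> elsewhere in \<open>\<Theta>\<close>,

  on events of probability close to one.  In the variable \<open>u = h / e\<close> the remainder is of order \<open>e \<bar>u\<bar> (1 + \<bar>u\<bar>)\<^sup>2\<close>;
  on a fixed small neighborhood half of the Gaussian exponent dominates it (\<open>weight_near_gaussian\<close>), so both integrals
  are rescaled Gaussian moments up to an error that is smaller by a factor of order \<open>e\<close> (\<open>posterior_moment_expansion\<close>).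

  The quadratic expansion comes from sandwiching the profile likelihood between two least favorable submodels, through
  \<open>(\<theta>, \<eta>hat \<theta>)\<close> and through \<open>(\<theta>hat, \<eta>hat \<theta>hat)\<close> (\<open>profile_expansion\<close>).  Along each of them the averaged score is
  \<open>Z - I (t - \<theta>0)\<close> with the same \<open>Z\<close>, the averaged efficient score at the truth, up to a quadratic error
  (\<open>score_linear\<close>).  At the maximum likelihood estimator the score of its submodel vanishes, hence
  \<open>Z = I (\<theta>hat - \<theta>0) + O (e\<^sup>2)\<close>.  It is this equation, rather than a comparison of likelihood values, that gives an error of order
  \<open>e\<^sup>2\<close>: comparing values would only yield \<open>e\<^sup>3\<^sup>/\<^sup>2\<close>, which is too weak for the remainder claimed in the theorem.

  The stochastic input is collected in the locale \<open>regular_sample\<close>.  Envelopes bound the remainders by Markov's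
  inequality, and a Donsker class has an empirical process that is bounded in probability, uniformly over the class
  (\<open>likely_donsker\<close>).  The hypotheses about arbitrary random sequences \<open>tt\<close> are turned into bounds that hold simultaneously
  for all parameter values by selecting a sequence of worst cases (\<open>diagonal_selection\<close>); this yields the rate of
  the nuisance estimator and the exponential separation.
\<close>

section \<open>Outer probability and events of high probability\<close>

lemma outer_measure_of_Un_le:
  assumes "A \<subseteq> space M" "B \<subseteq> space M"
  shows "outer_measure_of M (A \<union> B) \<le> outer_measure_of M A + outer_measure_of M B"
proof -
  obtain E F where E: "E \<in> sets M" "A \<subseteq> E" "outer_measure_of M A = emeasure M E"
    and F: "F \<in> sets M" "B \<subseteq> F" "outer_measure_of M B = emeasure M F"
    using outer_measure_of_attain[OF assms(1)] outer_measure_of_attain[OF assms(2)] by blast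
  have "outer_measure_of M (A \<union> B) \<le> outer_measure_of M (E \<union> F)"
    using E F by (intro outer_measure_of_mono) auto
  also have "\<dots> \<le> emeasure M E + emeasure M F"
    using E F by (simp add: emeasure_subadditive)
  finally show ?thesis using E F by simp
qed

lemma outer_measure_of_AE_not:
  assumes "AE \<omega> in M. Q \<omega>"
  shows "outer_measure_of M {\<omega> \<in> space M. \<not> Q \<omega>} = 0"
proof -
  obtain N where N: "{\<omega> \<in> space M. \<not> Q \<omega>} \<subseteq> N" "emeasure M N = 0" "N \<in> sets M"
    using AE_E[OF assms] by blast
  then have "outer_measure_of M {\<omega> \<in> space M. \<not> Q \<omega>} \<le> outer_measure_of M N"
    by (intro outer_measure_of_mono)
  then show ?thesis using N by simp
qed

lemma outer_measure_of_vimage_le: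
  assumes "f \<in> measurable M N" "A \<subseteq> space N"
  shows "outer_measure_of M (f -` A \<inter> space M) \<le> outer_measure_of (distr M N f) A"
proof -
  obtain E where E: "E \<in> sets N" "A \<subseteq> E"
    "outer_measure_of (distr M N f) A = emeasure (distr M N f) E"
    using outer_measure_of_attain[of A "distr M N f"] assms by auto
  have "outer_measure_of M (f -` A \<inter> space M) \<le> outer_measure_of M (f -` E \<inter> space M)"
    using E by (intro outer_measure_of_mono) auto
  also have "\<dots> = emeasure M (f -` E \<inter> space M)"
    using E assms by (intro outer_measure_of_eq) auto
  also have "\<dots> = emeasure (distr M N f) E"
    using E assms by (simp add: emeasure_distr)
  finally show ?thesis using E by simp
qed

text \<open>
  Every \<open>O\<^sub>P\<close> statement of the proof is read as: with outer probability close to one a deterministic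
  inequality holds with a large constant \<open>K\<close>.  The parameter \<open>K\<close> is shared between all inequalities of
  an event, so that finitely many \<open>O\<^sub>P\<close> statements can be intersected and the rest of
  the argument takes place at a single outcome \<open>\<omega>\<close>.
\<close>

definition likely :: "'o measure \<Rightarrow> (real \<Rightarrow> nat \<Rightarrow> 'o \<Rightarrow> bool) \<Rightarrow> bool" where
  "likely M Q \<longleftrightarrow>
     (\<forall>\<epsilon>>0. \<exists>K. \<forall>\<^sub>F n in sequentially.
        outer_measure_of M {\<omega> \<in> space M. \<not> Q K n \<omega>} < ennreal \<epsilon>)"

lemma likelyI:
  assumes "\<And>\<epsilon>. \<epsilon> > 0 \<Longrightarrow> \<exists>K. \<forall>\<^sub>F n in sequentially.
        outer_measure_of M {\<omega> \<in> space M. \<not> Q K n \<omega>} < ennreal \<epsilon>"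
  shows "likely M Q"
  using assms unfolding likely_def by blast

lemma likely_AE:
  assumes "\<And>n. AE \<omega> in M. Q n \<omega>"
  shows "likely M (\<lambda>_. Q)"
  by (intro likelyI) (simp add: outer_measure_of_AE_not[OF assms])

lemma likely_weaken:
  assumes "likely M Q"
    and "\<And>K. \<exists>K'. \<forall>\<^sub>F n in sequentially. \<forall>\<omega>\<in>space M. Q K n \<omega> \<longrightarrow> R K' n \<omega>"
  shows "likely M R"
proof (rule likelyI)
  fix \<epsilon> :: real assume "\<epsilon> > 0"
  then obtain K where K: "\<forall>\<^sub>F n in sequentially.
      outer_measure_of M {\<omega> \<in> space M. \<not> Q K n \<omega>} < ennreal \<epsilon>"
    using assms(1) unfolding likely_def by blast
  obtain K' where "\<forall>\<^sub>F n in sequentially. \<forall>\<omega>\<in>space M. Q K n \<omega> \<longrightarrow> R K' n \<omega>"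
    using assms(2) by blast
  with K have "\<forall>\<^sub>F n in sequentially.
      outer_measure_of M {\<omega> \<in> space M. \<not> R K' n \<omega>} < ennreal \<epsilon>"
  proof eventually_elim
    case (elim n)
    have "outer_measure_of M {\<omega> \<in> space M. \<not> R K' n \<omega>}
      \<le> outer_measure_of M {\<omega> \<in> space M. \<not> Q K n \<omega>}"
      using elim by (intro outer_measure_of_mono) blast
    with elim show ?case by (meson le_less_trans)
  qed
  then show "\<exists>K. \<forall>\<^sub>F n in sequentially.
      outer_measure_of M {\<omega> \<in> space M. \<not> R K n \<omega>} < ennreal \<epsilon>" by blast
qed

lemma outer_measure_conj_less:
  assumes "outer_measure_of M {\<omega> \<in> space M. \<not> Q \<omega>} < ennreal \<epsilon>"
    and "outer_measure_of M {\<omega> \<in> space M. \<not> R \<omega>} < ennreal \<delta>"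
    and "0 \<le> \<epsilon>" "0 \<le> \<delta>"
  shows "outer_measure_of M {\<omega> \<in> space M. \<not> (Q \<omega> \<and> R \<omega>)} < ennreal (\<epsilon> + \<delta>)"
proof -
  have "{\<omega> \<in> space M. \<not> (Q \<omega> \<and> R \<omega>)} = {\<omega> \<in> space M. \<not> Q \<omega>} \<union> {\<omega> \<in> space M. \<not> R \<omega>}"
    by blast
  also have "outer_measure_of M \<dots>
      \<le> outer_measure_of M {\<omega> \<in> space M. \<not> Q \<omega>} + outer_measure_of M {\<omega> \<in> space M. \<not> R \<omega>}"
    by (intro outer_measure_of_Un_le) auto
  also have "\<dots> < ennreal \<epsilon> + ennreal \<delta>"
    using assms by (intro add_strict_mono) auto
  finally show ?thesis using assms by simp
qed

lemma likely_conj: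
  assumes Q: "likely M Q" "mono Q" and R: "likely M R" "mono R"
  shows "likely M (\<lambda>K n \<omega>. Q K n \<omega> \<and> R K n \<omega>)"
proof (rule likelyI)
  fix \<epsilon> :: real assume "\<epsilon> > 0"
  then obtain K1 K2 where
    1: "\<forall>\<^sub>F n in sequentially. outer_measure_of M {\<omega> \<in> space M. \<not> Q K1 n \<omega>} < ennreal (\<epsilon> / 2)"
    and 2: "\<forall>\<^sub>F n in sequentially. outer_measure_of M {\<omega> \<in> space M. \<not> R K2 n \<omega>} < ennreal (\<epsilon> / 2)"
    using Q(1) R(1) unfolding likely_def by (meson half_gt_zero)
  let ?K = "max K1 K2"
  from 1 2 have "\<forall>\<^sub>F n in sequentially.
      outer_measure_of M {\<omega> \<in> space M. \<not> (Q ?K n \<omega> \<and> R ?K n \<omega>)} < ennreal \<epsilon>"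
  proof eventually_elim
    case (elim n)
    have "outer_measure_of M {\<omega> \<in> space M. \<not> (Q ?K n \<omega> \<and> R ?K n \<omega>)}
        \<le> outer_measure_of M {\<omega> \<in> space M. \<not> (Q K1 n \<omega> \<and> R K2 n \<omega>)}"
      using monoD[OF Q(2), of K1 ?K] monoD[OF R(2), of K2 ?K]
      by (intro outer_measure_of_mono) (auto simp: le_fun_def)
    also have "\<dots> < ennreal (\<epsilon> / 2 + \<epsilon> / 2)"
      using elim \<open>\<epsilon> > 0\<close> by (intro outer_measure_conj_less) auto
    finally show ?case by simp
  qed
  then show "\<exists>K. \<forall>\<^sub>F n in sequentially.
      outer_measure_of M {\<omega> \<in> space M. \<not> (Q K n \<omega> \<and> R K n \<omega>)} < ennreal \<epsilon>" by blast
qed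

lemma likely_ge:
  assumes "likely M Q" "mono Q" "0 < \<epsilon>"
  obtains K where "b \<le> K"
    "\<forall>\<^sub>F n in sequentially. outer_measure_of M {\<omega> \<in> space M. \<not> Q K n \<omega>} < ennreal \<epsilon>"
proof -
  obtain K where K: "\<forall>\<^sub>F n in sequentially. outer_measure_of M {\<omega> \<in> space M. \<not> Q K n \<omega>} < ennreal \<epsilon>"
    using assms unfolding likely_def by blast
  have "\<forall>\<^sub>F n in sequentially. outer_measure_of M {\<omega> \<in> space M. \<not> Q (max K b) n \<omega>} < ennreal \<epsilon>"
    using K
  proof eventually_elim
    case (elim n)
    have "outer_measure_of M {\<omega> \<in> space M. \<not> Q (max K b) n \<omega>}
        \<le> outer_measure_of M {\<omega> \<in> space M. \<not> Q K n \<omega>}"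
      using monoD[OF assms(2), of K "max K b"]
      by (intro outer_measure_of_mono) (auto simp: le_fun_def)
    also note elim
    finally show ?case .
  qed
  then show ?thesis by (intro that[of "max K b"]) auto
qed

lemma mono_conj:
  assumes "mono Q" "mono R"
  shows "mono (\<lambda>K n \<omega>. Q (K::real) n \<omega> \<and> R K n \<omega>)"
  using assms unfolding mono_def le_fun_def le_bool_def by blast

lemma mono_boundI:
  assumes "\<And>n x. 0 \<le> g n x"
  shows "mono (\<lambda>(K::real) n \<omega>. \<forall>x\<in>A. f n \<omega> x \<le> K * g n x)"
  unfolding mono_def le_fun_def le_bool_def
proof (intro allI impI ballI)
  fix K K' :: real and n \<omega> x
  assume "K \<le> K'" "\<forall>x\<in>A. f n \<omega> x \<le> K * g n x" "x \<in> A"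
  then show "f n \<omega> x \<le> K' * g n x"
    using mult_right_mono[OF \<open>K \<le> K'\<close> assms[of n x]] by (meson order.trans)
qed

lemma bigOp_on_subset:
  assumes "bigOp_on M J Z R" "I \<subseteq> J"
  shows "bigOp_on M I Z R"
  unfolding bigOp_on_def
proof (intro allI impI)
  fix \<epsilon> :: real assume "0 < \<epsilon>"
  then obtain C where "\<forall>\<^sub>F n in sequentially.
      outer_measure_of M {\<omega> \<in> space M. \<exists>i\<in>J. C * R i < \<bar>Z n i \<omega>\<bar>} < ennreal \<epsilon>"
    using assms(1) unfolding bigOp_on_def by blast
  then have "\<forall>\<^sub>F n in sequentially.
      outer_measure_of M {\<omega> \<in> space M. \<exists>i\<in>I. C * R i < \<bar>Z n i \<omega>\<bar>} < ennreal \<epsilon>"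
  proof eventually_elim
    case (elim n)
    have "outer_measure_of M {\<omega> \<in> space M. \<exists>i\<in>I. C * R i < \<bar>Z n i \<omega>\<bar>}
        \<le> outer_measure_of M {\<omega> \<in> space M. \<exists>i\<in>J. C * R i < \<bar>Z n i \<omega>\<bar>}"
      using assms(2) by (intro outer_measure_of_mono) blast
    also note elim
    finally show ?case .
  qed
  then show "\<exists>C. \<forall>\<^sub>F n in sequentially.
      outer_measure_of M {\<omega> \<in> space M. \<exists>i\<in>I. C * R i < \<bar>Z n i \<omega>\<bar>} < ennreal \<epsilon>" by blast
qed

text \<open>
  Hypotheses on arbitrary random sequences \<open>tt\<close> become statements that are uniform in the parameter:
  if uniformity failed for every \<open>k\<close> at arbitrarily large sample sizes, a single sequence \<open>tt\<close> that selects
  a violating parameter value at slowly increasing \<open>k = \<kappa> n\<close> would violate the hypothesis.  At outcomes without a violation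
  the sequence takes the default value \<open>d\<close>.
\<close>

lemma diagonal_selection:
  fixes E :: "nat \<Rightarrow> nat \<Rightarrow> 'a \<Rightarrow> 'o \<Rightarrow> bool"
  assumes freq: "\<And>k. \<not> (\<forall>\<^sub>F n in sequentially.
      outer_measure_of M {\<omega> \<in> space M. \<exists>\<psi>\<in>T. E k n \<psi> \<omega>} < \<epsilon>)"
    and d: "\<And>n \<omega>. \<omega> \<in> space M \<Longrightarrow> d n \<omega> \<in> T"
  obtains \<kappa> :: "nat \<Rightarrow> nat" and tt :: "nat \<Rightarrow> 'o \<Rightarrow> 'a"
  where "filterlim \<kappa> at_top sequentially" "\<And>n \<omega>. \<omega> \<in> space M \<Longrightarrow> tt n \<omega> \<in> T"
    "\<And>n \<omega>. \<omega> \<in> space M \<Longrightarrow> tt n \<omega> = d n \<omega> \<or> E (\<kappa> n) n (tt n \<omega>) \<omega>"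
    "\<And>Q. \<lbrakk>\<forall>\<^sub>F n in sequentially. outer_measure_of M {\<omega> \<in> space M. Q n \<omega>} < \<epsilon>;
        \<forall>\<^sub>F n in sequentially. \<forall>\<omega>\<in>space M. E (\<kappa> n) n (tt n \<omega>) \<omega> \<longrightarrow> Q n \<omega>\<rbrakk> \<Longrightarrow> False"
proof -
  let ?big = "\<lambda>k n. \<epsilon> \<le> outer_measure_of M {\<omega> \<in> space M. \<exists>\<psi>\<in>T. E k n \<psi> \<omega>}"
  have ex: "\<exists>n. ?big k n \<and> n > m" for k m
  proof -
    from freq[of k] obtain n where "n \<ge> Suc m"
      "\<not> outer_measure_of M {\<omega> \<in> space M. \<exists>\<psi>\<in>T. E k n \<psi> \<omega>} < \<epsilon>"
      unfolding eventually_sequentially by blast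
    then show ?thesis by (intro exI[of _ n]) (auto simp: not_less)
  qed
  have "\<exists>f. \<forall>k. ?big k (f k) \<and> f k < f (Suc k)"
    by (rule dependent_nat_choice) (use ex in blast)+
  then obtain f where f: "\<And>k. ?big k (f k) \<and> f k < f (Suc k)" by blast
  then have mono: "strict_mono f" by (simp add: strict_mono_Suc_iff)
  define \<kappa> where "\<kappa> n = (LEAST k. n \<le> f k)" for n
  have \<kappa>f: "\<kappa> (f k) = k" for k
    unfolding \<kappa>_def using mono by (auto intro!: Least_equality simp: strict_mono_less_eq)
  have "k \<le> \<kappa> n" if "f k \<le> n" for k n
  proof -
    have "n \<le> f n" using mono by (rule strict_mono_imp_increasing)
    then have "n \<le> f (\<kappa> n)" unfolding \<kappa>_def by (rule LeastI)
    with that have "f k \<le> f (\<kappa> n)" by simp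
    then show ?thesis using mono by (simp add: strict_mono_less_eq)
  qed
  then have lim: "filterlim \<kappa> at_top sequentially"
    unfolding filterlim_at_top eventually_sequentially by blast
  define tt where "tt n \<omega> =
      (if \<exists>\<psi>\<in>T. E (\<kappa> n) n \<psi> \<omega> then SOME \<psi>. \<psi> \<in> T \<and> E (\<kappa> n) n \<psi> \<omega> else d n \<omega>)" for n \<omega>
  have sel: "tt n \<omega> \<in> T \<and> E (\<kappa> n) n (tt n \<omega>) \<omega>" if "\<exists>\<psi>\<in>T. E (\<kappa> n) n \<psi> \<omega>" for n \<omega>
  proof -
    from that have "\<exists>\<psi>. \<psi> \<in> T \<and> E (\<kappa> n) n \<psi> \<omega>" by blast
    from someI_ex[OF this] that show ?thesis by (simp add: tt_def)
  qed
  show ?thesis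
  proof (rule that[of \<kappa> tt])
    show "filterlim \<kappa> at_top sequentially" by (rule lim)
    show "tt n \<omega> \<in> T" if "\<omega> \<in> space M" for n \<omega>
      using sel[of n \<omega>] d[OF that] by (auto simp: tt_def)
    show "tt n \<omega> = d n \<omega> \<or> E (\<kappa> n) n (tt n \<omega>) \<omega>" if "\<omega> \<in> space M" for n \<omega>
      using sel[of n \<omega>] by (auto simp: tt_def)
    fix Q
    assume Q: "\<forall>\<^sub>F n in sequentially. outer_measure_of M {\<omega> \<in> space M. Q n \<omega>} < \<epsilon>"
      "\<forall>\<^sub>F n in sequentially. \<forall>\<omega>\<in>space M. E (\<kappa> n) n (tt n \<omega>) \<omega> \<longrightarrow> Q n \<omega>"
    then have "\<forall>\<^sub>F n in sequentially. outer_measure_of M {\<omega> \<in> space M. Q n \<omega>} < \<epsilon> \<and>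
        (\<forall>\<omega>\<in>space M. E (\<kappa> n) n (tt n \<omega>) \<omega> \<longrightarrow> Q n \<omega>)" by (rule eventually_conj)
    then obtain N where N: "\<And>n. n \<ge> N \<Longrightarrow> outer_measure_of M {\<omega> \<in> space M. Q n \<omega>} < \<epsilon> \<and>
        (\<forall>\<omega>\<in>space M. E (\<kappa> n) n (tt n \<omega>) \<omega> \<longrightarrow> Q n \<omega>)"
      unfolding eventually_sequentially by blast
    let ?n = "f N"
    have "?n \<ge> N" using mono by (rule strict_mono_imp_increasing)
    have "\<epsilon> \<le> outer_measure_of M {\<omega> \<in> space M. \<exists>\<psi>\<in>T. E N ?n \<psi> \<omega>}" using f by blast
    also have "\<dots> \<le> outer_measure_of M {\<omega> \<in> space M. Q ?n \<omega>}"
      using sel[of ?n] N[OF \<open>?n \<ge> N\<close>] unfolding \<kappa>f by (intro outer_measure_of_mono) auto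
    also have "\<dots> < \<epsilon>" using N[OF \<open>?n \<ge> N\<close>] by blast
    finally show False by simp
  qed
qed

section \<open>Stochastic bounds for independent observations\<close>

lemma (in prob_space) likely_Markov:
  assumes int: "\<And>n. n \<ge> 1 \<Longrightarrow> integrable M (F n)"
    and le: "\<And>n. n \<ge> 1 \<Longrightarrow> (\<integral>\<omega>. \<bar>F n \<omega>\<bar> \<partial>M) \<le> B"
  shows "likely M (\<lambda>K n \<omega>. \<bar>F n \<omega>\<bar> \<le> (K::real))"
proof (rule likelyI)
  fix \<epsilon> :: real assume "\<epsilon> > 0"
  define K where "K = (\<bar>B\<bar> + 1) / (\<epsilon> / 2)"
  have "K > 0" using \<open>\<epsilon> > 0\<close> by (simp add: K_def)
  have "outer_measure_of M {\<omega> \<in> space M. \<not> \<bar>F n \<omega>\<bar> \<le> K} < ennreal \<epsilon>" if "n \<ge> 1" for n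
  proof -
    note [measurable] = borel_measurable_integrable[OF int[OF that]]
    have "outer_measure_of M {\<omega> \<in> space M. \<not> \<bar>F n \<omega>\<bar> \<le> K}
        \<le> outer_measure_of M {\<omega> \<in> space M. \<bar>F n \<omega>\<bar> \<ge> K}"
      by (intro outer_measure_of_mono) auto
    also have "\<dots> = emeasure M {\<omega> \<in> space M. \<bar>F n \<omega>\<bar> \<ge> K}"
      by (intro outer_measure_of_eq) measurable
    also have "\<dots> \<le> (1 / K) * (\<integral>\<omega>. \<bar>F n \<omega>\<bar> \<partial>M)"
      using int[OF that] \<open>K > 0\<close> by (intro integral_Markov_inequality) auto
    also have "\<dots> \<le> ennreal (\<epsilon> / 2)"
    proof (rule ennreal_leI)
      have "(\<integral>\<omega>. \<bar>F n \<omega>\<bar> \<partial>M) \<le> \<bar>B\<bar> + 1" using le[OF that] by linarith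
      then have "(1 / K) * (\<integral>\<omega>. \<bar>F n \<omega>\<bar> \<partial>M) \<le> (1 / K) * (\<bar>B\<bar> + 1)"
        using \<open>K > 0\<close> by (intro mult_left_mono) auto
      also have "\<dots> = \<epsilon> / 2" using \<open>\<epsilon> > 0\<close> by (simp add: K_def field_simps)
      finally show "1 / K * (\<integral>\<omega>. \<bar>F n \<omega>\<bar> \<partial>M) \<le> \<epsilon> / 2" .
    qed
    also have "\<dots> < ennreal \<epsilon>" using \<open>\<epsilon> > 0\<close> by (intro ennreal_lessI) auto
    finally show ?thesis .
  qed
  then show "\<exists>K. \<forall>\<^sub>F n in sequentially.
      outer_measure_of M {\<omega> \<in> space M. \<not> \<bar>F n \<omega>\<bar> \<le> K} < ennreal \<epsilon>"
    unfolding eventually_sequentially by blast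
qed

locale iid_sample = prob_space M for M :: "'o measure" +
  fixes P :: "'x measure" and X :: "nat \<Rightarrow> 'o \<Rightarrow> 'x"
  assumes indep: "indep_vars (\<lambda>_. P) X UNIV"
    and law_X: "distr M P (X i) = P"
begin

lemma X_measurable [measurable]: "X i \<in> measurable M P"
  using indep unfolding indep_vars_def by auto

lemma prob_space_P: "prob_space P"
  using prob_space_distr[OF X_measurable[of 0]] law_X[of 0] by simp

lemma integrable_X:
  assumes "integrable P (f :: 'x \<Rightarrow> real)"
  shows "integrable M (\<lambda>\<omega>. f (X i \<omega>))"
    and "(\<integral>\<omega>. f (X i \<omega>) \<partial>M) = (\<integral>x. f x \<partial>P)"
proof -
  have "f \<in> borel_measurable P" using assms by auto
  then show "integrable M (\<lambda>\<omega>. f (X i \<omega>))" "(\<integral>\<omega>. f (X i \<omega>) \<partial>M) = (\<integral>x. f x \<partial>P)"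
    using assms integrable_distr_eq[OF X_measurable[of i], of f] integral_distr[OF X_measurable[of i], of f]
    by (simp_all add: law_X)
qed

lemma AE_all_X:
  assumes "AE x in P. Q x"
  shows "AE \<omega> in M. \<forall>i. Q (X i \<omega>)"
proof -
  have "AE \<omega> in M. Q (X i \<omega>)" for i
  proof (rule AE_distrD[OF X_measurable])
    show "AE x in distr M P (X i). Q x" unfolding law_X by (rule assms)
  qed
  then show ?thesis by (simp add: AE_all_countable)
qed

lemma likely_emp_mean:
  assumes "integrable P F"
  shows "likely M (\<lambda>K n \<omega>. \<bar>emp_mean n F (\<lambda>i. X i \<omega>)\<bar> \<le> K)"
proof (rule likely_Markov)
  fix n :: nat assume n: "n \<ge> 1"
  show int: "integrable M (\<lambda>\<omega>. emp_mean n F (\<lambda>i. X i \<omega>))"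
    unfolding emp_mean_def using integrable_X(1)[OF assms] by auto
  have absF: "integrable P (\<lambda>x. \<bar>F x\<bar>)" using assms by auto
  note absX = integrable_X[OF absF]
  have "(\<integral>\<omega>. \<bar>emp_mean n F (\<lambda>i. X i \<omega>)\<bar> \<partial>M) \<le> (\<integral>\<omega>. (\<Sum>i<n. \<bar>F (X i \<omega>)\<bar>) / n \<partial>M)"
  proof (rule integral_mono)
    show "integrable M (\<lambda>\<omega>. (\<Sum>i<n. \<bar>F (X i \<omega>)\<bar>) / n)" using absX by auto
    show "\<bar>emp_mean n F (\<lambda>i. X i \<omega>)\<bar> \<le> (\<Sum>i<n. \<bar>F (X i \<omega>)\<bar>) / n" for \<omega>
      unfolding emp_mean_def by (auto intro!: divide_right_mono sum_abs)
  qed (use int in auto)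
  also have "\<dots> = (\<integral>x. \<bar>F x\<bar> \<partial>P)" using n absX by simp
  finally show "(\<integral>\<omega>. \<bar>emp_mean n F (\<lambda>i. X i \<omega>)\<bar> \<partial>M) \<le> (\<integral>x. \<bar>F x\<bar> \<partial>P)" .
qed

text \<open>The central limit scaling of a centred mean follows from the additivity of variances.\<close>

lemma likely_emp_mean_centered:
  assumes F: "L2_fun P F" and mean: "(\<integral>x. F x \<partial>P) = 0"
  shows "likely M (\<lambda>K n \<omega>. \<bar>emp_mean n F (\<lambda>i. X i \<omega>)\<bar> \<le> K * (1 / sqrt n))"
proof -
  interpret P: prob_space P by (rule prob_space_P)
  have Fm [measurable]: "F \<in> borel_measurable P" and F2: "integrable P (\<lambda>x. (F x)\<^sup>2)"
    using F by (auto simp: L2_fun_def)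
  have F1: "integrable P F" using P.square_integrable_imp_integrable[OF Fm F2] .
  let ?Y = "\<lambda>i \<omega>. F (X i \<omega>)"
  have cross: "integrable M (\<lambda>\<omega>. ?Y i \<omega> * ?Y j \<omega>) \<and>
      (\<integral>\<omega>. ?Y i \<omega> * ?Y j \<omega> \<partial>M) = (if i = j then \<integral>x. (F x)\<^sup>2 \<partial>P else 0)" for i j
  proof (cases "i = j")
    case True
    then show ?thesis using integrable_X[OF F2] by (simp add: power2_eq_square)
  next
    case False
    have ind: "indep_vars (\<lambda>_. borel) ?Y {i, j}"
      using indep_vars_compose2[OF indep_vars_subset[OF indep, of "{i, j}"], of "\<lambda>_. F" "\<lambda>_. borel"]
      by simp
    have eq: "(\<Prod>k\<in>{i, j}. ?Y k \<omega>) = ?Y i \<omega> * ?Y j \<omega>" for \<omega> using False by simp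
    have int: "integrable M (?Y k)" for k by (rule integrable_X[OF F1])
    have "(\<integral>\<omega>. (\<Prod>k\<in>{i, j}. ?Y k \<omega>) \<partial>M) = (\<Prod>k\<in>{i, j}. \<integral>\<omega>. ?Y k \<omega> \<partial>M)"
      using ind int by (intro indep_vars_lebesgue_integral) auto
    moreover have "integrable M (\<lambda>\<omega>. \<Prod>k\<in>{i, j}. ?Y k \<omega>)"
      using ind int by (intro indep_vars_integrable) auto
    ultimately show ?thesis
      unfolding eq using False integrable_X(2)[OF F1] mean by simp
  qed
  define V where "V n \<omega> = (sqrt (real n) * emp_mean n F (\<lambda>i. X i \<omega>))\<^sup>2" for n \<omega>
  have V_eq: "V n \<omega> = (\<Sum>i<n. \<Sum>j<n. ?Y i \<omega> * ?Y j \<omega>) / n" if "n \<ge> 1" for n \<omega>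
  proof -
    have "V n \<omega> = (\<Sum>i<n. ?Y i \<omega>)\<^sup>2 / n"
      using that unfolding V_def emp_mean_def
      by (simp add: power_mult_distrib power_divide power2_eq_square[of "real n"])
    then show ?thesis by (simp add: power2_eq_square sum_product)
  qed
  have "likely M (\<lambda>K n \<omega>. \<bar>V n \<omega>\<bar> \<le> K)"
  proof (rule likely_Markov)
    fix n :: nat assume n: "n \<ge> 1"
    show "integrable M (V n)"
      unfolding V_eq[OF n, abs_def] using cross by (auto intro!: Bochner_Integration.integrable_sum)
    have "(\<integral>\<omega>. \<bar>V n \<omega>\<bar> \<partial>M) = (\<integral>\<omega>. V n \<omega> \<partial>M)" by (simp add: V_def)
    also have "\<dots> = (\<Sum>i<n. \<Sum>j<n. (if i = j then \<integral>x. (F x)\<^sup>2 \<partial>P else 0)) / n"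
      unfolding V_eq[OF n, abs_def] using cross
      by (simp add: Bochner_Integration.integral_sum Bochner_Integration.integrable_sum)
    also have "\<dots> = (\<integral>x. (F x)\<^sup>2 \<partial>P)"
      using n by (simp add: sum.delta)
    finally show "(\<integral>\<omega>. \<bar>V n \<omega>\<bar> \<partial>M) \<le> (\<integral>x. (F x)\<^sup>2 \<partial>P)" by simp
  qed
  then show ?thesis
  proof (rule likely_weaken)
    fix K :: real
    show "\<exists>K'. \<forall>\<^sub>F n in sequentially. \<forall>\<omega>\<in>space M. \<bar>V n \<omega>\<bar> \<le> K \<longrightarrow>
        \<bar>emp_mean n F (\<lambda>i. X i \<omega>)\<bar> \<le> K' * (1 / sqrt n)"
    proof (intro exI[of _ "sqrt K"] eventually_sequentiallyI[of 1] ballI impI)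
      fix n :: nat and \<omega> assume n: "1 \<le> n" and "\<bar>V n \<omega>\<bar> \<le> K"
      then have "\<bar>sqrt (real n) * emp_mean n F (\<lambda>i. X i \<omega>)\<bar> \<le> sqrt K"
        by (intro real_le_rsqrt) (simp add: V_def)
      then have "sqrt (real n) * \<bar>emp_mean n F (\<lambda>i. X i \<omega>)\<bar> \<le> sqrt K"
        by (simp add: abs_mult)
      then show "\<bar>emp_mean n F (\<lambda>i. X i \<omega>)\<bar> \<le> sqrt K * (1 / sqrt n)"
        using n by (simp add: pos_le_divide_eq mult.commute)
    qed
  qed
qed

text \<open>
  Weak convergence to a tight limit makes the empirical process uniformly bounded in probability:
  test it against \<open>h z = min 1 (max 0 (\<parallel>z\<parallel> - b))\<close>, which vanishes on a compact set of large
  limit probability.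
\<close>

lemma likely_donsker:
  assumes "donsker P F"
  shows "likely M (\<lambda>K n \<omega>. \<forall>f\<in>F. \<bar>emp_proc P n f (\<lambda>i. X i \<omega>)\<bar> \<le> K)"
proof -
  let ?PI = "PiM UNIV (\<lambda>_. P) :: (nat \<Rightarrow> 'x) measure"
  interpret P: prob_space P by (rule prob_space_P)
  interpret PI: prob_space ?PI by (intro prob_space_PiM P.prob_space_axioms)
  have distr: "distr M ?PI (\<lambda>\<omega> i. X i \<omega>) = ?PI"
    using indep_vars_iff_distr_eq_PiM'[of UNIV X "\<lambda>_. P"] indep X_measurable law_X
    by (simp add: restrict_def)
  have Xm: "(\<lambda>\<omega> i. X i \<omega>) \<in> measurable M ?PI"
    by (rule measurable_PiM_single') (auto simp: measurable_space[OF X_measurable])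
  from assms obtain L :: "'x linf measure" where
    bdd: "AE x in P. \<exists>B. \<forall>f\<in>F. \<bar>f x - (\<integral>y. f y \<partial>P)\<bar> \<le> B"
    and L: "prob_space L" "sets L = sets borel"
    and tight: "\<And>\<epsilon>. \<epsilon> > 0 \<Longrightarrow> \<exists>K. compact K \<and> measure L K > 1 - \<epsilon>"
    and conv: "\<And>h :: 'x linf \<Rightarrow> real. continuous_on UNIV h \<Longrightarrow> bounded (range h) \<Longrightarrow>
           (\<lambda>n. outer_expectation ?PI (\<lambda>xs. h (emp_path P F n xs))) \<longlonglongrightarrow> (\<integral>z. h z \<partial>L)"
    unfolding donsker_def by blast
  interpret L: prob_space L by (rule L)
  have path: "AE \<omega> in M. \<forall>f\<in>F. \<bar>emp_proc P n f (\<lambda>i. X i \<omega>)\<bar> \<le> norm (emp_path P F n (\<lambda>i. X i \<omega>))" for n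
    using AE_all_X[OF bdd]
  proof eventually_elim
    case (elim \<omega>)
    then obtain B where B: "\<And>i f. f \<in> F \<Longrightarrow> \<bar>f (X i \<omega>) - (\<integral>y. f y \<partial>P)\<bar> \<le> B i" by metis
    let ?g = "\<lambda>d. if of_discrete d \<in> F then emp_proc P n (of_discrete d) (\<lambda>i. X i \<omega>) else 0"
    have "\<bar>emp_proc P n f (\<lambda>i. X i \<omega>)\<bar> \<le> (\<Sum>i<n. \<bar>B i\<bar>) / sqrt n" if "f \<in> F" for f
    proof -
      have "\<bar>\<Sum>i<n. f (X i \<omega>) - (\<integral>y. f y \<partial>P)\<bar> \<le> (\<Sum>i<n. \<bar>B i\<bar>)"
        using B[OF that] by (intro order.trans[OF sum_abs] sum_mono) (meson abs_ge_self order.trans)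
      then show ?thesis unfolding emp_proc_def by (simp add: divide_right_mono)
    qed
    moreover have "0 \<le> (\<Sum>i<n. \<bar>B i\<bar>) / sqrt n" by (simp add: sum_nonneg)
    moreover have "continuous_on UNIV ?g"
      by (simp add: continuous_on_open_vimage open_discrete)
    ultimately have "?g \<in> bcontfun"
      by (intro bcontfun_normI[where b = "(\<Sum>i<n. \<bar>B i\<bar>) / sqrt n"]) auto
    then have app: "apply_bcontfun (emp_path P F n (\<lambda>i. X i \<omega>)) = ?g"
      unfolding emp_path_def by (rule Bcontfun_inverse)
    show ?case
    proof
      fix f assume "f \<in> F"
      then show "\<bar>emp_proc P n f (\<lambda>i. X i \<omega>)\<bar> \<le> norm (emp_path P F n (\<lambda>i. X i \<omega>))"
        using norm_bounded[of "emp_path P F n (\<lambda>i. X i \<omega>)" "discrete f"]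
        unfolding app by (simp add: discrete_inverse)
    qed
  qed
  have "likely M (\<lambda>K n \<omega>. norm (emp_path P F n (\<lambda>i. X i \<omega>)) \<le> K)"
  proof (rule likelyI)
    fix \<epsilon> :: real assume \<epsilon>: "\<epsilon> > 0"
    obtain C where C: "compact C" "measure L C > 1 - \<epsilon> / 2" using tight[of "\<epsilon> / 2"] \<epsilon> by auto
    obtain b where b: "\<And>z. z \<in> C \<Longrightarrow> norm z \<le> b"
      using compact_imp_bounded[OF C(1)] unfolding bounded_iff by blast
    define h :: "'x linf \<Rightarrow> real" where "h z = min 1 (max 0 (norm z - b))" for z
    have h01: "0 \<le> h z" "h z \<le> 1" for z by (auto simp: h_def)
    have hcont: "continuous_on UNIV h" unfolding h_def by (intro continuous_intros)
    have hbdd: "bounded (range h)" using h01 by (intro boundedI[of _ 1]) auto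
    have Cs: "C \<in> sets L" using compact_imp_closed[OF C(1)] by (simp add: L)
    have hm [measurable]: "h \<in> borel_measurable L"
      using borel_measurable_continuous_onI[OF hcont] by (simp add: measurable_def L sets_eq_imp_space_eq[OF L(2)])
    have "(\<integral>z. h z \<partial>L) \<le> (\<integral>z. 1 - indicator C z \<partial>L)"
    proof (rule integral_mono)
      show "integrable L h" by (rule L.integrable_const_bound[of _ 1]) (use h01 hm in auto)
      show "integrable L (\<lambda>z. 1 - indicator C z :: real)" using Cs by (auto simp: L.emeasure_eq_measure)
      show "h z \<le> 1 - indicator C z" for z using h01[of z] b[of z] by (auto simp: h_def indicator_def)
    qed
    also have "\<dots> = 1 - measure L C"
      using Cs by (subst Bochner_Integration.integral_diff) (auto simp: L.emeasure_eq_measure L.prob_space)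
    also have "\<dots> < \<epsilon> / 2" using C by simp
    finally have "(\<integral>z. h z \<partial>L) < \<epsilon>" using \<epsilon> by simp
    with conv[OF hcont hbdd] have
      "\<forall>\<^sub>F n in sequentially. outer_expectation ?PI (\<lambda>xs. h (emp_path P F n xs)) < \<epsilon>"
      by (rule order_tendstoD)
    then have "\<forall>\<^sub>F n in sequentially. outer_measure_of M
        {\<omega> \<in> space M. \<not> norm (emp_path P F n (\<lambda>i. X i \<omega>)) \<le> b + 1} < ennreal \<epsilon>"
    proof eventually_elim
      case (elim n)
      let ?Z = "\<lambda>xs. h (emp_path P F n xs)"
      let ?S = "{(\<integral>\<omega>. U \<omega> \<partial>?PI) | U. integrable ?PI U \<and> (\<forall>\<omega>\<in>space ?PI. ?Z \<omega> \<le> U \<omega>)}"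
      have "(\<integral>\<omega>. 1 \<partial>?PI) \<in> ?S" using h01 by (intro CollectI exI[of _ "\<lambda>_. 1"]) auto
      then have "?S \<noteq> {}" by blast
      from cInf_lessD[OF this elim[unfolded outer_expectation_def]]
      obtain U where U: "integrable ?PI U" "\<And>xs. xs \<in> space ?PI \<Longrightarrow> ?Z xs \<le> U xs"
        "(\<integral>xs. U xs \<partial>?PI) < \<epsilon>" by blast
      have U0: "0 \<le> U xs" if "xs \<in> space ?PI" for xs using U(2)[OF that] h01 by (meson order.trans)
      let ?A = "{xs \<in> space ?PI. 1 \<le> U xs}"
      \<comment> \<open>Where the norm exceeds \<open>b + 1\<close> the test function is \<open>1\<close>, so its majorant \<open>U\<close> is at least \<open>1\<close> there.\<close>
      have "{\<omega> \<in> space M. \<not> norm (emp_path P F n (\<lambda>i. X i \<omega>)) \<le> b + 1}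
          \<subseteq> (\<lambda>\<omega> i. X i \<omega>) -` ?A \<inter> space M"
      proof
        fix \<omega> assume "\<omega> \<in> {\<omega> \<in> space M. \<not> norm (emp_path P F n (\<lambda>i. X i \<omega>)) \<le> b + 1}"
        then have \<omega>: "\<omega> \<in> space M" "\<not> norm (emp_path P F n (\<lambda>i. X i \<omega>)) \<le> b + 1" by auto
        have sp: "(\<lambda>i. X i \<omega>) \<in> space ?PI" using measurable_space[OF Xm \<omega>(1)] .
        have "1 = ?Z (\<lambda>i. X i \<omega>)" using \<omega>(2) by (simp add: h_def)
        then have "1 \<le> U (\<lambda>i. X i \<omega>)" using U(2)[OF sp] by simp
        with sp \<omega>(1) show "\<omega> \<in> (\<lambda>\<omega> i. X i \<omega>) -` ?A \<inter> space M" by simp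
      qed
      then have "outer_measure_of M {\<omega> \<in> space M. \<not> norm (emp_path P F n (\<lambda>i. X i \<omega>)) \<le> b + 1}
          \<le> outer_measure_of M ((\<lambda>\<omega> i. X i \<omega>) -` ?A \<inter> space M)" by (rule outer_measure_of_mono)
      also have "\<dots> \<le> outer_measure_of (distr M ?PI (\<lambda>\<omega> i. X i \<omega>)) ?A"
        by (rule outer_measure_of_vimage_le[OF Xm]) auto
      also have "\<dots> = emeasure ?PI ?A"
        unfolding distr using borel_measurable_integrable[OF U(1)] by (intro outer_measure_of_eq) measurable
      also have "\<dots> \<le> (1 / 1) * (\<integral>xs. U xs \<partial>?PI)"
        using U U0 by (intro integral_Markov_inequality) (auto intro!: AE_I2)
      also have "\<dots> < ennreal \<epsilon>" using U(3) \<epsilon> by (simp add: ennreal_lessI)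
      finally show ?case .
    qed
    then show "\<exists>K. \<forall>\<^sub>F n in sequentially.
        outer_measure_of M {\<omega> \<in> space M. \<not> norm (emp_path P F n (\<lambda>i. X i \<omega>)) \<le> K} < ennreal \<epsilon>" by blast
  qed
  moreover have "mono (\<lambda>K n \<omega>. norm (emp_path P F n (\<lambda>i. X i \<omega>)) \<le> K)"
    by (auto simp: mono_def le_fun_def)
  moreover note likely_AE[OF path]
  ultimately have "likely M (\<lambda>K n \<omega>. norm (emp_path P F n (\<lambda>i. X i \<omega>)) \<le> K \<and>
      (\<forall>f\<in>F. \<bar>emp_proc P n f (\<lambda>i. X i \<omega>)\<bar> \<le> norm (emp_path P F n (\<lambda>i. X i \<omega>))))"
    by (intro likely_conj) (auto simp: mono_def)
  then show ?thesis
  proof (rule likely_weaken)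
    fix K :: real
    show "\<exists>K'. \<forall>\<^sub>F n in sequentially. \<forall>\<omega>\<in>space M.
        norm (emp_path P F n (\<lambda>i. X i \<omega>)) \<le> K \<and>
        (\<forall>f\<in>F. \<bar>emp_proc P n f (\<lambda>i. X i \<omega>)\<bar> \<le> norm (emp_path P F n (\<lambda>i. X i \<omega>))) \<longrightarrow>
        (\<forall>f\<in>F. \<bar>emp_proc P n f (\<lambda>i. X i \<omega>)\<bar> \<le> K')"
      by (intro exI[of _ K] always_eventually) (meson order.trans)
  qed
qed

end

section \<open>Laplace approximation of moments\<close>

lemma integrable_gaussian_abs_moment:
  fixes a :: real
  assumes "0 < a"
  shows "integrable lborel (\<lambda>u. \<bar>u\<bar> ^ k * exp (- a * u\<^sup>2))"
proof -
  define \<sigma> where "\<sigma> = 1 / sqrt (2 * a)"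
  have \<sigma>: "\<sigma> > 0" "2 * \<sigma>\<^sup>2 = 1 / a"
    using assms by (auto simp: \<sigma>_def power_divide)
  have "integrable lborel (\<lambda>u. sqrt (2 * pi * \<sigma>\<^sup>2) * (normal_density 0 \<sigma> u * \<bar>u - 0\<bar> ^ k))"
    using integrable_normal_moment_abs[OF \<sigma>(1), of 0 k] by simp
  moreover have "(\<lambda>u. sqrt (2 * pi * \<sigma>\<^sup>2) * (normal_density 0 \<sigma> u * \<bar>u - 0\<bar> ^ k))
      = (\<lambda>u. \<bar>u\<bar> ^ k * exp (- a * u\<^sup>2))"
    using \<sigma> assms by (auto simp: normal_density_def mult.commute)
  ultimately show ?thesis by (simp only:)
qed

lemma integrable_gaussian_moment:
  fixes a :: real
  assumes "0 < a"
  shows "integrable lborel (\<lambda>u. u ^ k * exp (- a * u\<^sup>2))"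
  by (rule Bochner_Integration.integrable_bound[OF integrable_gaussian_abs_moment[OF assms, of k]])
     (auto simp: abs_mult power_abs)

definition gauss_moment :: "real \<Rightarrow> nat \<Rightarrow> real" where
  "gauss_moment I k = (\<integral>u. u ^ k * exp (- I * u\<^sup>2 / 2) \<partial>lborel)"

lemma gauss_moment_scale:
  assumes "0 < I"
  shows "gauss_moment 1 k = sqrt I ^ (k + 1) * gauss_moment I k"
proof -
  have "gauss_moment 1 k = \<bar>sqrt I\<bar> *\<^sub>R (\<integral>u. (0 + sqrt I * u) ^ k * exp (- 1 * (0 + sqrt I * u)\<^sup>2 / 2) \<partial>lborel)"
    unfolding gauss_moment_def using assms by (intro lborel_integral_real_affine) auto
  also have "\<dots> = sqrt I * (\<integral>u. sqrt I ^ k * (u ^ k * exp (- I * u\<^sup>2 / 2)) \<partial>lborel)"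
    using assms by (simp add: power_mult_distrib mult.assoc)
  finally show ?thesis by (simp add: gauss_moment_def)
qed

lemma gauss_moment_0_pos:
  assumes "0 < I"
  shows "0 < gauss_moment I 0"
proof -
  have "gauss_moment 1 0 = (\<integral>u. sqrt (2 * pi) * (std_normal_density u * u ^ (2 * 0)) \<partial>lborel)"
    by (simp add: gauss_moment_def normal_density_def)
  also have "\<dots> = sqrt (2 * pi)" by (subst integral_mult_right_zero, subst integral_std_normal_moment_even) simp
  finally have "0 < sqrt I * gauss_moment I 0" using gauss_moment_scale[OF assms, of 0] by simp
  then show ?thesis using assms by (simp add: zero_less_mult_iff)
qed

text \<open>The quotient of Gaussian integrals produced by the posterior is the standard normal moment.\<close>

lemma gauss_moment_ratio:
  assumes "0 < I"
  shows "sqrt I ^ k * (gauss_moment I k / gauss_moment I 0) = (\<integral>u. u ^ k \<partial>std_normal_distribution)"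
proof -
  have "(\<integral>u. u ^ k \<partial>std_normal_distribution) = (\<integral>u. std_normal_density u *\<^sub>R u ^ k \<partial>lborel)"
    by (intro integral_density) auto
  also have "\<dots> = (\<integral>u. (1 / sqrt (2 * pi)) * (u ^ k * exp (- 1 * u\<^sup>2 / 2)) \<partial>lborel)"
    by (intro Bochner_Integration.integral_cong) (auto simp: normal_density_def)
  also have "\<dots> = gauss_moment 1 k / sqrt (2 * pi)" by (simp add: gauss_moment_def)
  finally have k: "(\<integral>u. u ^ k \<partial>std_normal_distribution) = gauss_moment 1 k / sqrt (2 * pi)" .
  have "gauss_moment 1 0 = (\<integral>u. sqrt (2 * pi) * (std_normal_density u * u ^ (2 * 0)) \<partial>lborel)"
    by (simp add: gauss_moment_def normal_density_def)
  also have "\<dots> = sqrt (2 * pi)" by (subst integral_mult_right_zero, subst integral_std_normal_moment_even) simp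
  finally show ?thesis
    unfolding k using gauss_moment_scale[OF assms, of 0] gauss_moment_scale[OF assms, of k] assms
      gauss_moment_0_pos[OF assms] by (simp add: field_simps)
qed

text \<open>Contributions that are exponentially small in \<open>n = 1 / s\<^sup>2\<close> are below every power of \<open>s\<close>.\<close>

lemma exp_neg_le_power:
  fixes c s :: real
  assumes "0 < c" "0 < s"
  shows "exp (- c / s\<^sup>2) \<le> (real m / c) ^ m * s ^ (2 * m)"
proof (cases "m = 0")
  case False
  have "(c / s\<^sup>2 / m) ^ m \<le> exp (c / s\<^sup>2 / m) ^ m"
  proof (rule power_mono)
    show "c / s\<^sup>2 / m \<le> exp (c / s\<^sup>2 / m)"
      using exp_ge_add_one_self[of "c / s\<^sup>2 / m"] by linarith
  qed (use assms in simp)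
  also have "\<dots> = exp (c / s\<^sup>2)" using False by (simp add: exp_of_nat_mult[symmetric])
  finally have "inverse (exp (c / s\<^sup>2)) \<le> inverse ((c / s\<^sup>2 / m) ^ m)"
    using assms False by (intro le_imp_inverse_le) auto
  also have "\<dots> = (real m / c) ^ m * s ^ (2 * m)"
  proof -
    have "inverse ((c / s\<^sup>2 / m) ^ m) = (real m / c * s\<^sup>2) ^ m"
      by (simp add: power_inverse[symmetric] mult.commute)
    then show ?thesis by (simp only: power_mult_distrib power_mult)
  qed
  finally show ?thesis by (simp add: exp_minus)
qed (use assms in auto)

text \<open>
  With \<open>u = h / s\<close>, the remainder \<open>R = ln q + I u\<^sup>2 / 2\<close> satisfies \<open>\<bar>R\<bar> \<le> 1 + I u\<^sup>2 / 4\<close> on the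
  \<open>\<delta>\<close>-neighborhood, so that half of the Gaussian exponent absorbs \<open>exp \<bar>R\<bar>\<close> and the error remains integrable in
  \<open>u\<close> although the neighborhood does not shrink.  Outside it the Gaussian is itself of order \<open>s\<close>.
\<close>

lemma weight_near_gaussian:
  fixes I K L s \<delta> \<theta> \<theta>0 \<theta>h q p p0 b h u :: real
  assumes pos: "0 < s" "0 < I" "0 \<le> K" "0 \<le> L" "0 \<le> p0" "0 < \<delta>" "0 \<le> p" "0 \<le> b"
    and \<delta>: "16 * K * \<delta> \<le> I" "4 * K * \<delta> \<le> 1"
    and \<theta>h: "\<bar>\<theta>h - \<theta>0\<bar> \<le> K * s" "K * s \<le> \<delta> / 2"
    and h: "h = \<theta> - \<theta>h" and u: "u = h / s"
    and near: "\<bar>\<theta> - \<theta>0\<bar> < \<delta> \<Longrightarrow> 0 < q \<and> \<bar>p - p0\<bar> \<le> L * \<bar>\<theta> - \<theta>0\<bar> \<and>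
        \<bar>ln q + I * h\<^sup>2 / (2 * s\<^sup>2)\<bar> \<le> K * \<bar>h\<bar> * (s + \<bar>h\<bar>)\<^sup>2 / s\<^sup>2"
    and far: "\<delta> \<le> \<bar>\<theta> - \<theta>0\<bar> \<Longrightarrow> 0 \<le> p * q \<and> p * q \<le> p * b"
  shows "\<bar>p * q - p0 * exp (- I * u\<^sup>2 / 2)\<bar>
    \<le> s * (exp 1 * (L * (1 + K) + 4 * p0 * K) + 2 * p0 / \<delta>) * ((1 + \<bar>u\<bar> ^ 3) * exp (- (I / 4) * u\<^sup>2))
      + p * b"
proof -
  have hu: "h = s * u" using pos by (simp add: u)
  define E where "E = exp (- I * u\<^sup>2 / 2)"
  define G where "G = exp (- (I / 4) * u\<^sup>2)"
  define v where "v = \<bar>u\<bar>"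
  have v0: "0 \<le> v" and u2: "u\<^sup>2 = v\<^sup>2" by (auto simp: v_def)
  have EG: "0 < E" "0 < G" "E \<le> G" using pos by (auto simp: E_def G_def)
  have cube: "v \<le> 1 + v ^ 3" "v * (1 + v)\<^sup>2 \<le> 4 * (1 + v ^ 3)"
  proof -
    have "v * (1 + v)\<^sup>2 = v + 2 * v\<^sup>2 + v ^ 3" by (simp add: power2_eq_square power3_eq_cube algebra_simps)
    moreover have v12: "v \<le> 1 + v ^ 3 \<and> v\<^sup>2 \<le> 1 + v ^ 3"
    proof (cases "v \<le> 1")
      case True
      then have "v\<^sup>2 \<le> 1" "0 \<le> v ^ 3" using v0 by (auto simp: power_le_one)
      with True show ?thesis by linarith
    next
      case False
      then have "v ^ 1 \<le> v ^ 3" "v ^ 2 \<le> v ^ 3" by (intro power_increasing; simp)+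
      then show ?thesis by simp
    qed
    moreover have "0 \<le> v ^ 3" using v0 by simp
    ultimately show "v * (1 + v)\<^sup>2 \<le> 4 * (1 + v ^ 3)" by simp
    show "v \<le> 1 + v ^ 3" using v12 by simp
  qed
  let ?A = "exp 1 * (L * (1 + K) + 4 * p0 * K)" and ?B = "2 * p0 / \<delta>"
  have AB: "0 \<le> ?A" "0 \<le> ?B" using pos by auto
  have v3: "0 \<le> v ^ 3" using v0 by simp
  show ?thesis
  proof (cases "\<bar>\<theta> - \<theta>0\<bar> < \<delta>")
    case True
    define R where "R = ln q + I * u\<^sup>2 / 2"
    have q: "0 < q" and p: "\<bar>p - p0\<bar> \<le> L * \<bar>\<theta> - \<theta>0\<bar>" using near[OF True] by auto
    have "\<bar>R\<bar> \<le> K * \<bar>h\<bar> * (s + \<bar>h\<bar>)\<^sup>2 / s\<^sup>2"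
      using near[OF True] pos by (simp add: R_def hu power_mult_distrib)
    also have "\<dots> = K * s * (v * (1 + v)\<^sup>2)"
    proof -
      have "s + \<bar>h\<bar> = s * (1 + v)" "\<bar>h\<bar> = s * v" using pos by (auto simp: hu abs_mult v_def algebra_simps)
      then show ?thesis using pos by (simp add: power_mult_distrib)
    qed
    finally have R1: "\<bar>R\<bar> \<le> K * s * (v * (1 + v)\<^sup>2)" .
    have "s * v \<le> 2 * \<delta>"
      using True \<theta>h pos by (simp add: v_def u h)
    have "v * (1 + v)\<^sup>2 \<le> v * (2 * (1 + v\<^sup>2))"
    proof (rule mult_left_mono)
      have "0 \<le> (1 - v)\<^sup>2" by simp
      then show "(1 + v)\<^sup>2 \<le> 2 * (1 + v\<^sup>2)" by (simp add: power2_eq_square algebra_simps)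
    qed (rule v0)
    then have "K * s * (v * (1 + v)\<^sup>2) \<le> K * s * (v * (2 * (1 + v\<^sup>2)))"
      by (rule mult_left_mono) (use pos in simp)
    also have "\<dots> = (2 * K * (1 + v\<^sup>2)) * (s * v)" by simp
    also have "\<dots> \<le> (2 * K * (1 + v\<^sup>2)) * (2 * \<delta>)"
      using \<open>s * v \<le> 2 * \<delta>\<close> pos by (intro mult_left_mono) auto
    also have "\<dots> = 4 * K * \<delta> + (16 * K * \<delta>) * v\<^sup>2 / 4" by (simp add: algebra_simps)
    also have "\<dots> \<le> 1 + I * v\<^sup>2 / 4"
      using \<delta> by (intro add_mono divide_right_mono mult_right_mono) auto
    finally have R2: "\<bar>R\<bar> \<le> 1 + I * v\<^sup>2 / 4" using R1 by linarith
    have qE: "q = E * exp R"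
    proof -
      have "E * exp R = exp (ln q)" unfolding E_def R_def exp_add[symmetric] by simp
      then show ?thesis using q by simp
    qed
    have Eexp: "E * exp \<bar>R\<bar> \<le> exp 1 * G"
    proof -
      have "E * exp \<bar>R\<bar> = exp (- I * v\<^sup>2 / 2 + \<bar>R\<bar>)" unfolding E_def exp_add u2 by simp
      also have "\<dots> \<le> exp (1 + - (I / 4) * v\<^sup>2)" using R2 by (simp add: algebra_simps)
      also have "\<dots> = exp 1 * G" unfolding G_def exp_add u2 by simp
      finally show ?thesis .
    qed
    have q_le: "q \<le> exp 1 * G"
    proof -
      have "q \<le> E * exp \<bar>R\<bar>" unfolding qE using EG by (intro mult_left_mono) auto
      with Eexp show ?thesis by linarith
    qed
    have "\<bar>exp R - 1\<bar> \<le> \<bar>R\<bar> * exp \<bar>R\<bar>"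
    proof (cases "R \<ge> 0")
      case True
      have "1 - R \<le> exp (- R)" using exp_ge_add_one_self[of "- R"] by simp
      then have "exp R * (1 - R) \<le> exp R * exp (- R)" by (intro mult_left_mono) auto
      then have "exp R - 1 \<le> R * exp R" by (simp add: exp_minus algebra_simps)
      then show ?thesis using True by simp
    next
      case False
      have "1 - exp R \<le> - R" using exp_ge_add_one_self[of R] by linarith
      also have "\<dots> \<le> - R * exp (- R)" using False by (simp add: mult_le_cancel_left1)
      finally show ?thesis using False by simp
    qed
    then have "E * \<bar>exp R - 1\<bar> \<le> E * (\<bar>R\<bar> * exp \<bar>R\<bar>)" using EG by (intro mult_left_mono) auto
    also have "\<dots> = \<bar>R\<bar> * (E * exp \<bar>R\<bar>)" by simp
    also have "\<dots> \<le> (K * s * (4 * (1 + v ^ 3))) * (exp 1 * G)"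
    proof (rule mult_mono)
      have "K * s * (v * (1 + v)\<^sup>2) \<le> K * s * (4 * (1 + v ^ 3))"
        using cube pos by (intro mult_left_mono) auto
      with R1 show "\<bar>R\<bar> \<le> K * s * (4 * (1 + v ^ 3))" by linarith
    qed (use Eexp EG pos v3 in auto)
    finally have qE_diff: "\<bar>q - E\<bar> \<le> (K * s * (4 * (1 + v ^ 3))) * (exp 1 * G)"
      unfolding qE using EG by (simp add: abs_mult[symmetric] algebra_simps abs_mult_pos')
    have "\<bar>p - p0\<bar> \<le> L * (s * ((1 + K) * (1 + v ^ 3)))"
    proof -
      have "\<bar>\<theta> - \<theta>0\<bar> \<le> \<bar>h\<bar> + \<bar>\<theta>h - \<theta>0\<bar>" by (simp add: h)
      also have "\<dots> \<le> s * v + K * s" using \<theta>h pos by (simp add: hu abs_mult v_def)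
      also have "\<dots> = s * (v + K)" by (simp add: algebra_simps)
      also have "\<dots> \<le> s * ((1 + K) * (1 + v ^ 3))"
      proof (rule mult_left_mono)
        have "K * 1 \<le> K * (1 + v ^ 3)" using v3 pos by (intro mult_left_mono) auto
        then show "v + K \<le> (1 + K) * (1 + v ^ 3)" using cube(1) by (simp add: algebra_simps)
      qed (use pos in simp)
      finally show ?thesis using p pos by (meson mult_left_mono order.trans)
    qed
    then have pq: "\<bar>p - p0\<bar> * q \<le> (L * (s * ((1 + K) * (1 + v ^ 3)))) * (exp 1 * G)"
      using q_le q pos v3 by (intro mult_mono) auto
    have "p * q - p0 * E = (p - p0) * q + p0 * (q - E)" by (simp add: algebra_simps)
    then have "\<bar>p * q - p0 * E\<bar> \<le> \<bar>p - p0\<bar> * q + p0 * \<bar>q - E\<bar>"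
      using abs_triangle_ineq[of "(p - p0) * q" "p0 * (q - E)"] q pos by (simp add: abs_mult)
    also have "\<dots> \<le> (L * (s * ((1 + K) * (1 + v ^ 3)))) * (exp 1 * G)
        + p0 * ((K * s * (4 * (1 + v ^ 3))) * (exp 1 * G))"
      using pq qE_diff pos by (intro add_mono mult_left_mono) auto
    also have "\<dots> = s * ?A * ((1 + v ^ 3) * G)" by (simp add: algebra_simps)
    also have "\<dots> \<le> s * (?A + ?B) * ((1 + v ^ 3) * G)"
      using AB pos v3 EG by (intro mult_right_mono mult_left_mono) auto
    also have "\<dots> \<le> \<dots> + p * b" using pos by simp
    finally show ?thesis unfolding E_def G_def v_def .
  next
    case False
    then have pq: "0 \<le> p * q" "p * q \<le> p * b" using far by auto
    have "\<delta> / 2 \<le> \<bar>h\<bar>" using False \<theta>h unfolding h by linarith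
    then have "1 \<le> 2 / \<delta> * (s * v)" using pos by (simp add: hu abs_mult v_def field_simps)
    also have "\<dots> \<le> 2 / \<delta> * (s * (1 + v ^ 3))" using cube pos by (intro mult_left_mono) auto
    finally have "(p0 * E) * 1 \<le> (p0 * E) * (2 / \<delta> * (s * (1 + v ^ 3)))"
      using pos EG by (intro mult_left_mono) auto
    also have "\<dots> \<le> (p0 * G) * (2 / \<delta> * (s * (1 + v ^ 3)))"
      using pos EG v3 by (intro mult_right_mono mult_left_mono) auto
    also have "\<dots> = s * ?B * ((1 + v ^ 3) * G)" by simp
    also have "\<dots> \<le> s * (?A + ?B) * ((1 + v ^ 3) * G)"
      using AB pos v3 EG by (intro mult_right_mono mult_left_mono) auto
    finally have "p0 * E \<le> s * (?A + ?B) * ((1 + v ^ 3) * G)" by simp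
    moreover have "0 \<le> p0 * E" using pos EG by simp
    moreover have "\<bar>p * q - p0 * E\<bar> \<le> p * q + p0 * E" using pq \<open>0 \<le> p0 * E\<close> by linarith
    ultimately show ?thesis using pq unfolding E_def G_def v_def by linarith
  qed
qed

text \<open>
  The two summands come from the two error terms in \<open>moment_near_gaussian\<close>: the first from the Gaussian one, integrated in the
  variable \<open>u = (\<theta> - \<theta>h) / s\<close>, the second from the exponentially small one by \<open>exp_neg_le_power\<close>.
\<close>

definition moment_const :: "real \<Rightarrow> real \<Rightarrow> real \<Rightarrow> real \<Rightarrow> nat \<Rightarrow> real" where
  "moment_const I c A D k =
     A * (\<integral>u. \<bar>u\<bar> ^ k * ((1 + \<bar>u\<bar> ^ 3) * exp (- (I / 4) * u\<^sup>2)) \<partial>lborel)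
     + D ^ k * (real (k + 2) / c) ^ (k + 2)"

lemma moment_near_gaussian:
  fixes I A D p0 c s \<theta>h :: real and \<rho> w :: "real \<Rightarrow> real"
  assumes pos: "0 < I" "0 < c" "0 \<le> D"
    and s: "0 < s" "s \<le> 1" and [measurable]: "w \<in> borel_measurable borel" "\<rho> \<in> borel_measurable borel"
    and \<rho>: "\<And>\<theta>. 0 \<le> \<rho> \<theta>" "(\<integral>\<^sup>+\<theta>. ennreal (\<rho> \<theta>) \<partial>lborel) = 1"
    and D: "\<And>\<theta>. \<rho> \<theta> \<noteq> 0 \<Longrightarrow> \<bar>\<theta> - \<theta>h\<bar> \<le> D"
    and le: "\<And>\<theta>. \<bar>w \<theta> - p0 * exp (- I * ((\<theta> - \<theta>h) / s)\<^sup>2 / 2)\<bar>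
       \<le> s * A * ((1 + \<bar>(\<theta> - \<theta>h) / s\<bar> ^ 3) * exp (- (I / 4) * ((\<theta> - \<theta>h) / s)\<^sup>2)) + \<rho> \<theta> * exp (- c / s\<^sup>2)"
  shows "\<bar>(\<integral>\<theta>. (\<theta> - \<theta>h) ^ k * w \<theta> \<partial>lborel) - s ^ (k + 1) * (p0 * gauss_moment I k)\<bar>
      \<le> moment_const I c A D k * s ^ (k + 2)"
proof -
  define g where "g u = \<bar>u\<bar> ^ k * ((1 + \<bar>u\<bar> ^ 3) * exp (- (I / 4) * u\<^sup>2))" for u :: real
  have g_int: "integrable lborel g"
  proof -
    have "g = (\<lambda>u. \<bar>u\<bar> ^ k * exp (- (I / 4) * u\<^sup>2) + \<bar>u\<bar> ^ (k + 3) * exp (- (I / 4) * u\<^sup>2))"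
      by (auto simp: g_def algebra_simps power_add)
    then show ?thesis using integrable_gaussian_abs_moment[of "I / 4"] pos by simp
  qed
  define f where "f u = u ^ k * exp (- I * u\<^sup>2 / 2)" for u :: real
  have f_int: "integrable lborel f"
    using integrable_gaussian_moment[of "I / 2" k] pos by (simp add: f_def[abs_def])
  have aff: "integrable lborel (\<lambda>\<theta>. F ((\<theta> - \<theta>h) / s)) \<and>
      (\<integral>\<theta>. F ((\<theta> - \<theta>h) / s) \<partial>lborel) = s * (\<integral>u. F u \<partial>lborel)"
    if "integrable lborel F" for F :: "real \<Rightarrow> real"
  proof -
    have eq: "F ((\<theta> - \<theta>h) / s) = F (- \<theta>h / s + (1 / s) * \<theta>)" for \<theta> by (simp add: diff_divide_distrib)
    have "integrable lborel (\<lambda>\<theta>. F (- \<theta>h / s + (1 / s) * \<theta>))"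
      using s by (intro lborel_integrable_real_affine that) auto
    moreover have "(\<integral>u. F u \<partial>lborel) = \<bar>1 / s\<bar> *\<^sub>R (\<integral>\<theta>. F (- \<theta>h / s + (1 / s) * \<theta>) \<partial>lborel)"
      using s by (intro lborel_integral_real_affine) auto
    ultimately show ?thesis using s unfolding eq by simp
  qed
  have \<rho>_int: "integrable lborel \<rho>" "(\<integral>\<theta>. \<rho> \<theta> \<partial>lborel) = 1"
    using \<rho> integrableI_nonneg[of \<rho> lborel] integral_eq_nn_integral[of \<rho> lborel] by auto
  let ?m = "\<lambda>\<theta>. s ^ k * (p0 * f ((\<theta> - \<theta>h) / s))"
  let ?e = "\<lambda>\<theta>. s ^ k * (s * A * g ((\<theta> - \<theta>h) / s)) + D ^ k * exp (- c / s\<^sup>2) * \<rho> \<theta>"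
  have m_int: "integrable lborel ?m" using aff[OF f_int] by simp
  have e_int: "integrable lborel ?e" using aff[OF g_int] \<rho>_int by simp
  have bound: "\<bar>(\<theta> - \<theta>h) ^ k * w \<theta> - ?m \<theta>\<bar> \<le> ?e \<theta>" for \<theta>
  proof -
    define u where "u = (\<theta> - \<theta>h) / s"
    have h: "\<theta> - \<theta>h = s * u" using s by (simp add: u_def)
    have "(\<theta> - \<theta>h) ^ k * w \<theta> - ?m \<theta> = (s * u) ^ k * (w \<theta> - p0 * exp (- I * u\<^sup>2 / 2))"
      unfolding f_def u_def[symmetric] unfolding h by (simp only: power_mult_distrib right_diff_distrib mult_ac)
    then have "\<bar>(\<theta> - \<theta>h) ^ k * w \<theta> - ?m \<theta>\<bar> = \<bar>s * u\<bar> ^ k * \<bar>w \<theta> - p0 * exp (- I * u\<^sup>2 / 2)\<bar>"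
      by (simp add: abs_mult power_abs)
    also have "\<dots> \<le> \<bar>s * u\<bar> ^ k * (s * A * ((1 + \<bar>u\<bar> ^ 3) * exp (- (I / 4) * u\<^sup>2)) + \<rho> \<theta> * exp (- c / s\<^sup>2))"
      using le[of \<theta>] unfolding u_def[symmetric] by (intro mult_left_mono) auto
    also have "\<dots> = s ^ k * (s * A * g u) + \<bar>s * u\<bar> ^ k * exp (- c / s\<^sup>2) * \<rho> \<theta>"
      using s by (simp add: g_def abs_mult power_mult_distrib algebra_simps)
    also have "\<bar>s * u\<bar> ^ k * exp (- c / s\<^sup>2) * \<rho> \<theta> \<le> D ^ k * exp (- c / s\<^sup>2) * \<rho> \<theta>"
    proof (cases "\<rho> \<theta> = 0")
      case False
      then show ?thesis using D[OF False] \<rho>(1)[of \<theta>] h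
        by (intro mult_right_mono power_mono) auto
    qed simp
    finally show ?thesis unfolding u_def by simp
  qed
  have int1: "integrable lborel (\<lambda>\<theta>. (\<theta> - \<theta>h) ^ k * w \<theta> - ?m \<theta>)"
  proof (rule Bochner_Integration.integrable_bound[OF e_int])
    have [measurable]: "f \<in> borel_measurable borel" unfolding f_def by measurable
    show "(\<lambda>\<theta>. (\<theta> - \<theta>h) ^ k * w \<theta> - ?m \<theta>) \<in> borel_measurable lborel" by measurable
  qed (auto intro!: AE_I2 order.trans[OF bound])
  have int2: "integrable lborel (\<lambda>\<theta>. (\<theta> - \<theta>h) ^ k * w \<theta>)"
    using Bochner_Integration.integrable_add[OF int1 m_int] by simp
  have "(\<integral>\<theta>. ?m \<theta> \<partial>lborel) = s ^ (k + 1) * (p0 * gauss_moment I k)"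
    using aff[OF f_int] by (simp add: gauss_moment_def f_def[abs_def])
  then have "\<bar>(\<integral>\<theta>. (\<theta> - \<theta>h) ^ k * w \<theta> \<partial>lborel) - s ^ (k + 1) * (p0 * gauss_moment I k)\<bar>
      = \<bar>\<integral>\<theta>. (\<theta> - \<theta>h) ^ k * w \<theta> - ?m \<theta> \<partial>lborel\<bar>"
    by (simp only: Bochner_Integration.integral_diff[OF int2 m_int])
  also have "\<dots> \<le> (\<integral>\<theta>. \<bar>(\<theta> - \<theta>h) ^ k * w \<theta> - ?m \<theta>\<bar> \<partial>lborel)" by (rule integral_abs_bound)
  also have "\<dots> \<le> (\<integral>\<theta>. ?e \<theta> \<partial>lborel)"
    using int1 e_int bound by (intro integral_mono) auto
  also have "\<dots> = s ^ (k + 2) * (A * (\<integral>u. g u \<partial>lborel)) + D ^ k * exp (- c / s\<^sup>2)"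
    using aff[OF g_int] \<rho>_int by (subst Bochner_Integration.integral_add) (auto simp: algebra_simps)
  also have "D ^ k * exp (- c / s\<^sup>2) \<le> D ^ k * ((real (k + 2) / c) ^ (k + 2) * s ^ (k + 2))"
  proof (rule mult_left_mono)
    have "exp (- c / s\<^sup>2) \<le> (real (k + 2) / c) ^ (k + 2) * s ^ (2 * (k + 2))"
      using pos s by (intro exp_neg_le_power) auto
    also have "\<dots> \<le> (real (k + 2) / c) ^ (k + 2) * s ^ (k + 2)"
      using s pos by (intro mult_left_mono power_decreasing) auto
    finally show "exp (- c / s\<^sup>2) \<le> (real (k + 2) / c) ^ (k + 2) * s ^ (k + 2)" .
  qed (use pos in simp)
  finally show ?thesis
    unfolding moment_const_def g_def[symmetric] by (simp add: algebra_simps)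
qed

lemma quotient_perturbation:
  fixes a b x y C s :: real
  assumes "\<bar>x - a\<bar> \<le> C * s" "\<bar>y - b\<bar> \<le> C * s" "0 < b" "C * s \<le> b / 2"
  shows "\<bar>x / y - a / b\<bar> \<le> 2 * C * (b + \<bar>a\<bar>) / b\<^sup>2 * s"
proof -
  have y: "b / 2 \<le> y" using assms by linarith
  have "x / y - a / b = ((x - a) * b - a * (y - b)) / (y * b)"
  proof -
    have "y \<noteq> 0" "b \<noteq> 0" using y assms by auto
    then have "x / y - a / b = (x * b - a * y) / (y * b)" by (rule diff_frac_eq)
    also have "x * b - a * y = (x - a) * b - a * (y - b)" by (simp add: algebra_simps)
    finally show ?thesis .
  qed
  also have "\<bar>\<dots>\<bar> = \<bar>(x - a) * b - a * (y - b)\<bar> / (y * b)"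
    using y assms by simp
  also have "\<dots> \<le> (C * s * (b + \<bar>a\<bar>)) / (b / 2 * b)"
  proof (rule frac_le)
    have "\<bar>(x - a) * b - a * (y - b)\<bar> \<le> \<bar>x - a\<bar> * b + \<bar>a\<bar> * \<bar>y - b\<bar>"
      using abs_triangle_ineq4[of "(x - a) * b" "a * (y - b)"] assms by (simp add: abs_mult)
    also have "\<dots> \<le> (C * s) * b + \<bar>a\<bar> * (C * s)"
      using assms by (intro add_mono mult_right_mono mult_left_mono) auto
    finally show "\<bar>(x - a) * b - a * (y - b)\<bar> \<le> C * s * (b + \<bar>a\<bar>)" by (simp add: algebra_simps)
    show "b / 2 * b \<le> y * b" using y assms by (intro mult_right_mono) auto
    have "0 \<le> C * s" using assms by linarith
    then show "0 \<le> C * s * (b + \<bar>a\<bar>)" using assms by simp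
  qed (use assms in auto)
  also have "\<dots> = 2 * C * (b + \<bar>a\<bar>) / b\<^sup>2 * s" by (simp add: power2_eq_square)
  finally show ?thesis .
qed

text \<open>
  The hypothesis of Laplace's method at scale \<open>s = n\<^sup>-\<^sup>1\<^sup>/\<^sup>2\<close>.  The arguments up to \<open>\<rho>\<close> are chosen before the sample; \<open>s\<close>, \<open>\<theta>h\<close> and
  \<open>pl\<close> depend on it.
\<close>

definition near_gaussian_profile ::
  "real \<Rightarrow> real \<Rightarrow> real \<Rightarrow> real \<Rightarrow> real \<Rightarrow> real \<Rightarrow> (real \<Rightarrow> real) \<Rightarrow> real \<Rightarrow> real \<Rightarrow> (real \<Rightarrow> real) \<Rightarrow> bool" where
  "near_gaussian_profile I K c \<delta> D \<theta>0 \<rho> s \<theta>h pl \<longleftrightarrow>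
     \<bar>\<theta>h - \<theta>0\<bar> \<le> K * s \<and> 0 < pl \<theta>h \<and> (\<lambda>\<theta>. \<rho> \<theta> * pl \<theta>) \<in> borel_measurable borel \<and>
     (\<forall>\<theta>. \<rho> \<theta> \<noteq> 0 \<longrightarrow> \<bar>\<theta> - \<theta>h\<bar> \<le> D) \<and>
     (\<forall>\<theta>. \<bar>\<theta> - \<theta>0\<bar> < \<delta> \<longrightarrow> 0 < pl \<theta> \<and>
        \<bar>ln (pl \<theta> / pl \<theta>h) + I * (\<theta> - \<theta>h)\<^sup>2 / (2 * s\<^sup>2)\<bar> \<le> K * \<bar>\<theta> - \<theta>h\<bar> * (s + \<bar>\<theta> - \<theta>h\<bar>)\<^sup>2 / s\<^sup>2) \<and>
     (\<forall>\<theta>. \<delta> \<le> \<bar>\<theta> - \<theta>0\<bar> \<longrightarrow> \<rho> \<theta> \<noteq> 0 \<longrightarrow> 0 \<le> pl \<theta> \<and> pl \<theta> \<le> pl \<theta>h * exp (- c / s\<^sup>2))"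

text \<open>
  The posterior moment is the quotient of the integrals of \<open>(\<theta> - \<theta>h) ^ r\<close> and of \<open>1\<close> against \<open>\<rho> * pl / pl \<theta>h\<close>.  Both are known up
  to a factor \<open>s\<close> smaller error, and their common factor \<open>s * \<rho> \<theta>0\<close> cancels.  The constants \<open>s0\<close> and \<open>C\<close> serve all likelihoods at
  once, which is what allows the likelihood to be random in the application.
\<close>

lemma posterior_moment_expansion:
  fixes I K L D \<delta> c \<theta>0 :: real and \<rho> :: "real \<Rightarrow> real"
  assumes pos: "0 < I" "0 \<le> K" "0 \<le> L" "0 < \<rho> \<theta>0" "0 < \<delta>" "0 < c" "0 \<le> D"
    and \<delta>: "16 * K * \<delta> \<le> I" "4 * K * \<delta> \<le> 1"
    and \<rho>: "\<rho> \<in> borel_measurable borel" "\<And>\<theta>. 0 \<le> \<rho> \<theta>" "(\<integral>\<^sup>+\<theta>. ennreal (\<rho> \<theta>) \<partial>lborel) = 1"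
    and lip: "\<And>\<theta>. \<bar>\<theta> - \<theta>0\<bar> < \<delta> \<Longrightarrow> \<bar>\<rho> \<theta> - \<rho> \<theta>0\<bar> \<le> L * \<bar>\<theta> - \<theta>0\<bar>"
  obtains s0 C where "0 < s0"
    "\<And>s \<theta>h pl. \<lbrakk>0 < s; s \<le> s0; near_gaussian_profile I K c \<delta> D \<theta>0 \<rho> s \<theta>h pl\<rbrakk> \<Longrightarrow>
       \<bar>(\<integral>\<theta>. ((\<theta> - \<theta>h) * sqrt I) ^ r \<partial>profile_posterior \<rho> pl)
          - s ^ r * (\<integral>u. u ^ r \<partial>std_normal_distribution)\<bar> \<le> C * s ^ (r + 1)"
proof -
  define p0 where "p0 = \<rho> \<theta>0"
  define A where "A = exp 1 * (L * (1 + K) + 4 * p0 * K) + 2 * p0 / \<delta>"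
  have "0 \<le> A" using pos by (simp add: A_def p0_def)
  define C0 where "C0 = moment_const I c A D 0"
  define Cr where "Cr = moment_const I c A D r"
  have C0: "0 \<le> C0"
    using pos \<open>0 \<le> A\<close> by (simp add: C0_def moment_const_def)
  define C where "C = max C0 Cr"
  define b where "b = p0 * gauss_moment I 0"
  define a where "a = p0 * gauss_moment I r"
  have "0 < b" using pos gauss_moment_0_pos[OF pos(1)] by (simp add: b_def p0_def)
  have "0 \<le> C" using C0 by (simp add: C_def)
  define s0 where "s0 = min 1 (min (\<delta> / (2 * (K + 1))) (b / (2 * (C + 1))))"
  have s0: "0 < s0" "s0 \<le> 1" "K * s0 \<le> \<delta> / 2" "C * s0 \<le> b / 2"
  proof -
    show "0 < s0" "s0 \<le> 1" using pos \<open>0 < b\<close> \<open>0 \<le> C\<close> by (auto simp: s0_def)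
    have "K * s0 \<le> (K + 1) * (\<delta> / (2 * (K + 1)))" using pos \<open>0 < s0\<close> by (intro mult_mono) (auto simp: s0_def)
    also have "\<dots> = \<delta> / 2" using pos by (simp add: divide_simps)
    finally show "K * s0 \<le> \<delta> / 2" .
    have "C * s0 \<le> (C + 1) * (b / (2 * (C + 1)))"
      using \<open>0 \<le> C\<close> \<open>0 < b\<close> \<open>0 < s0\<close> by (intro mult_mono) (auto simp: s0_def)
    also have "\<dots> = b / 2" using \<open>0 \<le> C\<close> by (simp add: divide_simps)
    finally show "C * s0 \<le> b / 2" .
  qed
  define C' where "C' = sqrt I ^ r * (2 * C * (b + \<bar>a\<bar>) / b\<^sup>2)"
  show ?thesis
  proof (rule that[OF \<open>0 < s0\<close>, of C'])
    fix s \<theta>h :: real and pl :: "real \<Rightarrow> real"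
    assume s: "0 < s" "s \<le> s0" and profile: "near_gaussian_profile I K c \<delta> D \<theta>0 \<rho> s \<theta>h pl"
    then have \<theta>h: "\<bar>\<theta>h - \<theta>0\<bar> \<le> K * s" and plh: "0 < pl \<theta>h"
      and meas [measurable]: "(\<lambda>\<theta>. \<rho> \<theta> * pl \<theta>) \<in> borel_measurable borel"
      and D: "\<And>\<theta>. \<rho> \<theta> \<noteq> 0 \<Longrightarrow> \<bar>\<theta> - \<theta>h\<bar> \<le> D"
      and near: "\<And>\<theta>. \<bar>\<theta> - \<theta>0\<bar> < \<delta> \<Longrightarrow> 0 < pl \<theta> \<and>
         \<bar>ln (pl \<theta> / pl \<theta>h) + I * (\<theta> - \<theta>h)\<^sup>2 / (2 * s\<^sup>2)\<bar> \<le> K * \<bar>\<theta> - \<theta>h\<bar> * (s + \<bar>\<theta> - \<theta>h\<bar>)\<^sup>2 / s\<^sup>2"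
      and far: "\<And>\<theta>. \<delta> \<le> \<bar>\<theta> - \<theta>0\<bar> \<Longrightarrow> \<rho> \<theta> \<noteq> 0 \<Longrightarrow> 0 \<le> pl \<theta> \<and> pl \<theta> \<le> pl \<theta>h * exp (- c / s\<^sup>2)"
      unfolding near_gaussian_profile_def by blast+
    define w where "w \<theta> = \<rho> \<theta> * (pl \<theta> / pl \<theta>h)" for \<theta>
    have w_eq: "w = (\<lambda>\<theta>. \<rho> \<theta> * pl \<theta> / pl \<theta>h)" by (simp add: w_def[abs_def])
    have w_meas [measurable]: "w \<in> borel_measurable borel" unfolding w_eq by measurable
    have "K * s \<le> \<delta> / 2" using s s0(3) pos mult_left_mono[of s s0 K] by linarith
    have w_bound: "\<bar>w \<theta> - p0 * exp (- I * ((\<theta> - \<theta>h) / s)\<^sup>2 / 2)\<bar>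
         \<le> s * A * ((1 + \<bar>(\<theta> - \<theta>h) / s\<bar> ^ 3) * exp (- (I / 4) * ((\<theta> - \<theta>h) / s)\<^sup>2)) + \<rho> \<theta> * exp (- c / s\<^sup>2)" for \<theta>
      unfolding w_def A_def
    proof (rule weight_near_gaussian[OF s(1) pos(1-3) _ pos(5) \<rho>(2) _ \<delta> \<theta>h \<open>K * s \<le> \<delta> / 2\<close> refl refl])
      assume "\<bar>\<theta> - \<theta>0\<bar> < \<delta>"
      then show "0 < pl \<theta> / pl \<theta>h \<and> \<bar>\<rho> \<theta> - p0\<bar> \<le> L * \<bar>\<theta> - \<theta>0\<bar> \<and>
        \<bar>ln (pl \<theta> / pl \<theta>h) + I * (\<theta> - \<theta>h)\<^sup>2 / (2 * s\<^sup>2)\<bar> \<le> K * \<bar>\<theta> - \<theta>h\<bar> * (s + \<bar>\<theta> - \<theta>h\<bar>)\<^sup>2 / s\<^sup>2"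
        using near lip plh by (simp add: p0_def)
    next
      assume *: "\<delta> \<le> \<bar>\<theta> - \<theta>0\<bar>"
      show "0 \<le> \<rho> \<theta> * (pl \<theta> / pl \<theta>h) \<and> \<rho> \<theta> * (pl \<theta> / pl \<theta>h) \<le> \<rho> \<theta> * exp (- c / s\<^sup>2)"
      proof (cases "\<rho> \<theta> = 0")
        case False
        then show ?thesis using far[OF * False] plh \<rho>(2)[of \<theta>]
          by (auto intro!: mult_left_mono simp: field_simps)
      qed simp
    qed (use pos in \<open>auto simp: p0_def\<close>)
    have s1: "s \<le> 1" using s s0 by linarith
    note mom = moment_near_gaussian[OF pos(1,6,7) s(1) s1 w_meas \<rho> D w_bound]
    note m0 = mom[of 0, folded C0_def] and mr = mom[of r, folded Cr_def]
    define M0 where "M0 = (\<integral>\<theta>. w \<theta> \<partial>lborel)"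
    define Mr where "Mr = (\<integral>\<theta>. (\<theta> - \<theta>h) ^ r * w \<theta> \<partial>lborel)"
    have scaled: "\<bar>y - t * x\<bar> / t = \<bar>y / t - x\<bar>" if "0 < t" for t x y :: real
    proof -
      have "y / t - x = (y - t * x) / t" using that by (simp add: diff_divide_distrib)
      then show ?thesis using that by simp
    qed
    have M0: "\<bar>M0 / s - b\<bar> \<le> C * s"
    proof -
      have "\<bar>M0 - s * b\<bar> \<le> C0 * s\<^sup>2" using m0 by (simp add: M0_def b_def power2_eq_square)
      also have "\<dots> \<le> C * s\<^sup>2" by (intro mult_right_mono) (auto simp: C_def)
      finally have "\<bar>M0 - s * b\<bar> / s \<le> C * s\<^sup>2 / s" using s by (intro divide_right_mono) auto
      moreover have "\<bar>M0 - s * b\<bar> / s = \<bar>M0 / s - b\<bar>"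
        using scaled[OF s(1)] by simp
      ultimately show ?thesis using s by (simp add: power2_eq_square)
    qed
    have Mr: "\<bar>Mr / s ^ (r + 1) - a\<bar> \<le> C * s"
    proof -
      have "\<bar>Mr - s ^ (r + 1) * a\<bar> \<le> Cr * s ^ (r + 2)" using mr by (simp add: Mr_def a_def)
      also have "\<dots> \<le> C * s ^ (r + 2)" using s by (intro mult_right_mono) (auto simp: C_def)
      finally have "\<bar>Mr - s ^ (r + 1) * a\<bar> / s ^ (r + 1) \<le> C * s ^ (r + 2) / s ^ (r + 1)"
        using s by (intro divide_right_mono) auto
      moreover have "\<bar>Mr - s ^ (r + 1) * a\<bar> / s ^ (r + 1) = \<bar>Mr / s ^ (r + 1) - a\<bar>"
      proof -
        have "0 < s ^ (r + 1)" using s by simp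
        then show ?thesis using scaled by blast
      qed
      ultimately show ?thesis using s by (simp add: field_simps)
    qed
    have "C * s \<le> b / 2" using s s0(4) \<open>0 \<le> C\<close> mult_left_mono[of s s0 C] by linarith
    note quot = quotient_perturbation[OF Mr M0 \<open>0 < b\<close> this]
    have "0 < M0"
    proof -
      have "b / 2 \<le> M0 / s" using M0 \<open>C * s \<le> b / 2\<close> by linarith
      then have "0 < M0 / s" using \<open>0 < b\<close> by linarith
      then show ?thesis using s by (simp add: zero_less_divide_iff)
    qed
    have w0: "0 \<le> w \<theta>" for \<theta>
    proof (cases "\<bar>\<theta> - \<theta>0\<bar> < \<delta>")
      case True
      then show ?thesis using near[OF True] plh \<rho>(2)[of \<theta>] by (simp add: w_def)
    next
      case False
      then show ?thesis using far[of \<theta>] plh \<rho>(2)[of \<theta>] by (cases "\<rho> \<theta> = 0") (auto simp: w_def)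
    qed
    have norm: "(\<integral>t. \<rho> t * pl t \<partial>lborel) = pl \<theta>h * M0"
      using plh by (simp add: M0_def w_eq)
    have dens: "\<rho> \<theta> * pl \<theta> / (\<integral>t. \<rho> t * pl t \<partial>lborel) = w \<theta> / M0" for \<theta>
      unfolding norm using plh \<open>0 < M0\<close> by (simp add: w_def field_simps)
    have "(\<integral>\<theta>. ((\<theta> - \<theta>h) * sqrt I) ^ r \<partial>profile_posterior \<rho> pl)
        = (\<integral>\<theta>. (w \<theta> / M0) *\<^sub>R ((\<theta> - \<theta>h) * sqrt I) ^ r \<partial>lborel)"
      unfolding profile_posterior_def dens using w0 \<open>0 < M0\<close>
      by (intro integral_density) auto
    also have "\<dots> = (\<integral>\<theta>. (sqrt I ^ r / M0) * ((\<theta> - \<theta>h) ^ r * w \<theta>) \<partial>lborel)"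
      by (intro Bochner_Integration.integral_cong) (auto simp: power_mult_distrib)
    also have "\<dots> = sqrt I ^ r * (Mr / M0)" by (simp add: Mr_def)
    also have "\<dots> = s ^ r * (sqrt I ^ r * ((Mr / s ^ (r + 1)) / (M0 / s)))" using s by simp
    finally have post: "(\<integral>\<theta>. ((\<theta> - \<theta>h) * sqrt I) ^ r \<partial>profile_posterior \<rho> pl)
        = s ^ r * (sqrt I ^ r * ((Mr / s ^ (r + 1)) / (M0 / s)))" .
    have "a / b = gauss_moment I r / gauss_moment I 0" using pos by (simp add: a_def b_def p0_def)
    then have "(\<integral>u. u ^ r \<partial>std_normal_distribution) = sqrt I ^ r * (a / b)"
      using gauss_moment_ratio[OF pos(1), of r] by simp
    then have "(\<integral>\<theta>. ((\<theta> - \<theta>h) * sqrt I) ^ r \<partial>profile_posterior \<rho> pl)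
          - s ^ r * (\<integral>u. u ^ r \<partial>std_normal_distribution)
        = (s ^ r * sqrt I ^ r) * ((Mr / s ^ (r + 1)) / (M0 / s) - a / b)"
      unfolding post by (simp add: right_diff_distrib mult.assoc)
    then have "\<bar>(\<integral>\<theta>. ((\<theta> - \<theta>h) * sqrt I) ^ r \<partial>profile_posterior \<rho> pl)
          - s ^ r * (\<integral>u. u ^ r \<partial>std_normal_distribution)\<bar>
        = (s ^ r * sqrt I ^ r) * \<bar>(Mr / s ^ (r + 1)) / (M0 / s) - a / b\<bar>"
      using s pos by (simp only: abs_mult) simp
    also have "\<dots> \<le> (s ^ r * sqrt I ^ r) * (2 * C * (b + \<bar>a\<bar>) / b\<^sup>2 * s)"
      using quot s pos by (intro mult_left_mono) auto
    also have "\<dots> = C' * s ^ (r + 1)" by (simp add: C'_def)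
    finally show "\<bar>(\<integral>\<theta>. ((\<theta> - \<theta>h) * sqrt I) ^ r \<partial>profile_posterior \<rho> pl)
          - s ^ r * (\<integral>u. u ^ r \<partial>std_normal_distribution)\<bar> \<le> C' * s ^ (r + 1)" .
  qed
qed

section \<open>Quadratic expansion of the profile likelihood for a regular sample\<close>

lemma lipschitz_of_DERIV:
  fixes f f' :: "real \<Rightarrow> real"
  assumes "\<And>t. t \<in> closed_segment x c \<Longrightarrow> (f has_real_derivative f' t) (at t)"
    and "\<And>t. t \<in> closed_segment x c \<Longrightarrow> \<bar>f' t\<bar> \<le> B"
  shows "\<bar>f x - f c\<bar> \<le> B * \<bar>x - c\<bar>"
  using field_differentiable_bound[of "closed_segment x c" f f' B x c] assms
  by (auto intro: has_field_derivative_at_within)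

lemma linear_approx_of_DERIV2:
  fixes f f1 f2 :: "real \<Rightarrow> real"
  assumes "\<And>t. t \<in> closed_segment x c \<Longrightarrow> (f has_real_derivative f1 t) (at t)"
    and "\<And>t. t \<in> closed_segment x c \<Longrightarrow> (f1 has_real_derivative f2 t) (at t)"
    and "\<And>t. t \<in> closed_segment x c \<Longrightarrow> \<bar>f2 t\<bar> \<le> B"
  shows "\<bar>f x - f c - f1 c * (x - c)\<bar> \<le> B * (x - c)\<^sup>2"
proof -
  let ?g = "\<lambda>t. f t - f1 c * (t - c)"
  have "\<bar>?g x - ?g c\<bar> \<le> (B * \<bar>x - c\<bar>) * \<bar>x - c\<bar>"
  proof (rule lipschitz_of_DERIV[where f' = "\<lambda>t. f1 t - f1 c"])
    fix t assume t: "t \<in> closed_segment x c"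
    show "(?g has_real_derivative f1 t - f1 c) (at t)"
      using assms(1)[OF t] by (auto intro!: derivative_eq_intros)
    have sub: "closed_segment t c \<subseteq> closed_segment x c" using t by (intro subset_closed_segment[THEN iffD2]) auto
    have "\<bar>f1 t - f1 c\<bar> \<le> B * \<bar>t - c\<bar>"
      by (rule lipschitz_of_DERIV[of t c f1 f2]) (use sub assms in auto)
    also have "\<dots> \<le> B * \<bar>x - c\<bar>"
    proof (rule mult_left_mono)
      show "\<bar>t - c\<bar> \<le> \<bar>x - c\<bar>" using t by (auto simp: closed_segment_eq_real_ivl split: if_splits)
      show "0 \<le> B" using assms(3)[OF t] by linarith
    qed
    finally show "\<bar>f1 t - f1 c\<bar> \<le> B * \<bar>x - c\<bar>" .
  qed
  then show ?thesis by (simp add: power2_eq_square abs_mult)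
qed

text \<open>
  The constants below depend on \<open>K\<close> and \<open>I\<close> only, so that radii can be chosen in terms of them before the
  sample is known: \<open>score_const\<close> bounds the nonlinearity of the score, \<open>mle_const\<close> the rate of the maximum likelihood
  estimator, and \<open>expansion_const\<close> the cubic remainder of the profile likelihood.
\<close>

definition score_const :: "real \<Rightarrow> real" where
  "score_const K = 10 * K ^ 3"

definition mle_const :: "real \<Rightarrow> real \<Rightarrow> real" where
  "mle_const I K = 2 * (K + 2 * score_const K) / I"

definition expansion_const :: "real \<Rightarrow> real \<Rightarrow> real" where
  "expansion_const I K = 2 * score_const K * (2 + 2 * mle_const I K)\<^sup>2 + mle_const I K"

lemma expansion_consts:
  assumes "0 < I" "1 \<le> K"
  shows "0 < score_const K" "0 < mle_const I K" "mle_const I K \<le> expansion_const I K"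
    "0 < expansion_const I K"
proof -
  show 1: "0 < score_const K" using assms by (simp add: score_const_def)
  show 2: "0 < mle_const I K" using assms 1 by (simp add: mle_const_def)
  show 3: "mle_const I K \<le> expansion_const I K" using 1 by (simp add: expansion_const_def)
  show "0 < expansion_const I K" using 2 3 by linarith
qed

lemma prof_lik_attained:
  assumes "is_mle \<Theta> H lik n xs \<theta>h \<eta>h" "\<psi> \<in> \<Theta>"
  shows "prof_lik H lik n xs \<psi> = lik_n lik n xs \<psi> (\<eta>h \<psi>)"
  using assms unfolding is_mle_def prof_lik_def
  by (intro cSup_eq_maximum) auto

lemma prof_lik_le_mle:
  assumes mle: "is_mle \<Theta> H lik n xs \<theta>h \<eta>h" and \<psi>: "\<psi> \<in> \<Theta>"
  shows "prof_lik H lik n xs \<psi> \<le> prof_lik H lik n xs \<theta>h"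
proof -
  have "\<theta>h \<in> \<Theta>" using mle unfolding is_mle_def by blast
  show ?thesis
    unfolding prof_lik_attained[OF mle \<psi>] prof_lik_attained[OF mle \<open>\<theta>h \<in> \<Theta>\<close>]
    using mle \<psi> unfolding is_mle_def by blast
qed

text \<open>
  All inequalities that hold for the \<open>n\<close>-th sample with high probability.  Here \<open>I\<close> is the efficient
  information, and \<open>K\<close> stands for every constant hidden in an \<open>O\<^sub>P\<close> symbol.  The radius of the neighborhood in
  \<open>rate\<close> is \<open>1 / K\<close>, so that each of these conditions becomes weaker as \<open>K\<close> grows.
\<close>

locale regular_sample =
  fixes lik :: "real \<Rightarrow> 'h::real_normed_vector \<Rightarrow> 'x \<Rightarrow> real"
    and \<eta>sub :: "real \<Rightarrow> real \<Rightarrow> 'h \<Rightarrow> 'h"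
    and \<Theta> :: "real set" and H :: "'h set" and \<theta>0 :: real and \<eta>0 :: 'h
    and \<delta> I K :: real and n :: nat and xs :: "nat \<Rightarrow> 'x" and \<theta>h :: real and \<eta>h :: "real \<Rightarrow> 'h"
  assumes K1: "1 \<le> K"
    and mle: "is_mle \<Theta> H lik n xs \<theta>h \<eta>h"
    and smooth: "\<And>i. ell_smooth lik \<eta>sub (nbhd3 \<Theta> H \<theta>0 \<eta>0 \<delta>) (xs i)"
    and remainders: "\<And>t \<theta> \<eta>. (t, \<theta>, \<eta>) \<in> nbhd3 \<Theta> H \<theta>0 \<eta>0 \<delta> \<Longrightarrow>
        \<bar>emp_mean n (ell_deriv lik \<eta>sub 3 0 t \<theta> \<eta>) xs\<bar> \<le> K \<and>
        \<bar>emp_mean n (ell_deriv lik \<eta>sub 1 2 t \<theta> \<eta>) xs\<bar> \<le> K \<and>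
        \<bar>emp_mean n (ell_deriv lik \<eta>sub 2 1 t \<theta> \<eta>) xs\<bar> \<le> K"
    and score0: "\<bar>emp_mean n (ell_deriv lik \<eta>sub 1 0 \<theta>0 \<theta>0 \<eta>0) xs\<bar> \<le> K * (1 / sqrt n)"
    and nuisance: "\<And>\<eta>. \<eta> \<in> H \<Longrightarrow> norm (\<eta> - \<eta>0) < \<delta> \<Longrightarrow>
        \<bar>emp_mean n (ell_deriv lik \<eta>sub 1 0 \<theta>0 \<theta>0 \<eta>) xs
            - emp_mean n (ell_deriv lik \<eta>sub 1 0 \<theta>0 \<theta>0 \<eta>0) xs\<bar>
          \<le> K * (1 / sqrt n * norm (\<eta> - \<eta>0) + (norm (\<eta> - \<eta>0))\<^sup>2) \<and>
        \<bar>emp_mean n (ell_deriv lik \<eta>sub 1 1 \<theta>0 \<theta>0 \<eta>) xs\<bar> \<le> K * (1 / sqrt n + norm (\<eta> - \<eta>0)) \<and>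
        \<bar>emp_mean n (ell_deriv lik \<eta>sub 2 0 \<theta>0 \<theta>0 \<eta>) xs + I\<bar> \<le> K * (1 / sqrt n + norm (\<eta> - \<eta>0))"
    and rate: "\<And>\<psi>. \<psi> \<in> \<Theta> \<Longrightarrow> K * \<bar>\<psi> - \<theta>0\<bar> < 1 \<Longrightarrow>
        norm (\<eta>h \<psi> - \<eta>0) \<le> K * (1 / sqrt n + \<bar>\<psi> - \<theta>0\<bar>)"
begin

abbreviation V where "V \<equiv> nbhd3 \<Theta> H \<theta>0 \<eta>0 \<delta>"

definition S :: "nat \<Rightarrow> nat \<Rightarrow> real \<Rightarrow> real \<Rightarrow> 'h \<Rightarrow> real" where
  "S l m t \<theta> \<eta> = emp_mean n (ell_deriv lik \<eta>sub l m t \<theta> \<eta>) xs"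

abbreviation e where "e \<equiv> 1 / sqrt n"
abbreviation C1 where "C1 \<equiv> score_const K"
abbreviation C2 where "C2 \<equiv> mle_const I K"
abbreviation C3 where "C3 \<equiv> expansion_const I K"
abbreviation Z where "Z \<equiv> S 1 0 \<theta>0 \<theta>0 \<eta>0"

lemma DERIV_S_t:
  assumes "(t, \<theta>, \<eta>) \<in> V" "l \<in> {0, 1, 2}"
  shows "((\<lambda>t. S l 0 t \<theta> \<eta>) has_real_derivative S (Suc l) 0 t \<theta> \<eta>) (at t)"
proof -
  have "((\<lambda>t. ell_deriv lik \<eta>sub l 0 t \<theta> \<eta> (xs i)) has_real_derivative
      ell_deriv lik \<eta>sub (Suc l) 0 t \<theta> \<eta> (xs i)) (at t)" for i
  proof -
    have "(\<lambda>t. ell_deriv lik \<eta>sub l 0 t \<theta> \<eta> (xs i)) field_differentiable (at t)"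
      using smooth[of i] assms unfolding ell_smooth_def by blast
    then show ?thesis by (simp add: DERIV_deriv_iff_field_differentiable[symmetric] ell_deriv_def)
  qed
  then show ?thesis
    unfolding S_def emp_mean_def by (intro DERIV_cdivide DERIV_sum) auto
qed

lemma DERIV_S_theta:
  assumes "(t, \<theta>, \<eta>) \<in> V" "(l, m) \<in> {(1, 0), (1, 1), (2, 0)}"
  shows "((\<lambda>\<theta>. S l m t \<theta> \<eta>) has_real_derivative S l (Suc m) t \<theta> \<eta>) (at \<theta>)"
proof -
  have "((\<lambda>\<theta>. ell_deriv lik \<eta>sub l m t \<theta> \<eta> (xs i)) has_real_derivative
      ell_deriv lik \<eta>sub l (Suc m) t \<theta> \<eta> (xs i)) (at \<theta>)" for i
  proof -
    have "(\<lambda>\<theta>. ell_deriv lik \<eta>sub l m t \<theta> \<eta> (xs i)) field_differentiable (at \<theta>)"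
      using smooth[of i] assms unfolding ell_smooth_def by blast
    then show ?thesis by (simp add: DERIV_deriv_iff_field_differentiable[symmetric] ell_deriv_def)
  qed
  then show ?thesis
    unfolding S_def emp_mean_def by (intro DERIV_cdivide DERIV_sum) auto
qed

text \<open>
  The score along the submodel through \<open>(\<theta>, \<eta>)\<close> is linear in \<open>t\<close> with intercept and slope that do not depend
  on \<open>(\<theta>, \<eta>)\<close>, up to a quadratic error.  By the assumption \<open>nuisance\<close>, moving \<open>\<eta>\<close> away from \<open>\<eta>0\<close> changes the score only to
  second order, and the mixed derivative, which governs the dependence on \<open>\<theta>\<close>, is itself small.
\<close>

lemma score_linear:
  assumes box: "\<And>t. \<bar>t - \<theta>0\<bar> < \<delta> \<Longrightarrow> t \<in> \<Theta>"
    and t: "\<bar>t - \<theta>0\<bar> < \<delta>" and \<theta>: "\<bar>\<theta> - \<theta>0\<bar> < \<delta>" and \<eta>: "\<eta> \<in> H" "norm (\<eta> - \<eta>0) < \<delta>"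
    and N: "norm (\<eta> - \<eta>0) \<le> K * (e + \<bar>\<theta> - \<theta>0\<bar>)"
  shows "\<bar>S 1 0 t \<theta> \<eta> - Z + I * (t - \<theta>0)\<bar> \<le> 10 * K ^ 3 * (e + \<bar>\<theta> - \<theta>0\<bar> + \<bar>t - \<theta>0\<bar>)\<^sup>2"
proof -
  have \<delta>: "0 < \<delta>" using t by linarith
  have inV: "(a, b, \<eta>) \<in> V" if "\<bar>a - \<theta>0\<bar> < \<delta>" "\<bar>b - \<theta>0\<bar> < \<delta>" for a b
    using that box \<eta> by (auto simp: nbhd3_def)
  have seg: "\<bar>y - \<theta>0\<bar> < \<delta>" if "y \<in> closed_segment x \<theta>0" "\<bar>x - \<theta>0\<bar> < \<delta>" for x y
    using that by (auto simp: closed_segment_eq_real_ivl split: if_splits)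
  define d where "d = \<bar>\<theta> - \<theta>0\<bar>"
  define \<tau> where "\<tau> = \<bar>t - \<theta>0\<bar>"
  define \<nu> where "\<nu> = norm (\<eta> - \<eta>0)"
  define m where "m = e + d + \<tau>"
  have nn: "0 \<le> d" "0 \<le> \<tau>" "0 \<le> \<nu>" "0 \<le> e" by (auto simp: d_def \<tau>_def \<nu>_def)
  have m: "d \<le> m" "\<tau> \<le> m" "e \<le> m" "0 \<le> m" using nn by (auto simp: m_def)
  have Km: "m \<le> K * m" using mult_right_mono[OF K1 m(4)] by simp
  have \<nu>m: "\<nu> \<le> K * m"
  proof -
    have "\<nu> \<le> K * (e + d)" using N by (simp add: \<nu>_def d_def)
    also have "\<dots> \<le> K * m" using nn K1 by (intro mult_left_mono) (auto simp: m_def)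
    finally show ?thesis .
  qed
  have 1: "\<bar>S 1 0 t \<theta> \<eta> - S 1 0 \<theta>0 \<theta> \<eta> - S 2 0 \<theta>0 \<theta> \<eta> * (t - \<theta>0)\<bar> \<le> K * \<tau>\<^sup>2"
  proof -
    have "\<bar>S 1 0 t \<theta> \<eta> - S 1 0 \<theta>0 \<theta> \<eta> - S 2 0 \<theta>0 \<theta> \<eta> * (t - \<theta>0)\<bar> \<le> K * (t - \<theta>0)\<^sup>2"
    proof (rule linear_approx_of_DERIV2[where f = "\<lambda>t. S 1 0 t \<theta> \<eta>" and ?f1.0 = "\<lambda>t. S 2 0 t \<theta> \<eta>"
          and ?f2.0 = "\<lambda>t. S 3 0 t \<theta> \<eta>"])
      fix y assume y: "y \<in> closed_segment t \<theta>0"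
      note V = inV[OF seg[OF y t] \<theta>]
      show "((\<lambda>t. S 1 0 t \<theta> \<eta>) has_real_derivative S 2 0 y \<theta> \<eta>) (at y)"
        using DERIV_S_t[OF V, of 1] by (simp add: numeral_2_eq_2)
      show "((\<lambda>t. S 2 0 t \<theta> \<eta>) has_real_derivative S 3 0 y \<theta> \<eta>) (at y)"
        using DERIV_S_t[OF V, of 2] by (simp add: numeral_3_eq_3 numeral_2_eq_2)
      show "\<bar>S 3 0 y \<theta> \<eta>\<bar> \<le> K" using remainders[OF V] by (simp add: S_def)
    qed
    then show ?thesis by (simp add: \<tau>_def)
  qed
  have 2: "\<bar>S 1 0 \<theta>0 \<theta> \<eta> - S 1 0 \<theta>0 \<theta>0 \<eta> - S 1 1 \<theta>0 \<theta>0 \<eta> * (\<theta> - \<theta>0)\<bar> \<le> K * d\<^sup>2"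
  proof -
    have "\<bar>S 1 0 \<theta>0 \<theta> \<eta> - S 1 0 \<theta>0 \<theta>0 \<eta> - S 1 1 \<theta>0 \<theta>0 \<eta> * (\<theta> - \<theta>0)\<bar> \<le> K * (\<theta> - \<theta>0)\<^sup>2"
    proof (rule linear_approx_of_DERIV2[where f = "\<lambda>\<theta>. S 1 0 \<theta>0 \<theta> \<eta>" and ?f1.0 = "\<lambda>\<theta>. S 1 1 \<theta>0 \<theta> \<eta>"
          and ?f2.0 = "\<lambda>\<theta>. S 1 2 \<theta>0 \<theta> \<eta>"])
      fix y assume y: "y \<in> closed_segment \<theta> \<theta>0"
      have V: "(\<theta>0, y, \<eta>) \<in> V" using inV[of \<theta>0 y] seg[OF y \<theta>] \<delta> by simp
      show "((\<lambda>\<theta>. S 1 0 \<theta>0 \<theta> \<eta>) has_real_derivative S 1 1 \<theta>0 y \<eta>) (at y)"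
        using DERIV_S_theta[OF V, of 1 0] by simp
      show "((\<lambda>\<theta>. S 1 1 \<theta>0 \<theta> \<eta>) has_real_derivative S 1 2 \<theta>0 y \<eta>) (at y)"
        using DERIV_S_theta[OF V, of 1 1] by (simp add: numeral_2_eq_2)
      show "\<bar>S 1 2 \<theta>0 y \<eta>\<bar> \<le> K" using remainders[OF V] by (simp add: S_def)
    qed
    then show ?thesis by (simp add: d_def)
  qed
  have 3: "\<bar>S 2 0 \<theta>0 \<theta> \<eta> - S 2 0 \<theta>0 \<theta>0 \<eta>\<bar> \<le> K * d"
    unfolding d_def
  proof (rule lipschitz_of_DERIV[where f' = "\<lambda>\<theta>. S 2 1 \<theta>0 \<theta> \<eta>"])
    fix y assume y: "y \<in> closed_segment \<theta> \<theta>0"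
    have V: "(\<theta>0, y, \<eta>) \<in> V" using inV[of \<theta>0 y] seg[OF y \<theta>] \<delta> by simp
    show "((\<lambda>\<theta>. S 2 0 \<theta>0 \<theta> \<eta>) has_real_derivative S 2 1 \<theta>0 y \<eta>) (at y)"
      using DERIV_S_theta[OF V, of 2 0] by simp
    show "\<bar>S 2 1 \<theta>0 y \<eta>\<bar> \<le> K" using remainders[OF V] by (simp add: S_def)
  qed
  have nu: "\<bar>S 1 0 \<theta>0 \<theta>0 \<eta> - Z\<bar> \<le> K * (e * \<nu> + \<nu>\<^sup>2)" "\<bar>S 1 1 \<theta>0 \<theta>0 \<eta>\<bar> \<le> K * (e + \<nu>)"
    "\<bar>S 2 0 \<theta>0 \<theta>0 \<eta> + I\<bar> \<le> K * (e + \<nu>)"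
    using nuisance[OF \<eta>] by (auto simp: S_def \<nu>_def)
  have e\<nu>: "e + \<nu> \<le> 2 * (K * m)" using m Km \<nu>m by linarith
  have K0: "0 \<le> K" using K1 by simp
  have "e * \<nu> + \<nu>\<^sup>2 \<le> (2 * (K * m)) * (K * m)"
  proof -
    have "e * \<nu> + \<nu>\<^sup>2 = (e + \<nu>) * \<nu>" by (simp add: power2_eq_square algebra_simps)
    also have "\<dots> \<le> (2 * (K * m)) * (K * m)" using e\<nu> \<nu>m nn m K0 by (intro mult_mono) auto
    finally show ?thesis .
  qed
  then have b1: "\<bar>S 1 0 \<theta>0 \<theta>0 \<eta> - Z\<bar> \<le> 2 * K ^ 3 * m\<^sup>2"
    using nu(1) mult_left_mono[of "e * \<nu> + \<nu>\<^sup>2" "(2 * (K * m)) * (K * m)" K] K0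
    by (simp add: power2_eq_square power3_eq_cube mult_ac)
  have b2: "\<bar>S 1 1 \<theta>0 \<theta>0 \<eta> * (\<theta> - \<theta>0)\<bar> \<le> 2 * K\<^sup>2 * m\<^sup>2"
  proof -
    have "\<bar>S 1 1 \<theta>0 \<theta>0 \<eta>\<bar> * d \<le> (K * (2 * (K * m))) * m"
      using nu(2) mult_left_mono[OF e\<nu> K0] m nn K0 by (intro mult_mono) auto
    then show ?thesis by (simp add: abs_mult d_def power2_eq_square mult_ac)
  qed
  have b3: "\<bar>(S 2 0 \<theta>0 \<theta> \<eta> + I) * (t - \<theta>0)\<bar> \<le> (2 * K\<^sup>2 + K) * m\<^sup>2"
  proof -
    have "\<bar>S 2 0 \<theta>0 \<theta> \<eta> + I\<bar> \<le> K * d + K * (e + \<nu>)" using 3 nu(3) by linarith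
    also have "\<dots> \<le> K * m + K * (2 * (K * m))" using m e\<nu> K0 by (intro add_mono mult_left_mono) auto
    finally have "\<bar>S 2 0 \<theta>0 \<theta> \<eta> + I\<bar> * \<tau> \<le> (K * m + K * (2 * (K * m))) * m"
      using m nn K0 by (intro mult_mono) auto
    also have "\<dots> = (2 * K\<^sup>2 + K) * m\<^sup>2" by (simp add: power2_eq_square algebra_simps)
    finally show ?thesis by (simp add: abs_mult \<tau>_def)
  qed
  have b4: "K * \<tau>\<^sup>2 \<le> K * m\<^sup>2" "K * d\<^sup>2 \<le> K * m\<^sup>2"
    using m nn K0 by (auto intro!: mult_left_mono power_mono)
  have "S 1 0 t \<theta> \<eta> - Z + I * (t - \<theta>0) =
      (S 1 0 t \<theta> \<eta> - S 1 0 \<theta>0 \<theta> \<eta> - S 2 0 \<theta>0 \<theta> \<eta> * (t - \<theta>0))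
    + (S 1 0 \<theta>0 \<theta> \<eta> - S 1 0 \<theta>0 \<theta>0 \<eta> - S 1 1 \<theta>0 \<theta>0 \<eta> * (\<theta> - \<theta>0))
    + (S 1 0 \<theta>0 \<theta>0 \<eta> - Z) + S 1 1 \<theta>0 \<theta>0 \<eta> * (\<theta> - \<theta>0)
    + (S 2 0 \<theta>0 \<theta> \<eta> + I) * (t - \<theta>0)" by (simp add: algebra_simps)
  then have "\<bar>S 1 0 t \<theta> \<eta> - Z + I * (t - \<theta>0)\<bar>
      \<le> K * m\<^sup>2 + K * m\<^sup>2 + 2 * K ^ 3 * m\<^sup>2 + 2 * K\<^sup>2 * m\<^sup>2 + (2 * K\<^sup>2 + K) * m\<^sup>2"
    using 1 2 b1 b2 b3 b4 by linarith
  also have "\<dots> = (2 * K ^ 3 + 4 * K\<^sup>2 + 3 * K) * m\<^sup>2" by (simp add: algebra_simps)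
  also have "\<dots> \<le> 10 * K ^ 3 * m\<^sup>2"
  proof (rule mult_right_mono)
    have "K ^ 1 \<le> K ^ 3" "K\<^sup>2 \<le> K ^ 3" using K1 by (intro power_increasing; simp)+
    moreover have "0 \<le> K ^ 3" using K0 by simp
    ultimately show "2 * K ^ 3 + 4 * K\<^sup>2 + 3 * K \<le> 10 * K ^ 3" by simp
  qed simp
  finally show ?thesis by (simp add: m_def d_def \<tau>_def)
qed

lemma lik_n_le_prof_lik:
  assumes "\<psi> \<in> \<Theta>" "\<eta> \<in> H"
  shows "lik_n lik n xs \<psi> \<eta> \<le> prof_lik H lik n xs \<psi>"
  unfolding prof_lik_attained[OF mle assms(1)] using mle assms unfolding is_mle_def by blast

lemma lik_n_submodel:
  assumes "(t, \<theta>, \<eta>) \<in> V" "n \<ge> 1"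
  shows "0 < lik_n lik n xs t (\<eta>sub t \<theta> \<eta>)"
    and "ln (lik_n lik n xs t (\<eta>sub t \<theta> \<eta>)) = n * S 0 0 t \<theta> \<eta>"
proof -
  have pos: "0 < lik t (\<eta>sub t \<theta> \<eta>) (xs i)" for i
    using smooth[of i] assms unfolding ell_smooth_def by blast
  then show "0 < lik_n lik n xs t (\<eta>sub t \<theta> \<eta>)" unfolding lik_n_def by (intro prod_pos) auto
  have "ln (lik_n lik n xs t (\<eta>sub t \<theta> \<eta>)) = (\<Sum>i<n. ln (lik t (\<eta>sub t \<theta> \<eta>) (xs i)))"
    unfolding lik_n_def
  proof (intro ln_prod)
    show "lik t (\<eta>sub t \<theta> \<eta>) (xs i) \<noteq> 0" for i using pos[of i] by simp
  qed simp
  also have "\<dots> = n * S 0 0 t \<theta> \<eta>"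
    using assms by (simp add: S_def emp_mean_def ell_deriv_def ell_def)
  finally show "ln (lik_n lik n xs t (\<eta>sub t \<theta> \<eta>)) = n * S 0 0 t \<theta> \<eta>" .
qed

text \<open>
  The submodels through \<open>(\<psi>, \<eta>h \<psi>)\<close> and \<open>(\<theta>h, \<eta>h \<theta>h)\<close> bound the log-likelihood ratio of \<open>\<psi>\<close> against \<open>\<theta>h\<close>
  from above and below; by the linearity of the score both bounds are \<open>- n I (\<psi> - \<theta>h)\<^sup>2 / 2\<close> up to
  a cubic error.  The score equation at the maximum likelihood estimator removes the linear term.
\<close>

lemma profile_expansion:
  assumes box: "\<And>t. \<bar>t - \<theta>0\<bar> < \<delta> \<Longrightarrow> t \<in> \<Theta>"
    and sub: "\<And>t \<theta> \<eta>. (t, \<theta>, \<eta>) \<in> V \<Longrightarrow> \<eta>sub t \<theta> \<eta> \<in> H"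
    and diag: "\<And>\<theta> \<eta>. \<theta> \<in> \<Theta> \<Longrightarrow> \<eta> \<in> H \<Longrightarrow> \<eta>sub \<theta> \<theta> \<eta> = \<eta>"
    and I: "0 < I" and n: "n \<ge> 1"
    and r: "0 < r" "r \<le> \<delta>" "K * r \<le> 1" "K * (e + r) < \<delta>" "16 * C1 * r \<le> I"
    and \<theta>h: "\<bar>\<theta>h - \<theta>0\<bar> < r"
  shows "\<bar>\<theta>h - \<theta>0\<bar> \<le> C3 * e"
    and "0 < prof_lik H lik n xs \<theta>h"
    and "\<bar>\<psi> - \<theta>0\<bar> < r \<Longrightarrow> 0 < prof_lik H lik n xs \<psi> \<and>
      \<bar>ln (prof_lik H lik n xs \<psi> / prof_lik H lik n xs \<theta>h) + n * I * (\<psi> - \<theta>h)\<^sup>2 / 2\<bar>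
        \<le> C3 * n * \<bar>\<psi> - \<theta>h\<bar> * (e + \<bar>\<psi> - \<theta>h\<bar>)\<^sup>2"
proof -
  have e: "0 < e" "e \<le> 1" using n by auto
  have C: "0 \<le> C1" "0 \<le> C2" "0 \<le> C3" "C2 \<le> C3"
    using expansion_consts[OF I K1] by auto
  let ?pl = "prof_lik H lik n xs"
  have in_\<Theta>: "\<psi> \<in> \<Theta>" if "\<bar>\<psi> - \<theta>0\<bar> < r" for \<psi> using that r box by simp
  have \<eta>h: "\<eta>h \<psi> \<in> H" "norm (\<eta>h \<psi> - \<eta>0) \<le> K * (e + \<bar>\<psi> - \<theta>0\<bar>)" "norm (\<eta>h \<psi> - \<eta>0) < \<delta>"
    if "\<bar>\<psi> - \<theta>0\<bar> < r" for \<psi>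
  proof -
    show "\<eta>h \<psi> \<in> H" using mle in_\<Theta>[OF that] unfolding is_mle_def by blast
    have "K * \<bar>\<psi> - \<theta>0\<bar> < K * r" using that K1 by (intro mult_strict_left_mono) auto
    then show *: "norm (\<eta>h \<psi> - \<eta>0) \<le> K * (e + \<bar>\<psi> - \<theta>0\<bar>)"
      using rate[OF in_\<Theta>[OF that]] r by simp
    have "K * (e + \<bar>\<psi> - \<theta>0\<bar>) \<le> K * (e + r)" using that K1 by (intro mult_left_mono) auto
    with * r show "norm (\<eta>h \<psi> - \<eta>0) < \<delta>" by linarith
  qed
  have inV: "(t, \<psi>, \<eta>h \<psi>) \<in> V" if "\<bar>t - \<theta>0\<bar> < \<delta>" "\<bar>\<psi> - \<theta>0\<bar> < r" for t \<psi>
    using that \<eta>h[OF that(2)] box r by (auto simp: nbhd3_def)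
  have lin: "\<bar>S 1 0 t \<psi> (\<eta>h \<psi>) - Z + I * (t - \<theta>0)\<bar> \<le> C1 * (e + \<bar>\<psi> - \<theta>0\<bar> + \<bar>t - \<theta>0\<bar>)\<^sup>2"
    if "\<bar>t - \<theta>0\<bar> < r" "\<bar>\<psi> - \<theta>0\<bar> < r" for t \<psi>
    unfolding score_const_def by (rule score_linear) (use that \<eta>h[OF that(2)] r box in auto)
  have pl_eq: "?pl \<psi> = lik_n lik n xs \<psi> (\<eta>sub \<psi> \<psi> (\<eta>h \<psi>))" if "\<bar>\<psi> - \<theta>0\<bar> < r" for \<psi>
    using prof_lik_attained[OF mle] diag in_\<Theta> \<eta>h(1) that by simp
  have pl: "0 < ?pl \<psi>" "ln (?pl \<psi>) = n * S 0 0 \<psi> \<psi> (\<eta>h \<psi>)" if "\<bar>\<psi> - \<theta>0\<bar> < r" for \<psi>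
    unfolding pl_eq[OF that] using lik_n_submodel[OF inV[of \<psi> \<psi>] n] that r by auto
  have pl_ge: "n * S 0 0 t \<psi> (\<eta>h \<psi>) \<le> ln (?pl t)" if "\<bar>t - \<theta>0\<bar> < \<delta>" "\<bar>\<psi> - \<theta>0\<bar> < r" for t \<psi>
  proof -
    note V = inV[OF that]
    have "lik_n lik n xs t (\<eta>sub t \<psi> (\<eta>h \<psi>)) \<le> ?pl t"
      using sub[OF V] box that by (intro lik_n_le_prof_lik) auto
    then show ?thesis using lik_n_submodel[OF V n] by (metis ln_mono)
  qed
  have score_eq: "S 1 0 \<theta>h \<theta>h (\<eta>h \<theta>h) = 0"
  proof (rule DERIV_local_max)
    show "((\<lambda>t. S 0 0 t \<theta>h (\<eta>h \<theta>h)) has_real_derivative S 1 0 \<theta>h \<theta>h (\<eta>h \<theta>h)) (at \<theta>h)"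
      using DERIV_S_t[OF inV[of \<theta>h \<theta>h], of 0] \<theta>h r by simp
    show "0 < \<delta> - \<bar>\<theta>h - \<theta>0\<bar>" using \<theta>h r by simp
    show "\<forall>y. \<bar>\<theta>h - y\<bar> < \<delta> - \<bar>\<theta>h - \<theta>0\<bar> \<longrightarrow> S 0 0 y \<theta>h (\<eta>h \<theta>h) \<le> S 0 0 \<theta>h \<theta>h (\<eta>h \<theta>h)"
    proof (intro allI impI)
      fix y assume "\<bar>\<theta>h - y\<bar> < \<delta> - \<bar>\<theta>h - \<theta>0\<bar>"
      then have y: "\<bar>y - \<theta>0\<bar> < \<delta>" by linarith
      have pos: "0 < ?pl y"
        using lik_n_submodel(1)[OF inV[OF y \<theta>h] n] lik_n_le_prof_lik[OF box[OF y] sub[OF inV[OF y \<theta>h]]]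
        by linarith
      have "n * S 0 0 y \<theta>h (\<eta>h \<theta>h) \<le> ln (?pl y)" by (rule pl_ge[OF y \<theta>h])
      also have "\<dots> \<le> ln (?pl \<theta>h)" using prof_lik_le_mle[OF mle box[OF y]] pos by (metis ln_mono)
      also have "\<dots> = n * S 0 0 \<theta>h \<theta>h (\<eta>h \<theta>h)" by (rule pl(2)[OF \<theta>h])
      finally show "S 0 0 y \<theta>h (\<eta>h \<theta>h) \<le> S 0 0 \<theta>h \<theta>h (\<eta>h \<theta>h)" using n by simp
    qed
  qed
  define d where "d = \<bar>\<theta>h - \<theta>0\<bar>"
  have lin_hat: "\<bar>Z - I * (\<theta>h - \<theta>0)\<bar> \<le> C1 * (e + 2 * d)\<^sup>2"
    using lin[OF \<theta>h \<theta>h] unfolding score_eq d_def by (simp add: abs_minus_commute add.assoc)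
  \<comment> \<open>The score equation bounds \<open>I d\<close> by \<open>O e + C1 (e + 2 d)\<^sup>2\<close>; as \<open>d < r\<close>, the quadratic term in \<open>d\<close> is at most \<open>I d / 2\<close>.\<close>
  have d_le: "d \<le> C2 * e"
  proof -
    have "(e + 2 * d)\<^sup>2 \<le> 2 * e\<^sup>2 + 8 * d\<^sup>2"
      using zero_le_power2[of "e - 2 * d"] by (simp add: power2_eq_square algebra_simps)
    then have "C1 * (e + 2 * d)\<^sup>2 \<le> C1 * (2 * e\<^sup>2 + 8 * d\<^sup>2)" using C by (intro mult_left_mono) auto
    also have "\<dots> \<le> 2 * C1 * e + I / 2 * d"
    proof -
      have "e\<^sup>2 \<le> e" unfolding power2_eq_square by (rule mult_left_le) (use e in auto)
      then have "(2 * C1) * e\<^sup>2 \<le> (2 * C1) * e" using C by (intro mult_left_mono) auto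
      moreover have "8 * C1 * d\<^sup>2 \<le> I / 2 * d"
      proof -
        have "8 * C1 * d \<le> 8 * C1 * r" using C \<theta>h by (intro mult_left_mono) (auto simp: d_def)
        also have "\<dots> \<le> I / 2" using r by simp
        finally have "(8 * C1 * d) * d \<le> I / 2 * d" by (rule mult_right_mono) (simp add: d_def)
        then show ?thesis by (simp add: power2_eq_square)
      qed
      ultimately show ?thesis by (simp add: algebra_simps)
    qed
    finally have "\<bar>Z - I * (\<theta>h - \<theta>0)\<bar> \<le> 2 * C1 * e + I / 2 * d" using lin_hat by linarith
    moreover have "\<bar>Z\<bar> \<le> K * e" using score0 by (simp add: S_def)
    moreover have "\<bar>I * (\<theta>h - \<theta>0)\<bar> = I * d" using I by (simp add: abs_mult d_def)
    ultimately have "I * d \<le> K * e + (2 * C1 * e + I / 2 * d)" by linarith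
    then have "I / 2 * d \<le> (K + 2 * C1) * e" unfolding distrib_right by linarith
    then have "2 / I * (I / 2 * d) \<le> 2 / I * ((K + 2 * C1) * e)"
      by (rule mult_left_mono) (use I in simp)
    moreover have "2 / I * (I / 2 * d) = d" using I by simp
    moreover have "2 / I * ((K + 2 * C1) * e) = C2 * e" by (simp add: mle_const_def)
    ultimately show ?thesis by linarith
  qed
  also have "\<dots> \<le> C3 * e" using C e by (intro mult_right_mono) auto
  finally show "\<bar>\<theta>h - \<theta>0\<bar> \<le> C3 * e" by (simp add: d_def)
  show "0 < ?pl \<theta>h" by (rule pl(1)[OF \<theta>h])
  assume \<psi>: "\<bar>\<psi> - \<theta>0\<bar> < r"
  define h where "h = \<psi> - \<theta>h"
  define c where "c = 2 * C1 * (2 + 2 * C2)\<^sup>2"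
  have *: "\<bar>S 0 0 \<psi> b (\<eta>h b) - S 0 0 \<theta>h b (\<eta>h b) + I * h\<^sup>2 / 2\<bar> \<le> c * (e + \<bar>h\<bar>)\<^sup>2 * \<bar>h\<bar>"
    if b: "b = \<psi> \<or> b = \<theta>h" for b
  proof -
    have br: "\<bar>b - \<theta>0\<bar> < r" using b \<psi> \<theta>h by auto
    let ?g = "\<lambda>t. S 0 0 t b (\<eta>h b) + I * (t - \<theta>h)\<^sup>2 / 2"
    have "\<bar>?g \<psi> - ?g \<theta>h\<bar> \<le> (c * (e + \<bar>h\<bar>)\<^sup>2) * \<bar>\<psi> - \<theta>h\<bar>"
    proof (rule lipschitz_of_DERIV[where f' = "\<lambda>t. S 1 0 t b (\<eta>h b) + I * (t - \<theta>h)"])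
      fix t assume t: "t \<in> closed_segment \<psi> \<theta>h"
      have tr: "\<bar>t - \<theta>0\<bar> < r" "\<bar>t - \<theta>h\<bar> \<le> \<bar>h\<bar>"
        using t \<psi> \<theta>h by (auto simp: closed_segment_eq_real_ivl h_def split: if_splits)
      have "((\<lambda>t. S 0 0 t b (\<eta>h b)) has_real_derivative S 1 0 t b (\<eta>h b)) (at t)"
        using DERIV_S_t[OF inV[of t b], of 0] tr br r by simp
      then show "(?g has_real_derivative S 1 0 t b (\<eta>h b) + I * (t - \<theta>h)) (at t)"
        by (auto intro!: derivative_eq_intros)
      have "\<bar>b - \<theta>0\<bar> \<le> \<bar>h\<bar> + d" "\<bar>t - \<theta>0\<bar> \<le> \<bar>h\<bar> + d"
        using b tr by (auto simp: h_def d_def)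
      then have "e + \<bar>b - \<theta>0\<bar> + \<bar>t - \<theta>0\<bar> \<le> e + 2 * \<bar>h\<bar> + 2 * (C2 * e)" using d_le by linarith
      also have "\<dots> \<le> (2 + 2 * C2) * (e + \<bar>h\<bar>)"
      proof -
        have "0 \<le> C2 * \<bar>h\<bar>" using C by simp
        moreover have "(2 + 2 * C2) * (e + \<bar>h\<bar>) = 2 * e + 2 * \<bar>h\<bar> + 2 * (C2 * e) + 2 * (C2 * \<bar>h\<bar>)"
          by (simp add: distrib_left distrib_right add_divide_distrib)
        ultimately show ?thesis using e by linarith
      qed
      finally have m: "(e + \<bar>b - \<theta>0\<bar> + \<bar>t - \<theta>0\<bar>)\<^sup>2 \<le> ((2 + 2 * C2) * (e + \<bar>h\<bar>))\<^sup>2"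
        using e by (intro power_mono) auto
      have "e + 2 * d \<le> (2 + 2 * C2) * (e + \<bar>h\<bar>)"
      proof -
        have "0 \<le> C2 * \<bar>h\<bar>" using C by simp
        moreover have "(2 + 2 * C2) * (e + \<bar>h\<bar>) = 2 * e + 2 * \<bar>h\<bar> + 2 * (C2 * e) + 2 * (C2 * \<bar>h\<bar>)"
          by (simp add: distrib_left distrib_right add_divide_distrib)
        ultimately show ?thesis using e d_le by linarith
      qed
      then have m': "(e + 2 * d)\<^sup>2 \<le> ((2 + 2 * C2) * (e + \<bar>h\<bar>))\<^sup>2"
        using e by (intro power_mono) (auto simp: d_def)
      have "S 1 0 t b (\<eta>h b) + I * (t - \<theta>h) =
          (S 1 0 t b (\<eta>h b) - Z + I * (t - \<theta>0)) + (Z - I * (\<theta>h - \<theta>0))" by (simp add: algebra_simps)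
      then have "\<bar>S 1 0 t b (\<eta>h b) + I * (t - \<theta>h)\<bar>
          \<le> C1 * (e + \<bar>b - \<theta>0\<bar> + \<bar>t - \<theta>0\<bar>)\<^sup>2 + C1 * (e + 2 * d)\<^sup>2"
        using lin[OF tr(1) br] lin_hat by linarith
      also have "\<dots> \<le> C1 * ((2 + 2 * C2) * (e + \<bar>h\<bar>))\<^sup>2 + C1 * ((2 + 2 * C2) * (e + \<bar>h\<bar>))\<^sup>2"
        using m m' C by (intro add_mono mult_left_mono) auto
      also have "\<dots> = c * (e + \<bar>h\<bar>)\<^sup>2" by (simp add: c_def power_mult_distrib)
      finally show "\<bar>S 1 0 t b (\<eta>h b) + I * (t - \<theta>h)\<bar> \<le> c * (e + \<bar>h\<bar>)\<^sup>2" .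
    qed
    then show ?thesis by (simp add: h_def algebra_simps)
  qed
  have lnq: "ln (?pl \<psi> / ?pl \<theta>h) = ln (?pl \<psi>) - ln (?pl \<theta>h)"
    using pl(1)[OF \<psi>] pl(1)[OF \<theta>h] by (simp add: ln_div)
  have up: "ln (?pl \<psi>) - ln (?pl \<theta>h) \<le> n * (S 0 0 \<psi> \<psi> (\<eta>h \<psi>) - S 0 0 \<theta>h \<psi> (\<eta>h \<psi>))"
    using pl(2)[OF \<psi>] pl_ge[of \<theta>h \<psi>] \<theta>h \<psi> r by (simp add: algebra_simps)
  have lo: "n * (S 0 0 \<psi> \<theta>h (\<eta>h \<theta>h) - S 0 0 \<theta>h \<theta>h (\<eta>h \<theta>h)) \<le> ln (?pl \<psi>) - ln (?pl \<theta>h)"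
    using pl(2)[OF \<theta>h] pl_ge[of \<psi> \<theta>h] \<theta>h \<psi> r by (simp add: algebra_simps)
  let ?b = "c * (e + \<bar>h\<bar>)\<^sup>2 * \<bar>h\<bar>"
  have "n * (S 0 0 \<psi> \<psi> (\<eta>h \<psi>) - S 0 0 \<theta>h \<psi> (\<eta>h \<psi>)) \<le> n * (?b - I * h\<^sup>2 / 2)"
    using *[of \<psi>] by (intro mult_left_mono) auto
  moreover have "n * (- ?b - I * h\<^sup>2 / 2) \<le> n * (S 0 0 \<psi> \<theta>h (\<eta>h \<theta>h) - S 0 0 \<theta>h \<theta>h (\<eta>h \<theta>h))"
    using *[of \<theta>h] by (intro mult_left_mono) auto
  ultimately have "\<bar>ln (?pl \<psi> / ?pl \<theta>h) + n * I * h\<^sup>2 / 2\<bar> \<le> n * ?b"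
    using up lo unfolding lnq by (simp add: algebra_simps abs_le_iff)
  also have "\<dots> = c * (n * \<bar>h\<bar> * (e + \<bar>h\<bar>)\<^sup>2)" by simp
  also have "\<dots> \<le> C3 * (n * \<bar>h\<bar> * (e + \<bar>h\<bar>)\<^sup>2)"
    using C e by (intro mult_right_mono) (auto simp: c_def expansion_const_def)
  finally show "0 < ?pl \<psi> \<and> \<bar>ln (?pl \<psi> / ?pl \<theta>h) + n * I * (\<psi> - \<theta>h)\<^sup>2 / 2\<bar>
      \<le> C3 * n * \<bar>\<psi> - \<theta>h\<bar> * (e + \<bar>\<psi> - \<theta>h\<bar>)\<^sup>2"
    using pl(1)[OF \<psi>] by (simp add: h_def mult.assoc)
qed

end

section \<open>Envelopes, efficient scores and priors\<close>

lemma nbhd3_mono: "\<delta> \<le> \<delta>' \<Longrightarrow> nbhd3 \<Theta> H \<theta>0 \<eta>0 \<delta> \<subseteq> nbhd3 \<Theta> H \<theta>0 \<eta>0 \<delta>'"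
  unfolding nbhd3_def by auto

lemma smooth_envelopesD:
  assumes "smooth_envelopes P lik \<eta>sub V"
    and "(l, m) \<in> {(0, 0), (1, 0), (2, 0), (3, 0), (1, 1), (1, 2), (2, 1)}"
  shows "(t, \<theta>, \<eta>) \<in> V \<Longrightarrow> ell_deriv lik \<eta>sub l m t \<theta> \<eta> \<in> borel_measurable P"
    and "\<exists>F. integrable P F \<and> (AE x in P. \<forall>(t, \<theta>, \<eta>)\<in>V. \<bar>ell_deriv lik \<eta>sub l m t \<theta> \<eta> x\<bar> \<le> F x)"
proof -
  have "\<forall>(l, m)\<in>{(0, 0), (1, 0), (2, 0), (3, 0), (1, 1), (1, 2), (2, 1)}.
      (\<forall>(t, \<theta>, \<eta>)\<in>V. ell_deriv lik \<eta>sub l m t \<theta> \<eta> \<in> borel_measurable P) \<and>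
      (\<exists>F. integrable P F \<and> (AE x in P. \<forall>(t, \<theta>, \<eta>)\<in>V. \<bar>ell_deriv lik \<eta>sub l m t \<theta> \<eta> x\<bar> \<le> F x))"
    using assms(1) unfolding smooth_envelopes_def by (rule conjunct2)
  from case_prodD[OF bspec[OF this assms(2)]]
  have *: "(\<forall>(t, \<theta>, \<eta>)\<in>V. ell_deriv lik \<eta>sub l m t \<theta> \<eta> \<in> borel_measurable P) \<and>
    (\<exists>F. integrable P F \<and> (AE x in P. \<forall>(t, \<theta>, \<eta>)\<in>V. \<bar>ell_deriv lik \<eta>sub l m t \<theta> \<eta> x\<bar> \<le> F x))"
    .
  show "\<exists>F. integrable P F \<and> (AE x in P. \<forall>(t, \<theta>, \<eta>)\<in>V. \<bar>ell_deriv lik \<eta>sub l m t \<theta> \<eta> x\<bar> \<le> F x)"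
    by (rule conjunct2[OF *])
  show "ell_deriv lik \<eta>sub l m t \<theta> \<eta> \<in> borel_measurable P" if "(t, \<theta>, \<eta>) \<in> V"
    using bspec[OF conjunct1[OF *] that] by simp
qed

lemma smooth_envelopes_integrable:
  assumes env: "smooth_envelopes P lik \<eta>sub V"
    and lm: "(l, m) \<in> {(0, 0), (1, 0), (2, 0), (3, 0), (1, 1), (1, 2), (2, 1)}"
    and V: "(t, \<theta>, \<eta>) \<in> V"
  shows "integrable P (ell_deriv lik \<eta>sub l m t \<theta> \<eta>)"
proof -
  obtain F where F: "integrable P F"
    "AE x in P. \<forall>(t, \<theta>, \<eta>)\<in>V. \<bar>ell_deriv lik \<eta>sub l m t \<theta> \<eta> x\<bar> \<le> F x"
    using smooth_envelopesD(2)[OF env lm] by blast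
  show ?thesis
  proof (rule Bochner_Integration.integrable_bound[OF F(1)])
    show "AE x in P. norm (ell_deriv lik \<eta>sub l m t \<theta> \<eta> x) \<le> norm (F x)"
      using F(2)
    proof eventually_elim
      case (elim x)
      from bspec[OF elim V] show ?case by simp
    qed
  qed (rule smooth_envelopesD(1)[OF env lm V])
qed

lemma ell_smooth_mono: "ell_smooth lik \<eta>sub V' x \<Longrightarrow> V \<subseteq> V' \<Longrightarrow> ell_smooth lik \<eta>sub V x"
  unfolding ell_smooth_def by (rule ballI, erule bspec, erule (1) subsetD)

lemma smooth_envelopes_mono:
  assumes env: "smooth_envelopes P lik \<eta>sub V'" and V: "V \<subseteq> V'"
  shows "smooth_envelopes P lik \<eta>sub V"
proof -
  have "AE x in P. ell_smooth lik \<eta>sub V' x" using env unfolding smooth_envelopes_def by (rule conjunct1)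
  then have "AE x in P. ell_smooth lik \<eta>sub V x" by eventually_elim (rule ell_smooth_mono[OF _ V])
  moreover have env': "(\<forall>(t, \<theta>, \<eta>)\<in>V. ell_deriv lik \<eta>sub l m t \<theta> \<eta> \<in> borel_measurable P) \<and>
      (\<exists>F. integrable P F \<and> (AE x in P. \<forall>(t, \<theta>, \<eta>)\<in>V. \<bar>ell_deriv lik \<eta>sub l m t \<theta> \<eta> x\<bar> \<le> F x))"
    if lm: "(l, m) \<in> {(0, 0), (1, 0), (2, 0), (3, 0), (1, 1), (1, 2), (2, 1)}" for l m
  proof
    show "\<forall>(t, \<theta>, \<eta>)\<in>V. ell_deriv lik \<eta>sub l m t \<theta> \<eta> \<in> borel_measurable P"
      using smooth_envelopesD(1)[OF env lm] subsetD[OF V] by (intro ballI case_prodI2) blast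
    obtain F where F: "integrable P F"
      "AE x in P. \<forall>(t, \<theta>, \<eta>)\<in>V'. \<bar>ell_deriv lik \<eta>sub l m t \<theta> \<eta> x\<bar> \<le> F x"
      using smooth_envelopesD(2)[OF env lm] by blast
    have "AE x in P. \<forall>(t, \<theta>, \<eta>)\<in>V. \<bar>ell_deriv lik \<eta>sub l m t \<theta> \<eta> x\<bar> \<le> F x"
      using F(2) by eventually_elim (rule ballI, erule bspec, rule subsetD[OF V])
    with F(1) show "\<exists>F. integrable P F \<and> (AE x in P. \<forall>(t, \<theta>, \<eta>)\<in>V. \<bar>ell_deriv lik \<eta>sub l m t \<theta> \<eta> x\<bar> \<le> F x)"
      by blast
  qed
  ultimately show ?thesis
    unfolding smooth_envelopes_def
  proof (intro conjI ballI)
    fix p :: "nat \<times> nat"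
    assume p: "p \<in> {(0, 0), (1, 0), (2, 0), (3, 0), (1, 1), (1, 2), (2, 1)}"
    obtain l m where lm: "p = (l, m)" by (rule prod.exhaust)
    show "case p of (l, m) \<Rightarrow> (\<forall>(t, \<theta>, \<eta>)\<in>V. ell_deriv lik \<eta>sub l m t \<theta> \<eta> \<in> borel_measurable P) \<and>
      (\<exists>F. integrable P F \<and> (AE x in P. \<forall>(t, \<theta>, \<eta>)\<in>V. \<bar>ell_deriv lik \<eta>sub l m t \<theta> \<eta> x\<bar> \<le> F x))"
      unfolding lm prod.case by (rule env'[OF p[unfolded lm]])
  qed
qed

text \<open>Differentiation under the integral sign, justified by the envelope of the next derivative.\<close>

lemma mixed_derivative_mean:
  assumes env: "smooth_envelopes P lik \<eta>sub (nbhd3 \<Theta> H \<theta>0 \<eta>0 \<delta>)"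
    and \<delta>: "0 < \<delta>" and box: "\<And>t. \<bar>t - \<theta>0\<bar> < \<delta> \<Longrightarrow> t \<in> \<Theta>" and \<eta>0: "\<eta>0 \<in> H"
    and der: "((\<lambda>\<theta>. \<integral>x. ell_deriv lik \<eta>sub 1 0 \<theta>0 \<theta> \<eta>0 x \<partial>P) has_real_derivative D) (at \<theta>0)"
  shows "(\<integral>x. ell_deriv lik \<eta>sub 1 1 \<theta>0 \<theta>0 \<eta>0 x \<partial>P) = D"
proof -
  let ?V = "nbhd3 \<Theta> H \<theta>0 \<eta>0 \<delta>"
  have inV: "(\<theta>0, \<theta>, \<eta>0) \<in> ?V" if "\<bar>\<theta> - \<theta>0\<bar> < \<delta>" for \<theta>
    using that box \<delta> \<eta>0 by (auto simp: nbhd3_def)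
  obtain F where F: "integrable P F"
    "AE x in P. \<forall>(t, \<theta>, \<eta>)\<in>?V. \<bar>ell_deriv lik \<eta>sub 1 2 t \<theta> \<eta> x\<bar> \<le> F x"
  proof -
    have "(1, 2) \<in> {(0, 0), (1, 0), (2, 0), (3, 0), (1, 1), (1, 2), (2::nat, 1::nat)}" by simp
    from smooth_envelopesD(2)[OF env this] that show ?thesis by blast
  qed
  have int10: "integrable P (ell_deriv lik \<eta>sub 1 0 \<theta>0 \<theta> \<eta>0)" if "\<bar>\<theta> - \<theta>0\<bar> < \<delta>" for \<theta>
    by (rule smooth_envelopes_integrable[OF env _ inV[OF that]]) simp
  have int11: "integrable P (ell_deriv lik \<eta>sub 1 1 \<theta>0 \<theta>0 \<eta>0)"
    by (rule smooth_envelopes_integrable[OF env]) (use inV[of \<theta>0] \<delta> in simp_all)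
  have sm: "AE x in P. ell_smooth lik \<eta>sub ?V x" using env unfolding smooth_envelopes_def by blast
  define f where "f \<theta> = (\<integral>x. ell_deriv lik \<eta>sub 1 0 \<theta>0 \<theta> \<eta>0 x \<partial>P)" for \<theta>
  define a where "a = (\<integral>x. ell_deriv lik \<eta>sub 1 1 \<theta>0 \<theta>0 \<eta>0 x \<partial>P)"
  define B where "B = (\<integral>x. F x \<partial>P)"
  have quad: "\<bar>f \<theta> - f \<theta>0 - a * (\<theta> - \<theta>0)\<bar> \<le> B * (\<theta> - \<theta>0)\<^sup>2" if \<theta>: "\<bar>\<theta> - \<theta>0\<bar> < \<delta>" for \<theta>
  proof -
    let ?g = "\<lambda>x. ell_deriv lik \<eta>sub 1 0 \<theta>0 \<theta> \<eta>0 x - ell_deriv lik \<eta>sub 1 0 \<theta>0 \<theta>0 \<eta>0 x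
        - ell_deriv lik \<eta>sub 1 1 \<theta>0 \<theta>0 \<eta>0 x * (\<theta> - \<theta>0)"
    have i0: "integrable P (ell_deriv lik \<eta>sub 1 0 \<theta>0 \<theta>0 \<eta>0)" using int10[of \<theta>0] \<delta> by simp
    note ints = int10[OF \<theta>] i0 int11
    have diff: "integrable P (\<lambda>x. u x - v x - w x * c) \<and>
        (\<integral>x. u x - v x - w x * c \<partial>P) = (\<integral>x. u x \<partial>P) - (\<integral>x. v x \<partial>P) - (\<integral>x. w x \<partial>P) * c"
      if "integrable P u" "integrable P v" "integrable P w" for u v w :: "_ \<Rightarrow> real" and c
      using that by simp
    have int: "integrable P ?g" by (rule conjunct1[OF diff[OF ints]])
    have eq: "f \<theta> - f \<theta>0 - a * (\<theta> - \<theta>0) = (\<integral>x. ?g x \<partial>P)"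
      unfolding f_def a_def by (rule conjunct2[OF diff[OF ints], symmetric])
    have "\<bar>f \<theta> - f \<theta>0 - a * (\<theta> - \<theta>0)\<bar> \<le> (\<integral>x. \<bar>?g x\<bar> \<partial>P)"
      unfolding eq by (rule integral_abs_bound)
    also have "\<dots> \<le> (\<integral>x. F x * (\<theta> - \<theta>0)\<^sup>2 \<partial>P)"
    proof (rule integral_mono_AE)
      show "AE x in P. \<bar>?g x\<bar> \<le> F x * (\<theta> - \<theta>0)\<^sup>2"
      proof (rule eventually_elim2[OF sm F(2)])
        fix x
        assume elim: "ell_smooth lik \<eta>sub ?V x"
          "\<forall>(t, \<theta>, \<eta>)\<in>?V. \<bar>ell_deriv lik \<eta>sub 1 2 t \<theta> \<eta> x\<bar> \<le> F x"
        show "\<bar>?g x\<bar> \<le> F x * (\<theta> - \<theta>0)\<^sup>2"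
        proof (rule linear_approx_of_DERIV2[where f = "\<lambda>\<theta>. ell_deriv lik \<eta>sub 1 0 \<theta>0 \<theta> \<eta>0 x"
              and ?f1.0 = "\<lambda>\<theta>. ell_deriv lik \<eta>sub 1 1 \<theta>0 \<theta> \<eta>0 x"
              and ?f2.0 = "\<lambda>\<theta>. ell_deriv lik \<eta>sub 1 2 \<theta>0 \<theta> \<eta>0 x"])
          fix y assume "y \<in> closed_segment \<theta> \<theta>0"
          then have "\<bar>y - \<theta>0\<bar> < \<delta>" using \<theta> by (auto simp: closed_segment_eq_real_ivl split: if_splits)
          note V = inV[OF this]
          have "(\<lambda>\<theta>. ell_deriv lik \<eta>sub 1 0 \<theta>0 \<theta> \<eta>0 x) field_differentiable (at y)"
            "(\<lambda>\<theta>. ell_deriv lik \<eta>sub 1 1 \<theta>0 \<theta> \<eta>0 x) field_differentiable (at y)"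
            using elim(1) V unfolding ell_smooth_def by blast+
          then show "((\<lambda>\<theta>. ell_deriv lik \<eta>sub 1 0 \<theta>0 \<theta> \<eta>0 x) has_real_derivative
                ell_deriv lik \<eta>sub 1 1 \<theta>0 y \<eta>0 x) (at y)"
            "((\<lambda>\<theta>. ell_deriv lik \<eta>sub 1 1 \<theta>0 \<theta> \<eta>0 x) has_real_derivative
                ell_deriv lik \<eta>sub 1 2 \<theta>0 y \<eta>0 x) (at y)"
            by (simp_all add: DERIV_deriv_iff_field_differentiable[symmetric] ell_deriv_def numeral_2_eq_2)
          show "\<bar>ell_deriv lik \<eta>sub 1 2 \<theta>0 y \<eta>0 x\<bar> \<le> F x" using bspec[OF elim(2) V] by simp
        qed
      qed
    qed (use int F(1) in auto)
    also have "\<dots> = B * (\<theta> - \<theta>0)\<^sup>2" by (simp add: B_def)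
    finally show ?thesis .
  qed
  have "((\<lambda>\<theta>. (f \<theta> - f \<theta>0) / (\<theta> - \<theta>0)) \<longlongrightarrow> a) (at \<theta>0)"
  proof (rule LIM_zero_cancel)
    show "((\<lambda>\<theta>. (f \<theta> - f \<theta>0) / (\<theta> - \<theta>0) - a) \<longlongrightarrow> 0) (at \<theta>0)"
    proof (rule Lim_null_comparison[where g = "\<lambda>\<theta>. B * \<bar>\<theta> - \<theta>0\<bar>"])
      show "\<forall>\<^sub>F \<theta> in at \<theta>0. norm ((f \<theta> - f \<theta>0) / (\<theta> - \<theta>0) - a) \<le> B * \<bar>\<theta> - \<theta>0\<bar>"
        unfolding eventually_at
      proof (intro exI[of _ \<delta>] conjI ballI impI \<delta>)
        fix \<theta> assume \<theta>: "\<theta> \<noteq> \<theta>0 \<and> dist \<theta> \<theta>0 < \<delta>"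
        then have "(f \<theta> - f \<theta>0) / (\<theta> - \<theta>0) - a = (f \<theta> - f \<theta>0 - a * (\<theta> - \<theta>0)) / (\<theta> - \<theta>0)"
          by (simp add: diff_divide_distrib)
        also have "norm \<dots> \<le> (B * (\<theta> - \<theta>0)\<^sup>2) / \<bar>\<theta> - \<theta>0\<bar>"
          using quad[of \<theta>] \<theta> by (auto simp: dist_real_def intro!: divide_right_mono)
        also have "\<dots> = B * \<bar>\<theta> - \<theta>0\<bar>"
        proof -
          have "(\<theta> - \<theta>0)\<^sup>2 = \<bar>\<theta> - \<theta>0\<bar> * \<bar>\<theta> - \<theta>0\<bar>" by (simp add: power2_eq_square)
          moreover have "B * (w * w) / w = B * w" if "w \<noteq> 0" for w :: real using that by simp
          ultimately show ?thesis using \<theta> by (metis abs_0_eq right_minus_eq)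
        qed
        finally show "norm ((f \<theta> - f \<theta>0) / (\<theta> - \<theta>0) - a) \<le> B * \<bar>\<theta> - \<theta>0\<bar>" .
      qed
      show "((\<lambda>\<theta>. B * \<bar>\<theta> - \<theta>0\<bar>) \<longlongrightarrow> 0) (at \<theta>0)"
        by (rule tendsto_eq_intros | simp)+
    qed
  qed
  then have "(f has_real_derivative a) (at \<theta>0)" by (simp add: has_field_derivative_iff)
  moreover have "(f has_real_derivative D) (at \<theta>0)" using der by (simp add: f_def[abs_def])
  ultimately show ?thesis using DERIV_unique by (simp add: a_def)
qed

lemma prior_locally_lipschitz:
  fixes \<rho> :: "real \<Rightarrow> real"
  assumes "\<exists>\<delta>>0. (\<forall>\<theta>\<in>ball \<theta>0 \<delta>. \<rho> field_differentiable (at \<theta>)) \<and> continuous_on (ball \<theta>0 \<delta>) (deriv \<rho>)"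
  obtains \<delta> L where "0 < \<delta>" "0 \<le> L" "\<And>\<theta>. \<bar>\<theta> - \<theta>0\<bar> < \<delta> \<Longrightarrow> \<bar>\<rho> \<theta> - \<rho> \<theta>0\<bar> \<le> L * \<bar>\<theta> - \<theta>0\<bar>"
proof -
  obtain \<delta> where \<delta>: "0 < \<delta>" "\<And>\<theta>. \<theta> \<in> ball \<theta>0 \<delta> \<Longrightarrow> \<rho> field_differentiable (at \<theta>)"
    "continuous_on (ball \<theta>0 \<delta>) (deriv \<rho>)" using assms by blast
  have "compact (deriv \<rho> ` cball \<theta>0 (\<delta> / 2))"
    using \<delta> by (intro compact_continuous_image continuous_on_subset[OF \<delta>(3)]) auto
  from compact_imp_bounded[OF this]
  obtain L where L': "\<forall>y\<in>deriv \<rho> ` cball \<theta>0 (\<delta> / 2). norm y \<le> L"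
    unfolding bounded_iff by blast
  have L: "\<bar>deriv \<rho> \<theta>\<bar> \<le> L" if "\<theta> \<in> cball \<theta>0 (\<delta> / 2)" for \<theta>
    using bspec[OF L' imageI[OF that]] by simp
  show ?thesis
  proof (rule that[of "\<delta> / 2" L])
    show "0 < \<delta> / 2" using \<delta> by simp
    show "0 \<le> L" using L[of \<theta>0] \<delta> by simp
    fix \<theta> assume \<theta>: "\<bar>\<theta> - \<theta>0\<bar> < \<delta> / 2"
    show "\<bar>\<rho> \<theta> - \<rho> \<theta>0\<bar> \<le> L * \<bar>\<theta> - \<theta>0\<bar>"
    proof (rule lipschitz_of_DERIV[where f' = "deriv \<rho>"])
      fix t assume "t \<in> closed_segment \<theta> \<theta>0"
      then have t: "\<bar>t - \<theta>0\<bar> < \<delta> / 2" using \<theta> by (auto simp: closed_segment_eq_real_ivl split: if_splits)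
      then show "(\<rho> has_real_derivative deriv \<rho> t) (at t)"
        using \<delta>(1) \<delta>(2)[of t] by (simp add: DERIV_deriv_iff_field_differentiable dist_real_def abs_minus_commute)
      show "\<bar>deriv \<rho> t\<bar> \<le> L" using t by (intro L) (simp add: dist_real_def abs_minus_commute)
    qed
  qed
qed

lemma L2_fun_diff:
  assumes f: "L2_fun P f" and g: "L2_fun P g"
  shows "L2_fun P (\<lambda>x. f x - g x)"
  unfolding L2_fun_def
proof
  show m: "(\<lambda>x. f x - g x) \<in> borel_measurable P" using f g unfolding L2_fun_def by auto
  show "integrable P (\<lambda>x. (f x - g x)\<^sup>2)"
  proof (rule Bochner_Integration.integrable_bound)
    show "integrable P (\<lambda>x. 2 * (f x)\<^sup>2 + 2 * (g x)\<^sup>2)" using f g unfolding L2_fun_def by auto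
    have "(f x - g x)\<^sup>2 \<le> 2 * (f x)\<^sup>2 + 2 * (g x)\<^sup>2" for x
      using zero_le_power2[of "f x + g x"] by (simp add: power2_eq_square algebra_simps)
    then show "AE x in P. norm ((f x - g x)\<^sup>2) \<le> norm (2 * (f x)\<^sup>2 + 2 * (g x)\<^sup>2)" by simp
  qed (use m in auto)
qed

lemma efficient_score_L2:
  assumes "is_efficient_score \<mu> H lik \<theta> \<eta> s"
  shows "L2_fun (law \<mu> lik \<theta> \<eta>) s"
  using assms unfolding is_efficient_score_def is_theta_score_def is_L2_projection_def L2_closed_span_def
  by (auto intro: L2_fun_diff)

lemma emp_mean_eq_proc:
  assumes "n \<ge> 1"
  shows "emp_mean n f xs = (\<integral>x. f x \<partial>P) + emp_proc P n f xs / sqrt n"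
  using assms by (simp add: emp_mean_def emp_proc_def sum_subtractf diff_divide_distrib)

lemma power_inverse_sqrt:
  assumes "n \<ge> 1"
  shows "(1 / sqrt (real n)) ^ k = real n powr (- real k / 2)"
proof -
  have pos: "0 < real n" using assms by simp
  have "1 / sqrt (real n) = 1 / real n powr (1 / 2)" using pos by (simp add: powr_half_sqrt)
  also have "\<dots> = real n powr (- (1 / 2))" by (simp only: powr_minus_divide)
  finally have "(1 / sqrt (real n)) ^ k = (real n powr (- (1 / 2))) ^ k" by (simp only:)
  also have "\<dots> = (real n powr (- (1 / 2))) powr real k" using pos by (intro powr_realpow[symmetric]) simp
  also have "\<dots> = real n powr (- (1 / 2) * real k)" by (rule powr_powr)
  finally show ?thesis by simp
qed

section \<open>Uniform stochastic bounds\<close>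

context iid_sample
begin

lemma likely_derivative_bound:
  assumes env: "smooth_envelopes P lik \<eta>sub V"
    and lm: "(l, m) \<in> {(0, 0), (1, 0), (2, 0), (3, 0), (1, 1), (1, 2), (2, 1)}"
  shows "likely M (\<lambda>K n \<omega>. \<forall>(t, \<theta>, \<eta>)\<in>V. \<bar>emp_mean n (ell_deriv lik \<eta>sub l m t \<theta> \<eta>) (\<lambda>i. X i \<omega>)\<bar> \<le> K)"
proof -
  obtain F where F: "integrable P F"
    "AE x in P. \<forall>(t, \<theta>, \<eta>)\<in>V. \<bar>ell_deriv lik \<eta>sub l m t \<theta> \<eta> x\<bar> \<le> F x"
    using smooth_envelopesD(2)[OF env lm] by blast
  let ?A = "\<lambda>\<omega>. \<forall>i. \<forall>(t, \<theta>, \<eta>)\<in>V. \<bar>ell_deriv lik \<eta>sub l m t \<theta> \<eta> (X i \<omega>)\<bar> \<le> F (X i \<omega>)"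
  have "likely M (\<lambda>K n \<omega>. \<bar>emp_mean n F (\<lambda>i. X i \<omega>)\<bar> \<le> K \<and> ?A \<omega>)"
    using likely_emp_mean[OF F(1)] likely_AE[of "\<lambda>_. ?A" M] AE_all_X[OF F(2)]
    by (intro likely_conj) (auto simp: mono_def le_fun_def)
  then show ?thesis
  proof (rule likely_weaken)
    fix K
    show "\<exists>K'. \<forall>\<^sub>F n in sequentially. \<forall>\<omega>\<in>space M. \<bar>emp_mean n F (\<lambda>i. X i \<omega>)\<bar> \<le> K \<and> ?A \<omega> \<longrightarrow>
        (\<forall>(t, \<theta>, \<eta>)\<in>V. \<bar>emp_mean n (ell_deriv lik \<eta>sub l m t \<theta> \<eta>) (\<lambda>i. X i \<omega>)\<bar> \<le> K')"
    proof (intro exI[of _ K] always_eventually allI ballI impI, clarify)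
      fix n \<omega> t \<theta> \<eta>
      assume F: "\<bar>emp_mean n F (\<lambda>i. X i \<omega>)\<bar> \<le> K" and A: "?A \<omega>" and V: "(t, \<theta>, \<eta>) \<in> V"
      have "\<bar>emp_mean n (ell_deriv lik \<eta>sub l m t \<theta> \<eta>) (\<lambda>i. X i \<omega>)\<bar> \<le> emp_mean n F (\<lambda>i. X i \<omega>)"
      proof -
        have "\<bar>\<Sum>i<n. ell_deriv lik \<eta>sub l m t \<theta> \<eta> (X i \<omega>)\<bar> \<le> (\<Sum>i<n. F (X i \<omega>))"
        proof (rule order.trans[OF sum_abs], rule sum_mono)
          show "\<bar>ell_deriv lik \<eta>sub l m t \<theta> \<eta> (X i \<omega>)\<bar> \<le> F (X i \<omega>)" for i
            using bspec[OF spec[OF A, of i] V] by simp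
        qed
        then show ?thesis unfolding emp_mean_def by (simp add: divide_right_mono)
      qed
      with F show "\<bar>emp_mean n (ell_deriv lik \<eta>sub l m t \<theta> \<eta>) (\<lambda>i. X i \<omega>)\<bar> \<le> K" by linarith
    qed
  qed
qed

text \<open>
  Donsker classes give the rate \<open>n\<^sup>-\<^sup>1\<^sup>/\<^sup>2\<close> uniformly over the nuisance parameter; what remains is
  the modulus of continuity of the means.
\<close>

lemma likely_donsker_nuisance:
  assumes dons: "donsker P (ell_class lik \<eta>sub l m V)"
    and V: "\<And>\<eta>. \<eta> \<in> T \<Longrightarrow> (\<theta>0, \<theta>0, \<eta>) \<in> V"
    and mean: "\<And>\<eta>. \<eta> \<in> T \<Longrightarrow> \<bar>(\<integral>x. ell_deriv lik \<eta>sub l m \<theta>0 \<theta>0 \<eta> x \<partial>P) - a\<bar> \<le> C * norm (\<eta> - \<eta>0)"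
  shows "likely M (\<lambda>K n \<omega>. \<forall>\<eta>\<in>T. \<bar>emp_mean n (ell_deriv lik \<eta>sub l m \<theta>0 \<theta>0 \<eta>) (\<lambda>i. X i \<omega>) - a\<bar>
      \<le> K * (1 / sqrt n + norm (\<eta> - \<eta>0)))"
  using likely_donsker[OF dons]
proof (rule likely_weaken)
  fix K
  let ?F = "ell_class lik \<eta>sub l m V"
  show "\<exists>K'. \<forall>\<^sub>F n in sequentially. \<forall>\<omega>\<in>space M. (\<forall>f\<in>?F. \<bar>emp_proc P n f (\<lambda>i. X i \<omega>)\<bar> \<le> K) \<longrightarrow>
      (\<forall>\<eta>\<in>T. \<bar>emp_mean n (ell_deriv lik \<eta>sub l m \<theta>0 \<theta>0 \<eta>) (\<lambda>i. X i \<omega>) - a\<bar>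
      \<le> K' * (1 / sqrt n + norm (\<eta> - \<eta>0)))"
  proof (intro exI[of _ "max K C"] eventually_sequentiallyI[of 1] ballI impI)
    fix n \<omega> \<eta>
    assume n: "1 \<le> n" and K: "\<forall>f\<in>?F. \<bar>emp_proc P n f (\<lambda>i. X i \<omega>)\<bar> \<le> K" and \<eta>: "\<eta> \<in> T"
    let ?f = "ell_deriv lik \<eta>sub l m \<theta>0 \<theta>0 \<eta>"
    have "?f \<in> ?F" unfolding ell_class_def using V[OF \<eta>] by force
    then have "\<bar>emp_proc P n ?f (\<lambda>i. X i \<omega>) / sqrt n\<bar> \<le> K / sqrt n"
      using K by (simp add: divide_right_mono)
    then have "\<bar>emp_mean n ?f (\<lambda>i. X i \<omega>) - a\<bar> \<le> K / sqrt n + C * norm (\<eta> - \<eta>0)"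
      using mean[OF \<eta>] unfolding emp_mean_eq_proc[OF n, where P = P] by linarith
    also have "\<dots> \<le> max K C / sqrt n + max K C * norm (\<eta> - \<eta>0)"
      by (intro add_mono divide_right_mono mult_right_mono) auto
    finally show "\<bar>emp_mean n ?f (\<lambda>i. X i \<omega>) - a\<bar> \<le> max K C * (1 / sqrt n + norm (\<eta> - \<eta>0))"
      by (simp add: distrib_left)
  qed
qed

text \<open>
  The two parts of the increment of the averaged score: its centred part is \<open>n\<^sup>-\<^sup>1\<^sup>/\<^sup>2\<close> times the empirical process, and its
  mean is quadratic in the nuisance error.
\<close>

lemma likely_score_nuisance:
  fixes \<eta>0 :: "'h::real_normed_vector"
  assumes proc: "bigOp_on M T
      (\<lambda>n \<eta> \<omega>. emp_proc P n (\<lambda>x. f \<eta> x - f \<eta>0 x) (\<lambda>i. X i \<omega>)) (\<lambda>\<eta>. norm (\<eta> - \<eta>0))"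
    and int: "\<And>\<eta>. \<eta> \<in> T \<Longrightarrow> integrable P (f \<eta>)" "integrable P (f \<eta>0)" "(\<integral>x. f \<eta>0 x \<partial>P) = 0"
    and mean: "\<And>\<eta>. \<eta> \<in> T \<Longrightarrow> \<bar>\<integral>x. f \<eta> x \<partial>P\<bar> \<le> C * (norm (\<eta> - \<eta>0))\<^sup>2"
  shows "likely M (\<lambda>K n \<omega>. \<forall>\<eta>\<in>T. \<bar>emp_mean n (f \<eta>) (\<lambda>i. X i \<omega>) - emp_mean n (f \<eta>0) (\<lambda>i. X i \<omega>)\<bar>
      \<le> K * (1 / sqrt n * norm (\<eta> - \<eta>0) + (norm (\<eta> - \<eta>0))\<^sup>2))"
proof -
  let ?G = "\<lambda>n \<eta> \<omega>. emp_proc P n (\<lambda>x. f \<eta> x - f \<eta>0 x) (\<lambda>i. X i \<omega>)"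
  have "likely M (\<lambda>K n \<omega>. \<forall>\<eta>\<in>T. \<bar>?G n \<eta> \<omega>\<bar> \<le> K * norm (\<eta> - \<eta>0))"
    using proc unfolding likely_def bigOp_on_def by (simp add: not_le)
  then show ?thesis
  proof (rule likely_weaken)
    fix K
    show "\<exists>K'. \<forall>\<^sub>F n in sequentially. \<forall>\<omega>\<in>space M. (\<forall>\<eta>\<in>T. \<bar>?G n \<eta> \<omega>\<bar> \<le> K * norm (\<eta> - \<eta>0)) \<longrightarrow>
      (\<forall>\<eta>\<in>T. \<bar>emp_mean n (f \<eta>) (\<lambda>i. X i \<omega>) - emp_mean n (f \<eta>0) (\<lambda>i. X i \<omega>)\<bar>
        \<le> K' * (1 / sqrt n * norm (\<eta> - \<eta>0) + (norm (\<eta> - \<eta>0))\<^sup>2))"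
    proof (intro exI[of _ "max K C"] eventually_sequentiallyI[of 1] ballI impI)
      fix n \<omega> \<eta>
      assume n: "1 \<le> n" and K: "\<forall>\<eta>\<in>T. \<bar>?G n \<eta> \<omega>\<bar> \<le> K * norm (\<eta> - \<eta>0)" and \<eta>: "\<eta> \<in> T"
      let ?N = "norm (\<eta> - \<eta>0)"
      have "emp_mean n (f \<eta>) (\<lambda>i. X i \<omega>) - emp_mean n (f \<eta>0) (\<lambda>i. X i \<omega>)
          = emp_mean n (\<lambda>x. f \<eta> x - f \<eta>0 x) (\<lambda>i. X i \<omega>)"
        by (simp add: emp_mean_def sum_subtractf diff_divide_distrib)
      also have "\<dots> = (\<integral>x. f \<eta> x \<partial>P) + ?G n \<eta> \<omega> / sqrt n"
        unfolding emp_mean_eq_proc[OF n, where P = P] using int \<eta> by simp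
      finally have "\<bar>emp_mean n (f \<eta>) (\<lambda>i. X i \<omega>) - emp_mean n (f \<eta>0) (\<lambda>i. X i \<omega>)\<bar>
          \<le> \<bar>\<integral>x. f \<eta> x \<partial>P\<bar> + \<bar>?G n \<eta> \<omega> / sqrt n\<bar>" by (simp only: abs_triangle_ineq)
      also have "\<dots> \<le> C * ?N\<^sup>2 + \<bar>?G n \<eta> \<omega>\<bar> / sqrt n" using mean[OF \<eta>] by simp
      also have "\<dots> \<le> C * ?N\<^sup>2 + (K * ?N) / sqrt n"
        using K \<eta> by (intro add_mono divide_right_mono) auto
      also have "\<dots> \<le> max K C * ?N\<^sup>2 + (max K C * ?N) / sqrt n"
        by (intro add_mono divide_right_mono mult_right_mono) auto
      finally show "\<bar>emp_mean n (f \<eta>) (\<lambda>i. X i \<omega>) - emp_mean n (f \<eta>0) (\<lambda>i. X i \<omega>)\<bar>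
          \<le> max K C * (1 / sqrt n * ?N + ?N\<^sup>2)" by (simp add: distrib_left)
    qed
  qed
qed

end

lemma op_zero_real_iff:
  "op_zero M (\<lambda>n \<omega>. ereal (Z n \<omega>)) \<longleftrightarrow>
     (\<forall>\<epsilon>>0. (\<lambda>n. outer_measure_of M {\<omega> \<in> space M. \<epsilon> < \<bar>Z n \<omega>\<bar>}) \<longlonglongrightarrow> 0)"
  unfolding op_zero_def by simp

text \<open>
  Select parameter values within \<open>1 / (k + 1)\<close> of \<open>\<theta>0\<close> at which the bound fails with constant \<open>k + 1\<close>.  The resulting sequence
  converges to \<open>\<theta>0\<close>, so the hypothesis applies to it and bounds its rate by a fixed constant.
\<close>

lemma likely_nuisance_rate:
  fixes \<eta>0 :: "'h::real_normed_vector"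
  assumes \<theta>0: "\<theta>0 \<in> \<Theta>"
    and rate: "\<And>tt :: nat \<Rightarrow> 'o \<Rightarrow> real.
        (\<forall>n. \<forall>\<omega>\<in>space M. tt n \<omega> \<in> \<Theta>) \<Longrightarrow> op_zero M (\<lambda>n \<omega>. ereal (tt n \<omega> - \<theta>0)) \<Longrightarrow>
        bigOp M (\<lambda>n \<omega>. norm (\<eta>hat n \<omega> (tt n \<omega>) - \<eta>0))
                (\<lambda>n \<omega>. real n powr (- 1 / 2) + \<bar>tt n \<omega> - \<theta>0\<bar>)"
  shows "likely M (\<lambda>K n \<omega>. \<forall>\<psi>\<in>\<Theta>. K * \<bar>\<psi> - \<theta>0\<bar> < 1 \<longrightarrow>
      norm (\<eta>hat n \<omega> \<psi> - \<eta>0) \<le> K * (1 / sqrt n + \<bar>\<psi> - \<theta>0\<bar>))"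
proof (rule likelyI, rule ccontr)
  fix \<epsilon> :: real assume \<epsilon>: "\<epsilon> > 0"
  define E where "E k n \<psi> \<omega> \<longleftrightarrow> (real k + 1) * \<bar>\<psi> - \<theta>0\<bar> < 1 \<and>
      \<not> norm (\<eta>hat n \<omega> \<psi> - \<eta>0) \<le> (real k + 1) * (1 / sqrt n + \<bar>\<psi> - \<theta>0\<bar>)" for k n \<psi> \<omega>
  assume "\<nexists>K. \<forall>\<^sub>F n in sequentially. outer_measure_of M {\<omega> \<in> space M. \<not> (\<forall>\<psi>\<in>\<Theta>. K * \<bar>\<psi> - \<theta>0\<bar> < 1 \<longrightarrow>
      norm (\<eta>hat n \<omega> \<psi> - \<eta>0) \<le> K * (1 / sqrt n + \<bar>\<psi> - \<theta>0\<bar>))} < ennreal \<epsilon>"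
  then have freq: "\<not> (\<forall>\<^sub>F n in sequentially.
      outer_measure_of M {\<omega> \<in> space M. \<exists>\<psi>\<in>\<Theta>. E k n \<psi> \<omega>} < ennreal \<epsilon>)" for k
    unfolding E_def by (simp add: not_all)
  obtain \<kappa> tt where \<kappa>: "filterlim \<kappa> at_top sequentially"
    and tt: "\<And>n \<omega>. \<omega> \<in> space M \<Longrightarrow> tt n \<omega> \<in> \<Theta>"
    and sel: "\<And>n \<omega>. \<omega> \<in> space M \<Longrightarrow> tt n \<omega> = \<theta>0 \<or> E (\<kappa> n) n (tt n \<omega>) \<omega>"
    and contra: "\<And>Q. \<lbrakk>\<forall>\<^sub>F n in sequentially. outer_measure_of M {\<omega> \<in> space M. Q n \<omega>} < ennreal \<epsilon>;
        \<forall>\<^sub>F n in sequentially. \<forall>\<omega>\<in>space M. E (\<kappa> n) n (tt n \<omega>) \<omega> \<longrightarrow> Q n \<omega>\<rbrakk> \<Longrightarrow> False"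
    by (rule diagonal_selection[of M \<Theta> E "ennreal \<epsilon>" "\<lambda>_ _. \<theta>0", OF freq \<theta>0]) (rule that)
  have large: "\<forall>\<^sub>F n in sequentially. c \<le> real (\<kappa> n)" for c :: real
    using filterlim_compose[OF filterlim_real_sequentially \<kappa>] unfolding filterlim_at_top by blast
  have "op_zero M (\<lambda>n \<omega>. ereal (tt n \<omega> - \<theta>0))"
    unfolding op_zero_real_iff
  proof (intro allI impI tendsto_eventually)
    fix \<epsilon>' :: real assume \<epsilon>': "\<epsilon>' > 0"
    show "\<forall>\<^sub>F n in sequentially. outer_measure_of M {\<omega> \<in> space M. \<epsilon>' < \<bar>tt n \<omega> - \<theta>0\<bar>} = 0"
      using large[of "1 / \<epsilon>'"]
    proof eventually_elim
      case (elim n)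
      have "\<not> \<epsilon>' < \<bar>tt n \<omega> - \<theta>0\<bar>" if \<omega>: "\<omega> \<in> space M" for \<omega>
      proof
        assume *: "\<epsilon>' < \<bar>tt n \<omega> - \<theta>0\<bar>"
        then have "(real (\<kappa> n) + 1) * \<bar>tt n \<omega> - \<theta>0\<bar> < 1" using sel[OF \<omega>, of n] \<epsilon>' by (auto simp: E_def)
        moreover have "(1 / \<epsilon>') * \<epsilon>' \<le> (real (\<kappa> n) + 1) * \<bar>tt n \<omega> - \<theta>0\<bar>"
          using elim * \<epsilon>' by (intro mult_mono) auto
        ultimately show False using \<epsilon>' by simp
      qed
      then have "{\<omega> \<in> space M. \<epsilon>' < \<bar>tt n \<omega> - \<theta>0\<bar>} = {}" by blast
      then show ?case by (simp del: Collect_empty_eq)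
    qed
  qed
  from rate[OF _ this] tt obtain C where C: "\<forall>\<^sub>F n in sequentially. outer_measure_of M {\<omega> \<in> space M.
      C * (real n powr (- 1 / 2) + \<bar>tt n \<omega> - \<theta>0\<bar>) < \<bar>norm (\<eta>hat n \<omega> (tt n \<omega>) - \<eta>0)\<bar>} < ennreal \<epsilon>"
    unfolding bigOp_def using \<epsilon> by blast
  show False
  proof (rule contra[OF C])
    show "\<forall>\<^sub>F n in sequentially. \<forall>\<omega>\<in>space M. E (\<kappa> n) n (tt n \<omega>) \<omega> \<longrightarrow>
        C * (real n powr (- 1 / 2) + \<bar>tt n \<omega> - \<theta>0\<bar>) < \<bar>norm (\<eta>hat n \<omega> (tt n \<omega>) - \<eta>0)\<bar>"
      using large[of C] eventually_ge_at_top[of 1]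
    proof eventually_elim
      case (elim n)
      show ?case
      proof (intro ballI impI)
        fix \<omega> assume "\<omega> \<in> space M" and E: "E (\<kappa> n) n (tt n \<omega>) \<omega>"
        have "C * (1 / sqrt n + \<bar>tt n \<omega> - \<theta>0\<bar>) \<le> (real (\<kappa> n) + 1) * (1 / sqrt n + \<bar>tt n \<omega> - \<theta>0\<bar>)"
          using elim by (intro mult_right_mono) auto
        then show "C * (real n powr (- 1 / 2) + \<bar>tt n \<omega> - \<theta>0\<bar>) < \<bar>norm (\<eta>hat n \<omega> (tt n \<omega>) - \<eta>0)\<bar>"
          using E power_inverse_sqrt[OF elim(2), of 1] by (simp add: E_def)
      qed
    qed
  qed
qed

text \<open>
  A parameter value whose likelihood ratio is at least \<open>exp (- c n)\<close> with \<open>c \<rightarrow> 0\<close> makes \<open>\<Delta>\<^sub>n\<close> vanish, so the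
  identifiability hypothesis applies to it.
\<close>

lemma Delta_n_le:
  assumes mle: "is_mle \<Theta> H lik n xs \<theta>h \<eta>h" and n: "n \<ge> 1" and \<psi>: "\<psi> \<in> \<Theta>"
    and pos: "0 < prof_lik H lik n xs \<theta>h"
    and ge: "prof_lik H lik n xs \<theta>h * exp (- (c * n)) \<le> prof_lik H lik n xs \<psi>"
  shows "\<bar>Delta_n H lik n xs \<theta>h \<psi>\<bar> \<le> ereal c"
proof -
  let ?a = "prof_lik H lik n xs \<psi>" and ?b = "prof_lik H lik n xs \<theta>h"
  have a: "0 < ?a" using ge pos by (meson exp_gt_zero less_le_trans mult_pos_pos)
  have ab: "?a \<le> ?b" by (rule prof_lik_le_mle[OF mle \<psi>])
  have "ln (?b * exp (- (c * n))) \<le> ln ?a" using ge pos a by (subst ln_le_cancel_iff) auto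
  then have lo: "ln ?b - c * n \<le> ln ?a" using pos by (simp add: ln_mult)
  have up: "ln ?a \<le> ln ?b" using ab a pos by (subst ln_le_cancel_iff) auto
  have "Delta_n H lik n xs \<theta>h \<psi> = ereal ((ln ?a - ln ?b) / n)"
    using a pos n by (simp add: Delta_n_def ext_ln_def)
  moreover have "\<bar>(ln ?a - ln ?b) / n\<bar> \<le> c"
    using lo up n by (simp add: abs_le_iff divide_le_eq le_divide_eq field_simps)
  ultimately show ?thesis by simp
qed

text \<open>Positivity of the maximal likelihood keeps \<open>\<Delta>\<^sub>n\<close> away from the undefined form \<open>- \<infinity> - (- \<infinity>)\<close>.\<close>

locale identifiable_profile =
  fixes M :: "'o measure" and xs :: "'o \<Rightarrow> nat \<Rightarrow> 'x"
    and lik :: "real \<Rightarrow> 'h \<Rightarrow> 'x \<Rightarrow> real" and \<Theta> :: "real set" and H :: "'h set" and \<theta>0 :: real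
    and \<theta>hat :: "nat \<Rightarrow> 'o \<Rightarrow> real" and \<eta>hat :: "nat \<Rightarrow> 'o \<Rightarrow> real \<Rightarrow> 'h"
  assumes \<theta>0: "\<theta>0 \<in> \<Theta>"
    and good: "\<And>n. AE \<omega> in M. is_mle \<Theta> H lik n (xs \<omega>) (\<theta>hat n \<omega>) (\<eta>hat n \<omega>) \<and>
        0 < prof_lik H lik n (xs \<omega>) (\<theta>hat n \<omega>)"
    and consistency: "\<And>tt :: nat \<Rightarrow> 'o \<Rightarrow> real.
        (\<forall>n. \<forall>\<omega>\<in>space M. tt n \<omega> \<in> \<Theta>) \<Longrightarrow>
        op_zero M (\<lambda>n \<omega>. Delta_n H lik n (xs \<omega>) (\<theta>hat n \<omega>) (tt n \<omega>)) \<Longrightarrow>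
        op_zero M (\<lambda>n \<omega>. ereal (tt n \<omega> - \<theta>0))"
begin

abbreviation pl where "pl n \<omega> \<equiv> prof_lik H lik n (xs \<omega>)"
abbreviation mle where "mle n \<omega> \<equiv> is_mle \<Theta> H lik n (xs \<omega>) (\<theta>hat n \<omega>) (\<eta>hat n \<omega>)"

lemma consistency_of_likelihood_ratio:
  assumes tt: "\<And>n \<omega>. \<omega> \<in> space M \<Longrightarrow> tt n \<omega> \<in> \<Theta>"
    and c: "c \<longlonglongrightarrow> 0"
    and ge: "\<And>n \<omega>. \<lbrakk>\<omega> \<in> space M; mle n \<omega>; 0 < pl n \<omega> (\<theta>hat n \<omega>)\<rbrakk> \<Longrightarrow>
        pl n \<omega> (\<theta>hat n \<omega>) * exp (- (c n * n)) \<le> pl n \<omega> (tt n \<omega>)"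
    and "0 < \<delta>" "0 < \<epsilon>"
  shows "\<forall>\<^sub>F n in sequentially. outer_measure_of M {\<omega> \<in> space M. \<delta> < \<bar>tt n \<omega> - \<theta>0\<bar>} < ennreal \<epsilon>"
proof -
  let ?\<Delta> = "\<lambda>n \<omega>. Delta_n H lik n (xs \<omega>) (\<theta>hat n \<omega>) (tt n \<omega>)"
  have "op_zero M ?\<Delta>"
    unfolding op_zero_def
  proof (intro allI impI tendsto_eventually)
    fix \<epsilon>' :: real assume "\<epsilon>' > 0"
    with c have "\<forall>\<^sub>F n in sequentially. c n < \<epsilon>'" by (rule order_tendstoD)
    then show "\<forall>\<^sub>F n in sequentially. outer_measure_of M {\<omega> \<in> space M. ereal \<epsilon>' < \<bar>?\<Delta> n \<omega>\<bar>} = 0"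
      using eventually_ge_at_top[of 1]
    proof eventually_elim
      case (elim n)
      let ?good = "\<lambda>\<omega>. mle n \<omega> \<and> 0 < pl n \<omega> (\<theta>hat n \<omega>)"
      have "{\<omega> \<in> space M. ereal \<epsilon>' < \<bar>?\<Delta> n \<omega>\<bar>} \<subseteq> {\<omega> \<in> space M. \<not> ?good \<omega>}"
      proof (intro subsetI CollectI conjI notI)
        fix \<omega> assume \<omega>: "\<omega> \<in> {\<omega> \<in> space M. ereal \<epsilon>' < \<bar>?\<Delta> n \<omega>\<bar>}"
        then show "\<omega> \<in> space M" by simp
        assume g: "?good \<omega>"
        have "\<bar>?\<Delta> n \<omega>\<bar> \<le> ereal (c n)"
          using g \<omega> elim tt ge by (intro Delta_n_le[where \<Theta> = \<Theta> and \<eta>h = "\<eta>hat n \<omega>"]) auto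
        also have "\<dots> \<le> ereal \<epsilon>'" using elim by simp
        finally show False using \<omega> by auto
      qed
      then have "outer_measure_of M {\<omega> \<in> space M. ereal \<epsilon>' < \<bar>?\<Delta> n \<omega>\<bar>}
          \<le> outer_measure_of M {\<omega> \<in> space M. \<not> ?good \<omega>}" by (rule outer_measure_of_mono)
      also have "\<dots> = 0" by (rule outer_measure_of_AE_not[OF good])
      finally show ?case by simp
    qed
  qed
  then have "op_zero M (\<lambda>n \<omega>. ereal (tt n \<omega> - \<theta>0))" by (rule consistency[rotated]) (use tt in blast)
  then have "(\<lambda>n. outer_measure_of M {\<omega> \<in> space M. \<delta> < \<bar>tt n \<omega> - \<theta>0\<bar>}) \<longlonglongrightarrow> 0"
    using \<open>0 < \<delta>\<close> unfolding op_zero_real_iff by blast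
  moreover have "0 < ennreal \<epsilon>" using \<open>0 < \<epsilon>\<close> by simp
  ultimately show ?thesis by (rule order_tendstoD)
qed

text \<open>The premise \<open>\<theta>hat n \<omega> \<in> \<Theta>\<close> restricts the claim to outcomes at which \<open>\<theta>hat\<close> is an estimator; it fails on a null set at most.\<close>

lemma mle_consistent:
  assumes "0 < \<delta>" "0 < \<epsilon>"
  shows "\<forall>\<^sub>F n in sequentially. outer_measure_of M
      {\<omega> \<in> space M. \<not> (\<theta>hat n \<omega> \<in> \<Theta> \<longrightarrow> \<bar>\<theta>hat n \<omega> - \<theta>0\<bar> \<le> \<delta>)} < ennreal \<epsilon>"
proof -
  define tt where "tt n \<omega> = (if \<theta>hat n \<omega> \<in> \<Theta> then \<theta>hat n \<omega> else \<theta>0)" for n \<omega>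
  have "\<forall>\<^sub>F n in sequentially. outer_measure_of M {\<omega> \<in> space M. \<delta> < \<bar>tt n \<omega> - \<theta>0\<bar>} < ennreal \<epsilon>"
  proof (rule consistency_of_likelihood_ratio[where c = "\<lambda>_. 0"])
    fix n \<omega> assume "mle n \<omega>"
    then have "\<theta>hat n \<omega> \<in> \<Theta>" unfolding is_mle_def by blast
    then show "pl n \<omega> (\<theta>hat n \<omega>) * exp (- (0 * real n)) \<le> pl n \<omega> (tt n \<omega>)"
      by (simp add: tt_def)
  qed (use assms \<theta>0 in \<open>auto simp: tt_def\<close>)
  then show ?thesis
  proof eventually_elim
    case (elim n)
    have "{\<omega> \<in> space M. \<not> (\<theta>hat n \<omega> \<in> \<Theta> \<longrightarrow> \<bar>\<theta>hat n \<omega> - \<theta>0\<bar> \<le> \<delta>)} \<subseteq> {\<omega> \<in> space M. \<delta> < \<bar>tt n \<omega> - \<theta>0\<bar>}"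
      by (auto simp: tt_def)
    then have "outer_measure_of M {\<omega> \<in> space M. \<not> (\<theta>hat n \<omega> \<in> \<Theta> \<longrightarrow> \<bar>\<theta>hat n \<omega> - \<theta>0\<bar> \<le> \<delta>)}
        \<le> outer_measure_of M {\<omega> \<in> space M. \<delta> < \<bar>tt n \<omega> - \<theta>0\<bar>}" by (rule outer_measure_of_mono)
    also note elim
    finally show ?case .
  qed
qed

text \<open>
  If parameter values at distance \<open>\<delta>\<close> from \<open>\<theta>0\<close> with likelihood ratio above \<open>exp (- n / (k + 1))\<close> kept occurring for every \<open>k\<close>,
  selecting them, and \<open>\<theta>hat\<close> where there is none, would give a sequence with \<open>\<Delta>\<^sub>n \<rightarrow> 0\<close> that does not converge to \<open>\<theta>0\<close>.
\<close>

lemma profile_separation: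
  assumes \<delta>: "0 < \<delta>" and \<epsilon>: "0 < \<epsilon>"
  obtains c :: real where "0 < c"
    "\<forall>\<^sub>F n in sequentially. outer_measure_of M {\<omega> \<in> space M. \<not> (\<forall>\<psi>\<in>\<Theta>. \<delta> \<le> \<bar>\<psi> - \<theta>0\<bar> \<longrightarrow>
        pl n \<omega> \<psi> \<le> pl n \<omega> (\<theta>hat n \<omega>) * exp (- (c * n)))} < ennreal \<epsilon>"
proof (rule ccontr)
  assume no: "\<not> thesis"
  define c where "c k = inverse (real (Suc k))" for k
  have c: "0 < c k" for k by (simp add: c_def)
  define E where "E k n \<psi> \<omega> \<longleftrightarrow> \<delta> \<le> \<bar>\<psi> - \<theta>0\<bar> \<and>
      \<not> pl n \<omega> \<psi> \<le> pl n \<omega> (\<theta>hat n \<omega>) * exp (- (c k * n))" for k n \<psi> \<omega>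
  have freq: "\<not> (\<forall>\<^sub>F n in sequentially.
      outer_measure_of M {\<omega> \<in> space M. \<exists>\<psi>\<in>\<Theta>. E k n \<psi> \<omega>} < ennreal \<epsilon>)" for k
  proof
    assume *: "\<forall>\<^sub>F n in sequentially.
        outer_measure_of M {\<omega> \<in> space M. \<exists>\<psi>\<in>\<Theta>. E k n \<psi> \<omega>} < ennreal \<epsilon>"
    have "(\<exists>\<psi>\<in>\<Theta>. E k n \<psi> \<omega>) \<longleftrightarrow> \<not> (\<forall>\<psi>\<in>\<Theta>. \<delta> \<le> \<bar>\<psi> - \<theta>0\<bar> \<longrightarrow>
        pl n \<omega> \<psi> \<le> pl n \<omega> (\<theta>hat n \<omega>) * exp (- (c k * n)))" for n \<omega>
      unfolding E_def by blast
    with * have "\<forall>\<^sub>F n in sequentially. outer_measure_of M {\<omega> \<in> space M. \<not> (\<forall>\<psi>\<in>\<Theta>. \<delta> \<le> \<bar>\<psi> - \<theta>0\<bar> \<longrightarrow>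
        pl n \<omega> \<psi> \<le> pl n \<omega> (\<theta>hat n \<omega>) * exp (- (c k * n)))} < ennreal \<epsilon>" by (simp only:)
    from that[OF c this] no show False by (rule notE[rotated])
  qed
  define d where "d n \<omega> = (if \<theta>hat n \<omega> \<in> \<Theta> then \<theta>hat n \<omega> else \<theta>0)" for n \<omega>
  have d_in: "d n \<omega> \<in> \<Theta>" for n \<omega> using \<theta>0 by (simp add: d_def)
  obtain \<kappa> tt where \<kappa>: "filterlim \<kappa> at_top sequentially"
    and tt: "\<And>n \<omega>. \<omega> \<in> space M \<Longrightarrow> tt n \<omega> \<in> \<Theta>"
    and sel: "\<And>n \<omega>. \<omega> \<in> space M \<Longrightarrow> tt n \<omega> = d n \<omega> \<or> E (\<kappa> n) n (tt n \<omega>) \<omega>"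
    and contra: "\<And>Q. \<lbrakk>\<forall>\<^sub>F n in sequentially. outer_measure_of M {\<omega> \<in> space M. Q n \<omega>} < ennreal \<epsilon>;
        \<forall>\<^sub>F n in sequentially. \<forall>\<omega>\<in>space M. E (\<kappa> n) n (tt n \<omega>) \<omega> \<longrightarrow> Q n \<omega>\<rbrakk> \<Longrightarrow> False"
    by (rule diagonal_selection[of M \<Theta> E "ennreal \<epsilon>" d, OF freq d_in]) (rule that)
  have c0: "(\<lambda>n. c (\<kappa> n)) \<longlonglongrightarrow> 0"
    unfolding c_def by (rule filterlim_compose[OF LIMSEQ_inverse_real_of_nat \<kappa>])
  have "\<forall>\<^sub>F n in sequentially. outer_measure_of M {\<omega> \<in> space M. \<delta> / 2 < \<bar>tt n \<omega> - \<theta>0\<bar>} < ennreal \<epsilon>"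
  proof (rule consistency_of_likelihood_ratio[OF tt c0])
    fix n \<omega>
    assume \<omega>: "\<omega> \<in> space M" and mle: "mle n \<omega>" and pos: "0 < pl n \<omega> (\<theta>hat n \<omega>)"
    show "pl n \<omega> (\<theta>hat n \<omega>) * exp (- (c (\<kappa> n) * real n)) \<le> pl n \<omega> (tt n \<omega>)"
      using sel[OF \<omega>, of n]
    proof
      assume "tt n \<omega> = d n \<omega>"
      moreover have "\<theta>hat n \<omega> \<in> \<Theta>" using mle unfolding is_mle_def by blast
      moreover have "exp (- (c (\<kappa> n) * real n)) \<le> 1" using c[of "\<kappa> n"] by simp
      ultimately show ?thesis using pos by (simp add: d_def mult_left_le)
    qed (simp add: E_def)
  qed (use \<delta> \<epsilon> in auto)
  then show False
    by (rule contra) (use \<delta> in \<open>auto simp: E_def intro!: always_eventually\<close>)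
qed

end

section \<open>Posterior moments\<close>

theorem corollary2:
  fixes M :: "'o measure" and X :: "nat \<Rightarrow> 'o \<Rightarrow> 'x"
    and \<mu> P :: "'x measure"
    and lik :: "real \<Rightarrow> 'h::real_normed_vector \<Rightarrow> 'x \<Rightarrow> real"
    and \<Theta> :: "real set" and H :: "'h set" and \<theta>0 :: real and \<eta>0 :: 'h
    and \<theta>hat :: "nat \<Rightarrow> 'o \<Rightarrow> real" and \<eta>hat :: "nat \<Rightarrow> 'o \<Rightarrow> real \<Rightarrow> 'h"
    and \<eta>sub :: "real \<Rightarrow> real \<Rightarrow> 'h \<Rightarrow> 'h"
    and dl :: "nat \<Rightarrow> nat \<Rightarrow> real \<Rightarrow> real \<Rightarrow> 'h \<Rightarrow> 'x \<Rightarrow> real"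
    and eff :: "'x \<Rightarrow> real" and I0 :: real
    and \<rho> :: "real \<Rightarrow> real" and r :: nat
  assumes model: "semiparametric_model \<mu> \<Theta> H lik"
    and truth: "\<theta>0 \<in> \<Theta>" "\<eta>0 \<in> H" "P = law \<mu> lik \<theta>0 \<eta>0"
    and data: "prob_space M" "prob_space.indep_vars M (\<lambda>_. P) X UNIV" "\<And>i. distr M P (X i) = P"
    and mle: "\<And>n. AE \<omega> in M. is_mle \<Theta> H lik n (\<lambda>i. X i \<omega>) (\<theta>hat n \<omega>) (\<eta>hat n \<omega>)"
    and eff: "is_efficient_score \<mu> H lik \<theta>0 \<eta>0 eff"
    and I0: "I0 = efficient_info P eff"
    and dl: "dl = ell_deriv lik \<eta>sub"
    and least_favorable: "AE x in P. dl 1 0 \<theta>0 \<theta>0 \<eta>0 x = eff x"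
    and A1: "compact \<Theta>" "\<theta>0 \<in> interior \<Theta>"
    and A2: "is_submodel \<Theta> H \<theta>0 \<eta>0 \<eta>sub"
    and A3: "\<And>tt :: nat \<Rightarrow> 'o \<Rightarrow> real.
        (\<forall>n. \<forall>\<omega>\<in>space M. tt n \<omega> \<in> \<Theta>) \<Longrightarrow> op_zero M (\<lambda>n \<omega>. ereal (tt n \<omega> - \<theta>0)) \<Longrightarrow>
        bigOp M (\<lambda>n \<omega>. norm (\<eta>hat n \<omega> (tt n \<omega>) - \<eta>0))
                (\<lambda>n \<omega>. real n powr (- 1 / 2) + \<bar>tt n \<omega> - \<theta>0\<bar>)"
    and A4: "\<exists>\<delta>>0. smooth_envelopes P lik \<eta>sub (nbhd3 \<Theta> H \<theta>0 \<eta>0 \<delta>)"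
      "- (\<integral>x. (dl 1 0 \<theta>0 \<theta>0 \<eta>0 x)\<^sup>2 \<partial>P) = (\<integral>x. dl 2 0 \<theta>0 \<theta>0 \<eta>0 x \<partial>P)"
      "((\<lambda>\<theta>. \<integral>x. dl 1 0 \<theta>0 \<theta> \<eta>0 x \<partial>P) has_real_derivative 0) (at \<theta>0)"
    and A5: "\<exists>\<delta>>0.
        donsker P (ell_class lik \<eta>sub 2 0 (nbhd3 \<Theta> H \<theta>0 \<eta>0 \<delta>)) \<and>
        donsker P (ell_class lik \<eta>sub 1 1 (nbhd3 \<Theta> H \<theta>0 \<eta>0 \<delta>)) \<and>
        glivenko_cantelli P (ell_class lik \<eta>sub 3 0 (nbhd3 \<Theta> H \<theta>0 \<eta>0 \<delta>))"
    and A6: "\<exists>\<delta>>0.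
        bigOp_on M {\<eta>\<in>H. norm (\<eta> - \<eta>0) < \<delta>}
          (\<lambda>n \<eta> \<omega>. emp_proc P n (\<lambda>x. dl 1 0 \<theta>0 \<theta>0 \<eta> x - dl 1 0 \<theta>0 \<theta>0 \<eta>0 x) (\<lambda>i. X i \<omega>))
          (\<lambda>\<eta>. norm (\<eta> - \<eta>0)) \<and>
        (\<exists>C. \<forall>\<eta>\<in>H. norm (\<eta> - \<eta>0) < \<delta> \<longrightarrow>
          \<bar>(\<integral>x. dl 2 0 \<theta>0 \<theta>0 \<eta> x \<partial>P) - (\<integral>x. dl 2 0 \<theta>0 \<theta>0 \<eta>0 x \<partial>P)\<bar> \<le> C * norm (\<eta> - \<eta>0) \<and>
          \<bar>(\<integral>x. dl 1 1 \<theta>0 \<theta>0 \<eta> x \<partial>P) - (\<integral>x. dl 1 1 \<theta>0 \<theta>0 \<eta>0 x \<partial>P)\<bar> \<le> C * norm (\<eta> - \<eta>0) \<and>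
          \<bar>\<integral>x. dl 1 0 \<theta>0 \<theta>0 \<eta> x \<partial>P\<bar> \<le> C * (norm (\<eta> - \<eta>0))\<^sup>2)"
    and A7: "0 < I0"
    and consistency: "\<And>tt :: nat \<Rightarrow> 'o \<Rightarrow> real.
        (\<forall>n. \<forall>\<omega>\<in>space M. tt n \<omega> \<in> \<Theta>) \<Longrightarrow>
        op_zero M (\<lambda>n \<omega>. Delta_n H lik n (\<lambda>i. X i \<omega>) (\<theta>hat n \<omega>) (tt n \<omega>)) \<Longrightarrow>
        op_zero M (\<lambda>n \<omega>. ereal (tt n \<omega> - \<theta>0))"
    and prior: "proper_prior \<Theta> \<rho>" "0 < \<rho> \<theta>0"
      "\<exists>\<delta>>0. (\<forall>\<theta>\<in>ball \<theta>0 \<delta>. \<rho> field_differentiable (at \<theta>)) \<and> continuous_on (ball \<theta>0 \<delta>) (deriv \<rho>)"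
    and posterior_measurable:
      "\<And>n. AE \<omega> in M. (\<lambda>\<theta>. \<rho> \<theta> * prof_lik H lik n (\<lambda>i. X i \<omega>) \<theta>) \<in> borel_measurable borel"
    and r: "1 \<le> r"
    and moment: "integrable lborel (\<lambda>\<theta>. \<bar>\<theta>\<bar> ^ r * \<rho> \<theta>)"
  shows "bigOp M
    (\<lambda>n \<omega>. (\<integral>\<theta>. ((\<theta> - \<theta>hat n \<omega>) * sqrt I0) ^ r
               \<partial>profile_posterior \<rho> (prof_lik H lik n (\<lambda>i. X i \<omega>)))
           - real n powr (- real r / 2) * (\<integral>u. u ^ r \<partial>std_normal_distribution))
    (\<lambda>n \<omega>. real n powr (- (real r + 1) / 2))"
proof -
  interpret prob_space M by (rule data(1))
  interpret iid_sample M P X by unfold_locales (use data in auto)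
  let ?xs = "\<lambda>\<omega> i. X i \<omega>"
  let ?d = "ell_deriv lik \<eta>sub"
  let ?S = "\<lambda>l m t \<theta> \<eta> n \<omega>. emp_mean n (?d l m t \<theta> \<eta>) (?xs \<omega>)"
  let ?pl = "\<lambda>n \<omega>. prof_lik H lik n (?xs \<omega>)"
  let ?dev = "\<lambda>n \<omega>. \<bar>(\<integral>\<theta>. ((\<theta> - \<theta>hat n \<omega>) * sqrt I0) ^ r \<partial>profile_posterior \<rho> (?pl n \<omega>))
           - real n powr (- real r / 2) * (\<integral>u. u ^ r \<partial>std_normal_distribution)\<bar>"
  \<comment> \<open>The assumptions hold on neighborhoods of \<open>(\<theta>0, \<theta>0, \<eta>0)\<close> of various sizes; the smallest radius serves all of them.\<close>
  obtain \<delta>1 where \<delta>1: "0 < \<delta>1" "ball \<theta>0 \<delta>1 \<subseteq> \<Theta>"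
    using A1(2) by (auto simp: mem_interior)
  obtain \<delta>2 where \<delta>2: "0 < \<delta>2" "\<forall>(t, \<theta>, \<eta>) \<in> nbhd3 \<Theta> H \<theta>0 \<eta>0 \<delta>2. \<eta>sub t \<theta> \<eta> \<in> H"
    using A2 unfolding is_submodel_def by blast
  obtain \<delta>4 where \<delta>4: "0 < \<delta>4" "smooth_envelopes P lik \<eta>sub (nbhd3 \<Theta> H \<theta>0 \<eta>0 \<delta>4)"
    using A4(1) by blast
  obtain \<delta>5 where \<delta>5: "0 < \<delta>5" "donsker P (ell_class lik \<eta>sub 2 0 (nbhd3 \<Theta> H \<theta>0 \<eta>0 \<delta>5))"
    "donsker P (ell_class lik \<eta>sub 1 1 (nbhd3 \<Theta> H \<theta>0 \<eta>0 \<delta>5))"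
    using A5 by blast
  obtain \<delta>6 C6 where \<delta>6: "0 < \<delta>6" "bigOp_on M {\<eta>\<in>H. norm (\<eta> - \<eta>0) < \<delta>6}
        (\<lambda>n \<eta> \<omega>. emp_proc P n (\<lambda>x. dl 1 0 \<theta>0 \<theta>0 \<eta> x - dl 1 0 \<theta>0 \<theta>0 \<eta>0 x) (\<lambda>i. X i \<omega>))
        (\<lambda>\<eta>. norm (\<eta> - \<eta>0))"
    and C6: "\<forall>\<eta>\<in>H. norm (\<eta> - \<eta>0) < \<delta>6 \<longrightarrow>
          \<bar>(\<integral>x. dl 2 0 \<theta>0 \<theta>0 \<eta> x \<partial>P) - (\<integral>x. dl 2 0 \<theta>0 \<theta>0 \<eta>0 x \<partial>P)\<bar> \<le> C6 * norm (\<eta> - \<eta>0) \<and>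
          \<bar>(\<integral>x. dl 1 1 \<theta>0 \<theta>0 \<eta> x \<partial>P) - (\<integral>x. dl 1 1 \<theta>0 \<theta>0 \<eta>0 x \<partial>P)\<bar> \<le> C6 * norm (\<eta> - \<eta>0) \<and>
          \<bar>\<integral>x. dl 1 0 \<theta>0 \<theta>0 \<eta> x \<partial>P\<bar> \<le> C6 * (norm (\<eta> - \<eta>0))\<^sup>2"
    using A6 by blast
  define \<delta> where "\<delta> = min \<delta>1 (min \<delta>2 (min \<delta>4 (min \<delta>5 \<delta>6)))"
  have \<delta>: "0 < \<delta>" "\<delta> \<le> \<delta>1" "\<delta> \<le> \<delta>2" "\<delta> \<le> \<delta>4" "\<delta> \<le> \<delta>5" "\<delta> \<le> \<delta>6"
    using \<delta>1 \<delta>2 \<delta>4 \<delta>5 \<delta>6 by (auto simp: \<delta>_def)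
  let ?V = "nbhd3 \<Theta> H \<theta>0 \<eta>0 \<delta>"
  let ?T = "{\<eta>\<in>H. norm (\<eta> - \<eta>0) < \<delta>}"
  have box: "t \<in> \<Theta>" if "\<bar>t - \<theta>0\<bar> < \<delta>" for t
    using that \<delta>(2) \<delta>1(2) by (auto simp: dist_real_def abs_minus_commute subset_eq)
  have sub: "\<eta>sub t \<theta> \<eta> \<in> H" if "(t, \<theta>, \<eta>) \<in> ?V" for t \<theta> \<eta>
    using bspec[OF \<delta>2(2) subsetD[OF nbhd3_mono[OF \<delta>(3)] that]] by simp
  have diag: "\<eta>sub \<theta> \<theta> \<eta> = \<eta>" if "\<theta> \<in> \<Theta>" "\<eta> \<in> H" for \<theta> \<eta>
    using A2 that unfolding is_submodel_def by blast
  have env: "smooth_envelopes P lik \<eta>sub ?V"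
    by (rule smooth_envelopes_mono[OF \<delta>4(2) nbhd3_mono[OF \<delta>(4)]])
  have T_V: "(\<theta>0, \<theta>0, \<eta>) \<in> ?V" "(\<theta>0, \<theta>0, \<eta>) \<in> nbhd3 \<Theta> H \<theta>0 \<eta>0 \<delta>5" if "\<eta> \<in> ?T" for \<eta>
    using that \<delta> truth by (auto simp: nbhd3_def)
  have \<eta>0_T: "\<eta>0 \<in> ?T" using truth \<delta> by simp
  have int1: "integrable P (?d 1 0 \<theta>0 \<theta>0 \<eta>)" if "\<eta> \<in> ?T" for \<eta>
    by (rule smooth_envelopes_integrable[OF env _ T_V(1)[OF that]]) simp
  \<comment> \<open>At \<open>\<eta> = \<eta>0\<close> the quadratic bound on the mean of the score is zero.\<close>
  have mean1: "(\<integral>x. ?d 1 0 \<theta>0 \<theta>0 \<eta>0 x \<partial>P) = 0"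
    using C6 truth(2) \<delta>6(1) unfolding dl by fastforce
  have mean11: "(\<integral>x. ?d 1 1 \<theta>0 \<theta>0 \<eta>0 x \<partial>P) = 0"
    by (rule mixed_derivative_mean[OF env \<delta>(1) box truth(2) A4(3)[unfolded dl]])
  have eff_L2: "L2_fun P eff" unfolding truth(3) by (rule efficient_score_L2[OF eff])
  have score_meas: "?d 1 0 \<theta>0 \<theta>0 \<eta>0 \<in> borel_measurable P"
    using int1[OF \<eta>0_T] by (rule borel_measurable_integrable)
  have ae: "AE x in P. ?d 1 0 \<theta>0 \<theta>0 \<eta>0 x = eff x"
    using least_favorable unfolding dl .
  have eff_meas: "eff \<in> borel_measurable P" using eff_L2 unfolding L2_fun_def by blast
  have score_L2: "L2_fun P (?d 1 0 \<theta>0 \<theta>0 \<eta>0)"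
  proof -
    have "integrable P (\<lambda>x. (?d 1 0 \<theta>0 \<theta>0 \<eta>0 x)\<^sup>2) \<longleftrightarrow> integrable P (\<lambda>x. (eff x)\<^sup>2)"
      using ae score_meas eff_meas by (intro integrable_cong_AE) auto
    then show ?thesis using eff_L2 score_meas unfolding L2_fun_def by blast
  qed
  have info: "(\<integral>x. ?d 2 0 \<theta>0 \<theta>0 \<eta>0 x \<partial>P) = - I0"
  proof -
    have "(\<integral>x. eff x \<partial>P) = (\<integral>x. ?d 1 0 \<theta>0 \<theta>0 \<eta>0 x \<partial>P)"
      using ae score_meas eff_meas by (intro integral_cong_AE) auto
    then have "I0 = (\<integral>x. (eff x)\<^sup>2 \<partial>P)" using mean1 by (simp add: I0 efficient_info_def)
    also have "\<dots> = (\<integral>x. (?d 1 0 \<theta>0 \<theta>0 \<eta>0 x)\<^sup>2 \<partial>P)"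
      using ae score_meas eff_meas by (intro integral_cong_AE) auto
    finally show ?thesis using A4(2) unfolding dl by linarith
  qed
  define as where "as n \<omega> \<longleftrightarrow> is_mle \<Theta> H lik n (?xs \<omega>) (\<theta>hat n \<omega>) (\<eta>hat n \<omega>) \<and>
      (\<forall>i. ell_smooth lik \<eta>sub ?V (X i \<omega>)) \<and>
      (\<lambda>\<theta>. \<rho> \<theta> * ?pl n \<omega> \<theta>) \<in> borel_measurable borel" for n \<omega>
  have sm: "AE x in P. ell_smooth lik \<eta>sub ?V x" using env unfolding smooth_envelopes_def by (rule conjunct1)
  have as: "AE \<omega> in M. as n \<omega>" for n
    using mle[of n] AE_all_X[OF sm] posterior_measurable[of n] unfolding as_def by (simp add: AE_conj_iff)
  \<comment> \<open>The maximal likelihood is positive because the likelihood at the truth is, almost surely.\<close>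
  have good: "AE \<omega> in M. is_mle \<Theta> H lik n (?xs \<omega>) (\<theta>hat n \<omega>) (\<eta>hat n \<omega>) \<and> 0 < ?pl n \<omega> (\<theta>hat n \<omega>)" for n
    using as[of n]
  proof eventually_elim
    case (elim \<omega>)
    then have m: "is_mle \<Theta> H lik n (?xs \<omega>) (\<theta>hat n \<omega>) (\<eta>hat n \<omega>)" by (simp add: as_def)
    have "0 < lik \<theta>0 (\<eta>sub \<theta>0 \<theta>0 \<eta>0) (X i \<omega>)" for i
      using elim T_V(1)[OF \<eta>0_T] unfolding as_def ell_smooth_def by blast
    then have "0 < lik_n lik n (?xs \<omega>) \<theta>0 \<eta>0"
      unfolding lik_n_def using diag truth by (intro prod_pos) simp
    also have "\<dots> \<le> lik_n lik n (?xs \<omega>) (\<theta>hat n \<omega>) (\<eta>hat n \<omega> (\<theta>hat n \<omega>))"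
      using m truth unfolding is_mle_def by blast
    also have "\<dots> = ?pl n \<omega> (\<theta>hat n \<omega>)"
      using m by (intro prof_lik_attained[symmetric]) (auto simp: is_mle_def)
    finally show ?case using m by blast
  qed
  interpret L: identifiable_profile M ?xs lik \<Theta> H \<theta>0 \<theta>hat \<eta>hat
    by (rule identifiable_profile.intro) (fact truth(1), fact good, rule consistency)
  \<comment> \<open>Each of the following events grows with \<open>K\<close>, so that they can be intersected with a common constant.\<close>
  define rem where "rem l m K n \<omega> \<longleftrightarrow>
      (\<forall>(t, \<theta>, \<eta>)\<in>?V. \<bar>?S l m t \<theta> \<eta> n \<omega>\<bar> \<le> K)" for l m and K :: real and n \<omega>
  define sc where "sc K n \<omega> \<longleftrightarrow>
      \<bar>?S 1 0 \<theta>0 \<theta>0 \<eta>0 n \<omega>\<bar> \<le> K * (1 / sqrt n)" for K n \<omega>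
  define nu10 where "nu10 K n \<omega> \<longleftrightarrow> (\<forall>\<eta>\<in>?T. \<bar>?S 1 0 \<theta>0 \<theta>0 \<eta> n \<omega>
        - ?S 1 0 \<theta>0 \<theta>0 \<eta>0 n \<omega>\<bar>
      \<le> K * (1 / sqrt n * norm (\<eta> - \<eta>0) + (norm (\<eta> - \<eta>0))\<^sup>2))" for K n \<omega>
  define nu where "nu l m a K n \<omega> \<longleftrightarrow> (\<forall>\<eta>\<in>?T.
      \<bar>?S l m \<theta>0 \<theta>0 \<eta> n \<omega> - a\<bar>
        \<le> K * (1 / sqrt n + norm (\<eta> - \<eta>0)))" for l m and a :: real and K n \<omega>
  define rt where "rt K n \<omega> \<longleftrightarrow> (\<forall>\<psi>\<in>\<Theta>. K * \<bar>\<psi> - \<theta>0\<bar> < 1 \<longrightarrow>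
      norm (\<eta>hat n \<omega> \<psi> - \<eta>0) \<le> K * (1 / sqrt n + \<bar>\<psi> - \<theta>0\<bar>))" for K n \<omega>
  have mono_rem: "mono (rem l m)" for l m
  proof -
    have "rem l m K n \<omega> \<longleftrightarrow> (\<forall>v\<in>?V. \<bar>emp_mean n ((\<lambda>(t, \<theta>, \<eta>). ?d l m t \<theta> \<eta>) v) (?xs \<omega>)\<bar> \<le> K * 1)"
      for K n \<omega> unfolding rem_def by (simp add: case_prod_unfold)
    then have "rem l m = (\<lambda>K n \<omega>. \<forall>v\<in>?V.
        \<bar>emp_mean n ((\<lambda>(t, \<theta>, \<eta>). ?d l m t \<theta> \<eta>) v) (?xs \<omega>)\<bar> \<le> K * 1)"
      by (intro ext)
    then show ?thesis by (simp only: mono_boundI[of "\<lambda>_ _. 1"] zero_le_one)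
  qed
  have mono_sc: "mono sc"
    unfolding sc_def[abs_def] using mono_boundI[of "\<lambda>n _. 1 / sqrt (real n)" "{()}"] by simp
  have mono_nu10: "mono nu10"
    unfolding nu10_def[abs_def] by (rule mono_boundI) simp
  have mono_nu: "mono (nu l m a)" for l m a
    unfolding nu_def[abs_def] by (rule mono_boundI) simp
  have mono_rt: "mono rt"
    unfolding mono_def le_fun_def le_bool_def rt_def
  proof (intro allI impI ballI)
    fix K K' :: real and n \<omega> \<psi>
    assume KK: "K \<le> K'" and all: "\<forall>\<psi>\<in>\<Theta>. K * \<bar>\<psi> - \<theta>0\<bar> < 1 \<longrightarrow>
        norm (\<eta>hat n \<omega> \<psi> - \<eta>0) \<le> K * (1 / sqrt n + \<bar>\<psi> - \<theta>0\<bar>)"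
      and \<psi>: "\<psi> \<in> \<Theta>" "K' * \<bar>\<psi> - \<theta>0\<bar> < 1"
    have "K * \<bar>\<psi> - \<theta>0\<bar> < 1" using mult_right_mono[OF KK abs_ge_zero[of "\<psi> - \<theta>0"]] \<psi>(2) by linarith
    with all \<psi>(1) have "norm (\<eta>hat n \<omega> \<psi> - \<eta>0) \<le> K * (1 / sqrt n + \<bar>\<psi> - \<theta>0\<bar>)" by blast
    then show "norm (\<eta>hat n \<omega> \<psi> - \<eta>0) \<le> K' * (1 / sqrt n + \<bar>\<psi> - \<theta>0\<bar>)"
      using mult_right_mono[OF KK, of "1 / sqrt n + \<bar>\<psi> - \<theta>0\<bar>"] by simp
  qed
  have likely_rem: "likely M (rem l m)"
    if "(l, m) \<in> {(0, 0), (1, 0), (2, 0), (3, 0), (1, 1), (1, 2), (2, 1)}" for l m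
    unfolding rem_def[abs_def] by (rule likely_derivative_bound[OF env that])
  have likely_sc: "likely M sc"
    unfolding sc_def[abs_def] by (rule likely_emp_mean_centered[OF score_L2 mean1])
  have likely_nu10: "likely M nu10"
    unfolding nu10_def[abs_def]
  proof (rule likely_score_nuisance[where C = C6])
    show "bigOp_on M ?T (\<lambda>n \<eta> \<omega>. emp_proc P n (\<lambda>x. ?d 1 0 \<theta>0 \<theta>0 \<eta> x
        - ?d 1 0 \<theta>0 \<theta>0 \<eta>0 x) (?xs \<omega>)) (\<lambda>\<eta>. norm (\<eta> - \<eta>0))"
      by (rule bigOp_on_subset[OF \<delta>6(2)[unfolded dl]]) (use \<delta>(6) in auto)
    show "\<bar>\<integral>x. ?d 1 0 \<theta>0 \<theta>0 \<eta> x \<partial>P\<bar> \<le> C6 * (norm (\<eta> - \<eta>0))\<^sup>2" if "\<eta> \<in> ?T" for \<eta>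
      using C6 that \<delta>(6) unfolding dl by fastforce
  qed (use int1 \<eta>0_T mean1 in auto)
  have likely_nu20: "likely M (nu 2 0 (- I0))"
    unfolding nu_def[abs_def]
  proof (rule likely_donsker_nuisance[OF \<delta>5(2) T_V(2)])
    show "\<bar>(\<integral>x. ?d 2 0 \<theta>0 \<theta>0 \<eta> x \<partial>P) - - I0\<bar> \<le> C6 * norm (\<eta> - \<eta>0)" if "\<eta> \<in> ?T" for \<eta>
      using C6 that \<delta>(6) unfolding dl info[symmetric] by fastforce
  qed
  have likely_nu11: "likely M (nu 1 1 0)"
    unfolding nu_def[abs_def]
  proof (rule likely_donsker_nuisance[OF \<delta>5(3) T_V(2)])
    show "\<bar>(\<integral>x. ?d 1 1 \<theta>0 \<theta>0 \<eta> x \<partial>P) - 0\<bar> \<le> C6 * norm (\<eta> - \<eta>0)" if "\<eta> \<in> ?T" for \<eta>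
      using C6 that \<delta>(6) unfolding dl mean11[symmetric] by fastforce
  qed
  have likely_rt: "likely M rt"
    unfolding rt_def[abs_def] by (rule likely_nuisance_rate[OF truth(1) A3])
  define ev where "ev K n \<omega> \<longleftrightarrow> as n \<omega> \<and> rem 3 0 K n \<omega> \<and> rem 1 2 K n \<omega> \<and> rem 2 1 K n \<omega> \<and>
      sc K n \<omega> \<and> nu10 K n \<omega> \<and> nu 2 0 (- I0) K n \<omega> \<and> nu 1 1 0 K n \<omega> \<and> rt K n \<omega>" for K n \<omega>
  have mono_as: "mono (\<lambda>_::real. as)" by (simp add: mono_def)
  note ev_monos = mono_as mono_rem mono_sc mono_nu10 mono_nu mono_rt
  have ev: "likely M ev" "mono ev"
    unfolding ev_def[abs_def]
    by (intro likely_conj mono_conj ev_monos likely_AE as likely_rem likely_sc likely_nu10 likely_nu20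
        likely_nu11 likely_rt; simp)+
  have regular: "regular_sample lik \<eta>sub \<Theta> H \<theta>0 \<eta>0 \<delta> I0 K n (?xs \<omega>) (\<theta>hat n \<omega>) (\<eta>hat n \<omega>)"
    if "ev K n \<omega>" "1 \<le> K" for K n \<omega>
  proof
    have *: "as n \<omega>" "rem 3 0 K n \<omega>" "rem 1 2 K n \<omega>" "rem 2 1 K n \<omega>" "sc K n \<omega>" "nu10 K n \<omega>"
      "nu 2 0 (- I0) K n \<omega>" "nu 1 1 0 K n \<omega>" "rt K n \<omega>" using that(1) by (simp_all add: ev_def)
    show "1 \<le> K" by (rule that(2))
    show "is_mle \<Theta> H lik n (?xs \<omega>) (\<theta>hat n \<omega>) (\<eta>hat n \<omega>)" "ell_smooth lik \<eta>sub ?V (X i \<omega>)" for i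
      using *(1) by (auto simp: as_def)
    show "\<bar>?S 3 0 t \<theta> \<eta> n \<omega>\<bar> \<le> K \<and>
        \<bar>?S 1 2 t \<theta> \<eta> n \<omega>\<bar> \<le> K \<and>
        \<bar>?S 2 1 t \<theta> \<eta> n \<omega>\<bar> \<le> K" if "(t, \<theta>, \<eta>) \<in> ?V" for t \<theta> \<eta>
      using bspec[OF *(2)[unfolded rem_def] that] bspec[OF *(3)[unfolded rem_def] that]
        bspec[OF *(4)[unfolded rem_def] that] by simp
    show "\<bar>?S 1 0 \<theta>0 \<theta>0 \<eta>0 n \<omega>\<bar> \<le> K * (1 / sqrt n)"
      using *(5) unfolding sc_def .
    fix \<eta> assume "\<eta> \<in> H" "norm (\<eta> - \<eta>0) < \<delta>"
    then have \<eta>: "\<eta> \<in> ?T" by simp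
    show "\<bar>?S 1 0 \<theta>0 \<theta>0 \<eta> n \<omega>
            - ?S 1 0 \<theta>0 \<theta>0 \<eta>0 n \<omega>\<bar>
          \<le> K * (1 / sqrt n * norm (\<eta> - \<eta>0) + (norm (\<eta> - \<eta>0))\<^sup>2) \<and>
        \<bar>?S 1 1 \<theta>0 \<theta>0 \<eta> n \<omega>\<bar> \<le> K * (1 / sqrt n + norm (\<eta> - \<eta>0)) \<and>
        \<bar>?S 2 0 \<theta>0 \<theta>0 \<eta> n \<omega> + I0\<bar> \<le> K * (1 / sqrt n + norm (\<eta> - \<eta>0))"
      using bspec[OF *(6)[unfolded nu10_def] \<eta>] bspec[OF *(7)[unfolded nu_def] \<eta>]
        bspec[OF *(8)[unfolded nu_def] \<eta>] unfolding diff_minus_eq_add diff_0_right by blast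
  next
    show "norm (\<eta>hat n \<omega> \<psi> - \<eta>0) \<le> K * (1 / sqrt n + \<bar>\<psi> - \<theta>0\<bar>)"
      if "\<psi> \<in> \<Theta>" "K * \<bar>\<psi> - \<theta>0\<bar> < 1" for \<psi>
      using \<open>ev K n \<omega>\<close> that unfolding ev_def rt_def by blast
  qed
  obtain \<delta>\<rho> L where \<delta>\<rho>: "0 < \<delta>\<rho>" "0 \<le> L"
    "\<And>\<theta>. \<bar>\<theta> - \<theta>0\<bar> < \<delta>\<rho> \<Longrightarrow> \<bar>\<rho> \<theta> - \<rho> \<theta>0\<bar> \<le> L * \<bar>\<theta> - \<theta>0\<bar>"
    by (rule prior_locally_lipschitz[OF prior(3)]) blast
  obtain D where D: "\<And>\<theta> \<theta>'. \<theta> \<in> \<Theta> \<Longrightarrow> \<theta>' \<in> \<Theta> \<Longrightarrow> \<bar>\<theta> - \<theta>'\<bar> \<le> D" and "0 \<le> D"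
  proof -
    from compact_imp_bounded[OF A1(1)] obtain B where B: "\<forall>\<theta>\<in>\<Theta>. \<bar>\<theta>\<bar> \<le> B"
      unfolding bounded_iff real_norm_def by blast
    show ?thesis
    proof (rule that[of "2 * \<bar>B\<bar>"])
      fix \<theta> \<theta>' assume "\<theta> \<in> \<Theta>" "\<theta>' \<in> \<Theta>"
      then have "\<bar>\<theta>\<bar> \<le> B" "\<bar>\<theta>'\<bar> \<le> B" using B by auto
      then show "\<bar>\<theta> - \<theta>'\<bar> \<le> 2 * \<bar>B\<bar>" by linarith
    qed simp
  qed
  show ?thesis
    unfolding bigOp_def
  proof (intro allI impI)
    fix \<epsilon> :: real assume \<epsilon>: "0 < \<epsilon>"
    then have \<epsilon>3: "0 < \<epsilon> / 3" by simp
    obtain K where K: "1 \<le> K"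
      "\<forall>\<^sub>F n in sequentially. outer_measure_of M {\<omega> \<in> space M. \<not> ev K n \<omega>} < ennreal (\<epsilon> / 3)"
      by (rule likely_ge[OF ev \<epsilon>3])
    define K3 where "K3 = expansion_const I0 K"
    have K3: "0 < K3" "0 < score_const K" using expansion_consts[OF A7 K(1)] by (simp_all add: K3_def)
    \<comment> \<open>a radius at which both the expansion and the Laplace approximation are valid for this \<open>K\<close>; only then is the separation
      rate \<open>c\<close> chosen, since it depends on the radius\<close>
    define r0 where "r0 = Min {\<delta>, 1 / K, \<delta> / (4 * K), I0 / (16 * score_const K), \<delta>\<rho>, I0 / (16 * K3), 1 / (4 * K3)}"
    have r0: "0 < r0" "r0 \<le> \<delta>" "r0 \<le> 1 / K" "r0 \<le> \<delta> / (4 * K)" "r0 \<le> I0 / (16 * score_const K)"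
      "r0 \<le> \<delta>\<rho>" "r0 \<le> I0 / (16 * K3)" "r0 \<le> 1 / (4 * K3)"
      unfolding r0_def using \<delta>(1) K(1) K3 A7 \<delta>\<rho>(1) by (simp_all del: Min_insert)
    have r0': "K * r0 \<le> 1" "K * r0 \<le> \<delta> / 4" "16 * score_const K * r0 \<le> I0" "16 * K3 * r0 \<le> I0" "4 * K3 * r0 \<le> 1"
      using r0 K(1) K3 by (simp_all add: pos_le_divide_eq mult_ac)
    obtain c :: real where c: "0 < c"
      "\<forall>\<^sub>F n in sequentially. outer_measure_of M {\<omega> \<in> space M. \<not> (\<forall>\<psi>\<in>\<Theta>. r0 \<le> \<bar>\<psi> - \<theta>0\<bar> \<longrightarrow>
        ?pl n \<omega> \<psi> \<le> ?pl n \<omega> (\<theta>hat n \<omega>) * exp (- (c * n)))} < ennreal (\<epsilon> / 3)"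
      by (rule L.profile_separation[OF r0(1) \<epsilon>3])
    have "0 < r0 / 2" using r0(1) by simp
    have cons: "\<forall>\<^sub>F n in sequentially. outer_measure_of M
        {\<omega> \<in> space M. \<not> (\<theta>hat n \<omega> \<in> \<Theta> \<longrightarrow> \<bar>\<theta>hat n \<omega> - \<theta>0\<bar> \<le> r0 / 2)} < ennreal (\<epsilon> / 3)"
      by (rule L.mle_consistent[OF \<open>0 < r0 / 2\<close> \<epsilon>3])
    have \<rho>: "\<rho> \<in> borel_measurable borel" "\<And>\<theta>. 0 \<le> \<rho> \<theta>" "\<And>\<theta>. \<theta> \<notin> \<Theta> \<Longrightarrow> \<rho> \<theta> = 0"
      "(\<integral>\<^sup>+\<theta>. ennreal (\<rho> \<theta>) \<partial>lborel) = 1" using prior(1) unfolding proper_prior_def by blast+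
    have lip: "\<bar>\<rho> \<theta> - \<rho> \<theta>0\<bar> \<le> L * \<bar>\<theta> - \<theta>0\<bar>" if "\<bar>\<theta> - \<theta>0\<bar> < r0" for \<theta>
      using that r0(6) by (intro \<delta>\<rho>(3)) simp
    obtain s0 C where s0: "0 < s0" and post:
      "\<And>s \<theta>h pl. \<lbrakk>0 < s; s \<le> s0; near_gaussian_profile I0 K3 c r0 D \<theta>0 \<rho> s \<theta>h pl\<rbrakk> \<Longrightarrow>
         \<bar>(\<integral>\<theta>. ((\<theta> - \<theta>h) * sqrt I0) ^ r \<partial>profile_posterior \<rho> pl)
            - s ^ r * (\<integral>u. u ^ r \<partial>std_normal_distribution)\<bar> \<le> C * s ^ (r + 1)"
      by (rule posterior_moment_expansion[OF A7 less_imp_le[OF K3(1)] \<delta>\<rho>(2) prior(2) r0(1) c(1) \<open>0 \<le> D\<close>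
            r0'(4,5) \<rho>(1,2,4) lip, of r]) (assumption, rule that)
    have small: "\<forall>\<^sub>F n in sequentially. 1 / sqrt (real n) < x" if "0 < x" for x
    proof -
      have "(\<lambda>n. 1 / sqrt (real n)) \<longlonglongrightarrow> 0"
        by (intro tendsto_divide_0[OF tendsto_const] filterlim_at_top_imp_at_infinity
            filterlim_compose[OF sqrt_at_top filterlim_real_sequentially])
      then show ?thesis using that by (rule order_tendstoD)
    qed
    have "0 < \<delta> / (4 * K)" using \<delta>(1) K(1) by simp
    from K(2) c(2) cons small[OF s0] small[OF this] eventually_ge_at_top[of 1]
    have "\<forall>\<^sub>F n in sequentially. outer_measure_of M {\<omega> \<in> space M. C * real n powr (- (real r + 1) / 2)
        < ?dev n \<omega>} < ennreal \<epsilon>"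
    proof eventually_elim
      case (elim n)
      define s where "s = 1 / sqrt (real n)"
      have n: "1 \<le> n" by (rule elim(6))
      have s: "0 < s" "s \<le> s0" "s < \<delta> / (4 * K)" using elim by (auto simp: s_def)
      have s2: "s\<^sup>2 = 1 / n" using n by (simp add: s_def power_divide)
      define sep where "sep \<omega> \<longleftrightarrow> (\<forall>\<psi>\<in>\<Theta>. r0 \<le> \<bar>\<psi> - \<theta>0\<bar> \<longrightarrow>
          ?pl n \<omega> \<psi> \<le> ?pl n \<omega> (\<theta>hat n \<omega>) * exp (- (c * n)))" for \<omega>
      define con where "con \<omega> \<longleftrightarrow> (\<theta>hat n \<omega> \<in> \<Theta> \<longrightarrow> \<bar>\<theta>hat n \<omega> - \<theta>0\<bar> \<le> r0 / 2)" for \<omega>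
      note outer = elim(1) elim(3)[folded con_def] elim(2)[folded sep_def]
      have dev_le: "?dev n \<omega> \<le> C * real n powr (- (real r + 1) / 2)"
        if \<omega>: "\<omega> \<in> space M" and E: "ev K n \<omega>" and con: "con \<omega>" and sep: "sep \<omega>" for \<omega>
      proof -
        interpret S: regular_sample lik \<eta>sub \<Theta> H \<theta>0 \<eta>0 \<delta> I0 K n "?xs \<omega>" "\<theta>hat n \<omega>" "\<eta>hat n \<omega>"
          by (rule regular[OF E K(1)])
        have in\<Theta>: "\<theta>hat n \<omega> \<in> \<Theta>" using S.mle unfolding is_mle_def by blast
        have hat: "\<bar>\<theta>hat n \<omega> - \<theta>0\<bar> < r0" using con in\<Theta> r0(1) unfolding con_def by linarith
        have Ks: "K * (1 / sqrt n + r0) < \<delta>"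
        proof -
          have "K * s < \<delta> / 4" using s(3) K(1) by (simp add: pos_less_divide_eq mult_ac)
          then show ?thesis using r0'(2) \<delta>(1) by (simp add: s_def[symmetric] distrib_left)
        qed
        note exp = S.profile_expansion[OF _ _ _ A7 n r0(1,2) r0'(1) Ks r0'(3) hat, folded K3_def s_def]
        have rate: "\<bar>\<theta>hat n \<omega> - \<theta>0\<bar> \<le> K3 * s" by (rule exp(1)) (fact box sub diag)+
        have pos: "0 < ?pl n \<omega> (\<theta>hat n \<omega>)" by (rule exp(2)) (fact box sub diag)+
        have near: "0 < ?pl n \<omega> \<theta> \<and> \<bar>ln (?pl n \<omega> \<theta> / ?pl n \<omega> (\<theta>hat n \<omega>)) + I0 * (\<theta> - \<theta>hat n \<omega>)\<^sup>2 / (2 * s\<^sup>2)\<bar>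
            \<le> K3 * \<bar>\<theta> - \<theta>hat n \<omega>\<bar> * (s + \<bar>\<theta> - \<theta>hat n \<omega>\<bar>)\<^sup>2 / s\<^sup>2" if "\<bar>\<theta> - \<theta>0\<bar> < r0" for \<theta>
        proof -
          have "0 < ?pl n \<omega> \<theta> \<and> \<bar>ln (?pl n \<omega> \<theta> / ?pl n \<omega> (\<theta>hat n \<omega>)) + n * I0 * (\<theta> - \<theta>hat n \<omega>)\<^sup>2 / 2\<bar>
              \<le> K3 * n * \<bar>\<theta> - \<theta>hat n \<omega>\<bar> * (s + \<bar>\<theta> - \<theta>hat n \<omega>\<bar>)\<^sup>2"
            by (rule exp(3)) (fact box sub diag that)+
          then show ?thesis by (simp add: s2 mult_ac)
        qed
        have far: "0 \<le> ?pl n \<omega> \<theta> \<and> ?pl n \<omega> \<theta> \<le> ?pl n \<omega> (\<theta>hat n \<omega>) * exp (- c / s\<^sup>2)"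
          if "r0 \<le> \<bar>\<theta> - \<theta>0\<bar>" "\<rho> \<theta> \<noteq> 0" for \<theta>
        proof -
          have \<theta>: "\<theta> \<in> \<Theta>" using that \<rho>(3) by blast
          have "\<eta>hat n \<omega> \<theta> \<in> H" using S.mle \<theta> unfolding is_mle_def by blast
          moreover have "X i \<omega> \<in> space \<mu>" for i
            using measurable_space[OF X_measurable \<omega>, of i] by (simp add: truth(3) law_def)
          ultimately have "0 \<le> lik \<theta> (\<eta>hat n \<omega> \<theta>) (X i \<omega>)" for i
            using model \<theta> unfolding semiparametric_model_def by blast
          then have "0 \<le> ?pl n \<omega> \<theta>"
            unfolding prof_lik_attained[OF S.mle \<theta>] lik_n_def by (intro prod_nonneg) blast
          then show ?thesis using sep \<theta> that(1) unfolding sep_def by (simp add: s2)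
        qed
        have meas: "(\<lambda>\<theta>. \<rho> \<theta> * ?pl n \<omega> \<theta>) \<in> borel_measurable borel" using E by (simp add: ev_def as_def)
        have supp: "\<bar>\<theta> - \<theta>hat n \<omega>\<bar> \<le> D" if "\<rho> \<theta> \<noteq> 0" for \<theta> using that \<rho>(3) in\<Theta> by (intro D) auto
        have "near_gaussian_profile I0 K3 c r0 D \<theta>0 \<rho> s (\<theta>hat n \<omega>) (?pl n \<omega>)"
          unfolding near_gaussian_profile_def using rate pos meas supp near far by blast
        note dev = post[OF s(1,2) this]
        have sr: "s ^ r = real n powr (- real r / 2)" unfolding s_def by (rule power_inverse_sqrt[OF n])
        have sr1: "s ^ (r + 1) = real n powr (- (real r + 1) / 2)"
          unfolding s_def power_inverse_sqrt[OF n] of_nat_add of_nat_1 ..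
        show ?thesis using dev unfolding sr sr1 .
      qed
      have "{\<omega> \<in> space M. C * real n powr (- (real r + 1) / 2) < ?dev n \<omega>}
          \<subseteq> {\<omega> \<in> space M. \<not> (ev K n \<omega> \<and> (con \<omega> \<and> sep \<omega>))}"
      proof (rule Collect_mono, rule impI)
        fix \<omega> assume *: "\<omega> \<in> space M \<and> C * real n powr (- (real r + 1) / 2) < ?dev n \<omega>"
        show "\<omega> \<in> space M \<and> \<not> (ev K n \<omega> \<and> (con \<omega> \<and> sep \<omega>))"
        proof (rule conjI[OF conjunct1[OF *]], rule notI)
          assume E: "ev K n \<omega> \<and> (con \<omega> \<and> sep \<omega>)"
          have "?dev n \<omega> \<le> C * real n powr (- (real r + 1) / 2)"
            using * E by (intro dev_le) (elim conjE, assumption)+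
          from leD[OF this] conjunct2[OF *] show False by (rule notE)
        qed
      qed
      then have "outer_measure_of M {\<omega> \<in> space M. C * real n powr (- (real r + 1) / 2) < ?dev n \<omega>}
          \<le> outer_measure_of M {\<omega> \<in> space M. \<not> (ev K n \<omega> \<and> (con \<omega> \<and> sep \<omega>))}"
        by (rule outer_measure_of_mono)
      also have "\<dots> < ennreal (\<epsilon> / 3 + (\<epsilon> / 3 + \<epsilon> / 3))"
        by (intro outer_measure_conj_less outer) (use \<epsilon>3 in linarith)+
      also have "\<epsilon> / 3 + (\<epsilon> / 3 + \<epsilon> / 3) = \<epsilon>" by simp
      finally show ?case .
    qed
    then show "\<exists>C. \<forall>\<^sub>F n in sequentially. outer_measure_of M {\<omega> \<in> space M. C * real n powr (- (real r + 1) / 2)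
        < ?dev n \<omega>} < ennreal \<epsilon>" by blast
  qed
qed

end
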